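(* Let $H$ be a fixed graph with $|V(H)| = r$. There is an algorithm which, given an undirected graph $G=(V,E)$ on $n$ vertices of tree-width at most $t$ together with a nice tree decomposition of $G$ of width at most $t$ having $O(n)$ nodes, decides in time $2^{O(t^r)}\cdot n$ whether $V$ can be partitioned into two non-empty sets $A, B$ such that neither of the induced subgraphs $G[A]$ and $G[B]$ contains $H$ as a subgraph.
   Context: A tree decomposition of $G=(V,E)$ is a pair $(T,\{X_i : i\in I\})$ with $T$ a tree on node set $I$ and bags $X_i\subseteq V$ such that every vertex lies in some bag, every edge has both endpoints in some bag, and for each vertex $v$ the nodes whose bags contain $v$ induce a connected subtree of $T$; its width is $\max_i |X_i|-1$, and the tree-width of $G$ is the minimum width over all tree decompositions. A nice tree decomposition is a rooted tree decomposition in which every node is a leaf node (empty bag), an introduce node (one child, bag equals the child's bag plus one vertex), a forget node (one child, bag equals the child's bag minus one vertex), or a join node (two children with bags equal to its own). For $S\subseteq V$, $G[S]$ is the induced subgraph on $S$. "Contains $H$ as a subgraph" means some (not necessarily induced) subgraph is isomorphic to $H$. *)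

theory Defs
  imports Complex_Main "HOL-Library.Landau_Symbols" "Graph_Theory.Graph_Theory"
begin

section \<open>Graphs and tree decompositions\<close>

text \<open>
  Finite simple undirected graphs are the symmetric loop-free digraphs of the locale
  \<open>pair_graph\<close>. The library's \<open>forest\<close> and \<open>tree\<close> are not suitable for them: in a symmetric
  digraph the walk \<open>a, b, a\<close> counts as a \<open>cycle\<close>. The cycles of an undirected graph are the
  library's cycles of length at least 3.
\<close>

definition undirected_tree :: "'a pair_pre_digraph \<Rightarrow> bool" where
  "undirected_tree T \<longleftrightarrow>
     pair_graph T \<and> Digraph_Component.connected (with_proj T) \<and>
     \<not> (\<exists>p. pre_digraph.cycle (with_proj T) p \<and> 3 \<le> length p)"

definition contains_subgraph :: "('a, 'b) pre_digraph \<Rightarrow> ('c, 'd) pre_digraph \<Rightarrow> bool" where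
  "contains_subgraph G H \<longleftrightarrow> (\<exists>S. subgraph S G \<and> digraph_iso H S)"

definition tree_decomposition ::
    "'v pair_pre_digraph \<Rightarrow> 'i pair_pre_digraph \<Rightarrow> ('i \<Rightarrow> 'v set) \<Rightarrow> bool" where
  "tree_decomposition G T X \<longleftrightarrow>
     undirected_tree T \<and>
     (\<forall>i \<in> pverts T. X i \<subseteq> pverts G) \<and>
     (\<forall>v \<in> pverts G. \<exists>i \<in> pverts T. v \<in> X i) \<and>
     (\<forall>(u, v) \<in> parcs G. \<exists>i \<in> pverts T. u \<in> X i \<and> v \<in> X i) \<and>
     (\<forall>v \<in> pverts G. Digraph_Component.connected (with_proj T \<restriction> {i \<in> pverts T. v \<in> X i}))"

text \<open>The width is an integer because it is \<open>-1\<close> when all bags are empty.\<close>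

definition width :: "'i pair_pre_digraph \<Rightarrow> ('i \<Rightarrow> 'v set) \<Rightarrow> int" where
  "width T X = int (Max ((\<lambda>i. card (X i)) ` pverts T)) - 1"

text \<open>Trees are finite, so trees on natural numbers suffice for the minimum.\<close>

definition tree_width :: "'v pair_pre_digraph \<Rightarrow> int" where
  "tree_width G =
     (LEAST w. \<exists>(T :: nat pair_pre_digraph) X. tree_decomposition G T X \<and> width T X = w)"

text \<open>\<open>j\<close> is a child of \<open>i\<close> if \<open>i\<close> is the last node before \<open>j\<close> on the path from the root to \<open>j\<close>.\<close>

definition children :: "'i pair_pre_digraph \<Rightarrow> 'i \<Rightarrow> 'i \<Rightarrow> 'i set" where
  "children T rt i = {j. \<exists>q. vpath (q @ [i, j]) (with_proj T) \<and> hd (q @ [i, j]) = rt}"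

definition leaf_node ::
    "'i pair_pre_digraph \<Rightarrow> 'i \<Rightarrow> ('i \<Rightarrow> 'v set) \<Rightarrow> 'i \<Rightarrow> bool" where
  "leaf_node T rt X i \<longleftrightarrow> children T rt i = {} \<and> X i = {}"

definition introduce_node ::
    "'i pair_pre_digraph \<Rightarrow> 'i \<Rightarrow> ('i \<Rightarrow> 'v set) \<Rightarrow> 'i \<Rightarrow> bool" where
  "introduce_node T rt X i \<longleftrightarrow>
     (\<exists>c v. children T rt i = {c} \<and> v \<notin> X c \<and> X i = insert v (X c))"

definition forget_node ::
    "'i pair_pre_digraph \<Rightarrow> 'i \<Rightarrow> ('i \<Rightarrow> 'v set) \<Rightarrow> 'i \<Rightarrow> bool" where
  "forget_node T rt X i \<longleftrightarrow>
     (\<exists>c v. children T rt i = {c} \<and> v \<in> X c \<and> X i = X c - {v})"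

definition join_node ::
    "'i pair_pre_digraph \<Rightarrow> 'i \<Rightarrow> ('i \<Rightarrow> 'v set) \<Rightarrow> 'i \<Rightarrow> bool" where
  "join_node T rt X i \<longleftrightarrow>
     (\<exists>c d. c \<noteq> d \<and> children T rt i = {c, d} \<and> X c = X i \<and> X d = X i)"

definition nice_tree_decomposition ::
    "'v pair_pre_digraph \<Rightarrow> 'i pair_pre_digraph \<Rightarrow> 'i \<Rightarrow> ('i \<Rightarrow> 'v set) \<Rightarrow> bool" where
  "nice_tree_decomposition G T rt X \<longleftrightarrow>
     tree_decomposition G T X \<and> rt \<in> pverts T \<and>
     (\<forall>i \<in> pverts T. leaf_node T rt X i \<or> introduce_node T rt X i \<or>
        forget_node T rt X i \<or> join_node T rt X i)"

definition has_free_bipartition :: "'v pair_pre_digraph \<Rightarrow> 'h pair_pre_digraph \<Rightarrow> bool" where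
  "has_free_bipartition G H \<longleftrightarrow>
     (\<exists>A B. A \<union> B = pverts G \<and> A \<inter> B = {} \<and> A \<noteq> {} \<and> B \<noteq> {} \<and>
        \<not> contains_subgraph (with_proj G \<restriction> A) (with_proj H) \<and>
        \<not> contains_subgraph (with_proj G \<restriction> B) (with_proj H))"


section \<open>The machine model\<close>

text \<open>
  A uniform-cost random access machine whose only arithmetic is addition and (truncated)
  subtraction, programmed with structured control flow. A program mentions finitely many
  registers and finitely many unbounded arrays, all holding natural numbers. Interleaving the
  arrays in a single memory changes running times only by a constant factor that depends on the
  program. Multiplication is absent because at unit cost it would produce numbers of
  exponentially many bits.
\<close>

record ram_state =
  reg :: "string \<Rightarrow> nat"
  cell :: "string \<Rightarrow> nat \<Rightarrow> nat"

datatype aexp =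
    Num nat
  | Reg string
  | Cell string aexp
  | Plus aexp aexp
  | Minus aexp aexp

datatype bexp =
    Less aexp aexp
  | Equal aexp aexp
  | Neg bexp
  | Conj bexp bexp

datatype com =
    Skip
  | Assign string aexp
  | Store string aexp aexp
  | Seq com com
  | Cond bexp com com
  | While bexp com

primrec aval :: "aexp \<Rightarrow> ram_state \<Rightarrow> nat" where
  "aval (Num k) s = k"
| "aval (Reg x) s = reg s x"
| "aval (Cell a e) s = cell s a (aval e s)"
| "aval (Plus e1 e2) s = aval e1 s + aval e2 s"
| "aval (Minus e1 e2) s = aval e1 s - aval e2 s"

primrec bval :: "bexp \<Rightarrow> ram_state \<Rightarrow> bool" where
  "bval (Less e1 e2) s \<longleftrightarrow> aval e1 s < aval e2 s"
| "bval (Equal e1 e2) s \<longleftrightarrow> aval e1 s = aval e2 s"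
| "bval (Neg b) s \<longleftrightarrow> \<not> bval b s"
| "bval (Conj b1 b2) s \<longleftrightarrow> bval b1 s \<and> bval b2 s"

primrec acost :: "aexp \<Rightarrow> nat" where
  "acost (Num k) = 1"
| "acost (Reg x) = 1"
| "acost (Cell a e) = acost e + 1"
| "acost (Plus e1 e2) = acost e1 + acost e2 + 1"
| "acost (Minus e1 e2) = acost e1 + acost e2 + 1"

primrec bcost :: "bexp \<Rightarrow> nat" where
  "bcost (Less e1 e2) = acost e1 + acost e2 + 1"
| "bcost (Equal e1 e2) = acost e1 + acost e2 + 1"
| "bcost (Neg b) = bcost b + 1"
| "bcost (Conj b1 b2) = bcost b1 + bcost b2 + 1"

text \<open>
  \<open>runs c s k s'\<close>: started in state \<open>s\<close>, the program \<open>c\<close> terminates in state \<open>s'\<close> after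
  exactly \<open>k\<close> elementary operations.
\<close>

inductive runs :: "com \<Rightarrow> ram_state \<Rightarrow> nat \<Rightarrow> ram_state \<Rightarrow> bool" where
  Skip: "runs Skip s 1 s"
| Assign: "runs (Assign x e) s (acost e + 1) (s\<lparr>reg := (reg s)(x := aval e s)\<rparr>)"
| Store: "runs (Store a i e) s (acost i + acost e + 1)
    (s\<lparr>cell := (cell s)(a := (cell s a)(aval i s := aval e s))\<rparr>)"
| Seq: "runs c1 s k1 s' \<Longrightarrow> runs c2 s' k2 s'' \<Longrightarrow> runs (Seq c1 c2) s (k1 + k2) s''"
| CondTrue: "bval b s \<Longrightarrow> runs c1 s k s' \<Longrightarrow> runs (Cond b c1 c2) s (bcost b + k + 1) s'"
| CondFalse: "\<not> bval b s \<Longrightarrow> runs c2 s k s' \<Longrightarrow> runs (Cond b c1 c2) s (bcost b + k + 1) s'"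
| WhileFalse: "\<not> bval b s \<Longrightarrow> runs (While b c) s (bcost b + 1) s"
| WhileTrue: "bval b s \<Longrightarrow> runs c s k1 s' \<Longrightarrow> runs (While b c) s' k2 s'' \<Longrightarrow>
    runs (While b c) s (bcost b + k1 + k2 + 1) s''"

inductive_cases runs_SkipE: "runs Skip s k s'"
inductive_cases runs_AssignE: "runs (Assign x e) s k s'"
inductive_cases runs_StoreE: "runs (Store a i e) s k s'"
inductive_cases runs_SeqE: "runs (Seq c1 c2) s k s'"
inductive_cases runs_CondE: "runs (Cond b c1 c2) s k s'"
inductive_cases runs_WhileE: "runs (While b c) s k s'"

theorem runs_deterministic:
  "runs c s k s' \<Longrightarrow> runs c s l t' \<Longrightarrow> k = l \<and> s' = t'"
proof (induction arbitrary: l t' rule: runs.induct)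
  case (Skip s)
  then show ?case by (auto elim: runs_SkipE)
next
  case (Assign x e s)
  then show ?case by (auto elim: runs_AssignE)
next
  case (Store a i e s)
  then show ?case by (auto elim: runs_StoreE)
next
  case (Seq c1 s k1 s' c2 k2 s'')
  from Seq.prems show ?case
    by (rule runs_SeqE) (auto dest: Seq.IH)
next
  case (CondTrue b s c1 k s' c2)
  from CondTrue.prems show ?case
    by (rule runs_CondE) (auto dest: CondTrue.IH simp: CondTrue.hyps(1))
next
  case (CondFalse b s c2 k s' c1)
  from CondFalse.prems show ?case
    by (rule runs_CondE) (auto dest: CondFalse.IH simp: CondFalse.hyps(1))
next
  case (WhileFalse b s c)
  from WhileFalse.prems show ?case
    by (rule runs_WhileE) (auto simp: WhileFalse.hyps(1))
next
  case (WhileTrue b s c k1 s' k2 s'')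
  from WhileTrue.prems show ?case
    by (rule runs_WhileE) (auto dest: WhileTrue.IH simp: WhileTrue.hyps(1))
qed


section \<open>Input representation\<close>

text \<open>
  Finite sets \<open>S 0, \<dots>, S (k - 1)\<close> are stored as consecutive blocks of the array \<open>dat\<close>, the
  \<open>i\<close>-th block ranging from index \<open>off i\<close> to \<open>off (i + 1) - 1\<close> and listing \<open>S i\<close> without
  repetition in an arbitrary order.
\<close>

definition stores_sets :: "ram_state \<Rightarrow> string \<Rightarrow> string \<Rightarrow> nat \<Rightarrow> (nat \<Rightarrow> nat set) \<Rightarrow> bool" where
  "stores_sets s off dat k S \<longleftrightarrow>
     cell s off 0 = 0 \<and>
     (\<forall>i < k. cell s off (i + 1) = cell s off i + card (S i) \<and>
        bij_betw (cell s dat) {cell s off i ..< cell s off (i + 1)} (S i))"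

text \<open>
  The graph is given by adjacency lists, the decomposition by the bags and by the lists of
  children. The numbering of the nodes is arbitrary, and node types are not part of the input.
\<close>

definition initial_state ::
    "nat pair_pre_digraph \<Rightarrow> nat pair_pre_digraph \<Rightarrow> nat \<Rightarrow> (nat \<Rightarrow> nat set) \<Rightarrow>
     ram_state \<Rightarrow> bool" where
  "initial_state G T rt X s \<longleftrightarrow>
     pverts G = {..<reg s ''n''} \<and> pverts T = {..<reg s ''m''} \<and> reg s ''root'' = rt \<and>
     stores_sets s ''adj_off'' ''adj'' (reg s ''n'') (\<lambda>u. {v. (u, v) \<in> parcs G}) \<and>
     stores_sets s ''bag_off'' ''bag'' (reg s ''m'') X \<and>
     stores_sets s ''child_off'' ''child'' (reg s ''m'') (children T rt) \<and>
     (\<forall>x. x \<notin> {''n'', ''m'', ''root''} \<longrightarrow> reg s x = 0) \<and>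
     (\<forall>a. a \<notin> {''adj_off'', ''adj'', ''bag_off'', ''bag'', ''child_off'', ''child''} \<longrightarrow>
        cell s a = (\<lambda>_. 0))"

end

theory Submission
  imports Defs
begin

text \<open>
  Dynamic programming over the tree decomposition. For a node \<open>i\<close> and a 2-colouring of the vertices
  in the bags below \<open>i\<close>, record for each colour class which types of partial embeddings of \<open>H\<close> into
  it exist. The type of an embedding says for each of the \<open>r\<close> vertices of \<open>H\<close> whether it is unmapped,
  mapped outside the bag, or at which position of the bag its image is. With bags of size at most
  \<open>t + 1\<close> there are at most \<open>L = (t + 3) ^ r\<close> types, hence at most \<open>N = 2 ^ (2 * L)\<close> states per node.
  A state of a node is determined by states of its children, by one rule for leaf, introduce, forget
  and join nodes alike; whether three states match can be checked by brute force in time polynomial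
  in \<open>N\<close>, that is, in time \<open>2 ^ O(t ^ r)\<close>. Such checks are written as expressions with bounded
  quantifiers, for which a compiler to the machine is verified once and for all: if all loop bounds
  are at most \<open>Q\<close>, the compiled code runs in time polynomial in \<open>Q\<close>.
\<close>

section \<open>Rooted trees\<close>

text \<open>A state lists exactly the types that occur, because acceptance rests on an absence: no
  type maps all of H. Neither the colouring of the bag nor a flag for a non-empty class is stored
  beside it. Read as a code, the number \<open>p + 2\<close> is the type that maps vertex 0 of H to
  bag position \<open>p\<close> and nothing else, so its bits show the colour of that bag vertex; a
  class is non-empty iff a type other than 0 occurs in it. This presupposes a vertex 0, and
  \<open>r = 0\<close> is treated apart.

  The rule common to all nodes rests on separation: the parts below two children meet only inside
  the bag, and an edge with an end outside the bag stays within one part.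

  The rest is imposed by the cost model. With \<open>L = B ^ r\<close> and
  \<open>Q = 2 ^ (2 * L)\<close>, anything polynomial in \<open>Q\<close> is affordable, but the
  numbers n of vertices and m of nodes may enter only linearly. So apart from the maximum over all
  bags, no compiled loop is bounded by n or m, products such as \<open>c * m\<close> are loops over
  the factor \<open>c\<close>, row starts of the adjacency matrix come from repeated addition, and
  an order with children after parents, which the input does not provide, comes from breadth-first
  search.\<close>

lemma pcas_vwalk_arcs: "pcas u (vwalk_arcs (u # p)) (last (u # p))"
  by (induction p arbitrary: u) auto

lemma pawalk_verts_vwalk_arcs: "pawalk_verts u (vwalk_arcs (u # p)) = u # p"
  by (induction p arbitrary: u) auto

text \<open>The list \<open>p\<close> has one entry per arc of the closed walk \<open>a # p\<close>,
  because \<open>a\<close> reappears as its last entry. Hence \<open>3 \<le> length p\<close> leaves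
  aside only loops and the walk along an edge and back.\<close>

lemma undirected_tree_no_closed_walk:
  assumes "undirected_tree T" "vwalk (a # p) (with_proj T)" "last p = a" "distinct p" "3 \<le> length p"
  shows False
proof -
  interpret pair_pre_digraph T .
  have len: "length (vwalk_arcs (a # p)) = length p"
    using vwalk_length_simp[of "a # p", unfolded vwalk_length_def] by (metis diff_Suc_1 length_Cons)
  have "p \<noteq> []"
    using assms(5) by auto
  then have "pre_digraph.awalk (with_proj T) a (vwalk_arcs (a # p)) a"
    using assms(2,3) pcas_vwalk_arcs[of a p]
    unfolding pre_digraph.awalk_def by (auto simp: cas_with_proj_eq vwalk_def)
  then have "pre_digraph.cycle (with_proj T) (vwalk_arcs (a # p))"
    using assms(4) len \<open>p \<noteq> []\<close> unfolding pre_digraph.cycle_def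
    by (metis awalk_verts_with_proj_eq pawalk_verts_vwalk_arcs list.sel(3) length_0_conv)
  then show False
    using assms(1,5) len unfolding undirected_tree_def by auto
qed

lemma vwalk_Cons_iff:
  "p \<noteq> [] \<Longrightarrow> vwalk (a # p) G \<longleftrightarrow> a \<in> verts G \<and> (a, hd p) \<in> arcs_ends G \<and> vwalk p G"
  by (auto simp: vwalk_def)

lemma vwalk_append_iff:
  "p \<noteq> [] \<Longrightarrow> q \<noteq> [] \<Longrightarrow>
    vwalk (p @ q) G \<longleftrightarrow> vwalk p G \<and> vwalk q G \<and> (last p, hd q) \<in> arcs_ends G"
  by (auto simp: vwalk_def vwalk_arcs_append)

lemma vwalk_rev:
  assumes "sym (arcs_ends G)" "vwalk p G"
  shows "vwalk (rev p) G"
  using assms by (auto simp: vwalk_def set_vwalk_arcs_rev sym_def)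

lemma split_list_first_in:
  assumes "set p \<inter> Q \<noteq> {}"
  shows "\<exists>p1 x p2. p = p1 @ x # p2 \<and> x \<in> Q \<and> set p1 \<inter> Q = {}"
  using split_list_first_prop[of p "\<lambda>x. x \<in> Q"] assms by blast

lemma undirected_tree_sym:
  "undirected_tree T \<Longrightarrow> sym (parcs T)"
  unfolding undirected_tree_def
  using pair_graph.axioms(2) pair_pseudo_graph.axioms(2) pair_sym_digraph.pair_sym_arcs
  by (fastforce simp: symmetric_def)

text \<open>Two paths that part after a common prefix and meet again close a cycle: follow the first
  up to the first node shared with the other, then return along the other.\<close>

lemma undirected_tree_unique_vpath:
  assumes T: "undirected_tree T"
  shows "vpath p (with_proj T) \<Longrightarrow> vpath q (with_proj T) \<Longrightarrow> hd p = hd q \<Longrightarrow> last p = last q \<Longrightarrow> p = q"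
proof (induction p arbitrary: q)
  case Nil
  then show ?case by (auto simp: vpath_def vwalk_def)
next
  case (Cons a p)
  obtain q' where q: "q = a # q'"
    using Cons.prems by (cases q) (auto simp: vpath_def vwalk_def)
  consider "p = []" | "q' = []" | "p \<noteq> []" "q' \<noteq> []" "hd p = hd q'"
    | "p \<noteq> []" "q' \<noteq> []" "hd p \<noteq> hd q'"
    by auto
  then show ?case
  proof cases
    case 1
    then show ?thesis
      using Cons.prems q by (cases "q' = []") (auto simp: vpath_def)
  next
    case 2
    then show ?thesis
      using Cons.prems q by (cases "p = []") (auto simp: vpath_def split: if_splits)
  next
    case 3
    then have "p = q'"
      using Cons.prems q by (intro Cons.IH) (auto simp: vpath_def vwalk_Cons_iff)
    then show ?thesis using q by simp
  next
    case 4
    have walks: "vwalk p (with_proj T)" "vwalk q' (with_proj T)"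
      "(a, hd p) \<in> parcs T" "(a, hd q') \<in> parcs T" "a \<in> pverts T"
      "distinct (a # p)" "distinct (a # q')"
      using Cons.prems 4 q by (auto simp: vpath_def vwalk_Cons_iff)
    \<comment> \<open>The common end guarantees a shared node; taking the first one along
      \<open>p\<close> makes the closed walk below simple.\<close>
    have "last p \<in> set p \<inter> set q'"
      using 4 Cons.prems q by (metis IntI last.simps last_in_set)
    then obtain p1 x p2 where p: "p = p1 @ x # p2" "x \<in> set q'" "set p1 \<inter> set q' = {}"
      using split_list_first_in[of p "set q'"] by blast
    obtain q1 q2 where q': "q' = q1 @ x # q2"
      using p(2) by (meson split_list)
    have "vwalk (p1 @ [x]) (with_proj T)"
      using walks(1) p(1) by (metis append.assoc append_Cons append_Nil not_Cons_self2 vwalkI_append_l snoc_eq_iff_butlast)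
    moreover have "hd (p1 @ [x]) = hd p"
      using p(1) by (simp add: hd_append)
    ultimately have w1: "vwalk (a # p1 @ [x]) (with_proj T)"
      using walks by (simp add: vwalk_Cons_iff)
    have "vwalk (q1 @ [x]) (with_proj T)"
      using walks(2) q' by (metis append.assoc append_Cons append_Nil not_Cons_self2 vwalkI_append_l snoc_eq_iff_butlast)
    moreover have "hd (q1 @ [x]) = hd q'"
      using q' by (simp add: hd_append)
    ultimately have "vwalk (a # q1 @ [x]) (with_proj T)"
      using walks by (simp add: vwalk_Cons_iff)
    then have "vwalk (rev (a # q1 @ [x])) (with_proj T)"
      using vwalk_rev undirected_tree_sym[OF T] by (metis with_proj_simps(3))
    then have "vwalk (x # rev q1 @ [a]) (with_proj T)"
      by simp
    then have w2: "vwalk (rev q1 @ [a]) (with_proj T)" "(x, hd (rev q1 @ [a])) \<in> parcs T"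
      by (simp_all add: vwalk_Cons_iff)
    have "vwalk ((a # p1 @ [x]) @ (rev q1 @ [a])) (with_proj T)"
      using w1 w2 by (subst vwalk_append_iff) auto
    then have "vwalk (a # (p1 @ [x] @ rev q1 @ [a])) (with_proj T)"
      by simp
    moreover have "distinct (p1 @ [x] @ rev q1 @ [a])"
      using walks p q' by auto
    \<comment> \<open>\<open>p1\<close> and \<open>q1\<close> are not both empty, since otherwise
      both paths would continue with \<open>x\<close>.\<close>
    moreover have "3 \<le> length (p1 @ [x] @ rev q1 @ [a])"
      using 4 p q' by (cases p1; cases q1) auto
    ultimately show ?thesis
      using undirected_tree_no_closed_walk[OF T] by (metis append_is_Nil_conv last_append last_snoc not_Cons_self2)
  qed
qed

locale rooted_tree =
  fixes T :: "'i pair_pre_digraph" and rt :: 'i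
  assumes tree: "undirected_tree T" and root: "rt \<in> pverts T"
begin

lemma arcs_sym: "(x, y) \<in> parcs T \<Longrightarrow> (y, x) \<in> parcs T"
  using undirected_tree_sym[OF tree] by (auto simp: sym_def)

lemma arcs_irrefl: "(x, x) \<notin> parcs T"
proof -
  interpret pair_graph T using tree by (simp add: undirected_tree_def)
  show ?thesis using pair_no_loops by fastforce
qed

lemma arc_in_nodes: "(x, y) \<in> parcs T \<Longrightarrow> x \<in> pverts T \<and> y \<in> pverts T"
proof -
  interpret pair_graph T using tree by (simp add: undirected_tree_def)
  show "(x, y) \<in> parcs T \<Longrightarrow> ?thesis" using arc_fst_in_verts arc_snd_in_verts by fastforce
qed

definition root_path :: "'i \<Rightarrow> 'i list \<Rightarrow> bool" where
  "root_path j p \<longleftrightarrow> vpath p (with_proj T) \<and> hd p = rt \<and> last p = j"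

lemma root_path_unique: "root_path j p \<Longrightarrow> root_path j q \<Longrightarrow> p = q"
  unfolding root_path_def using undirected_tree_unique_vpath[OF tree] by metis

lemma root_path_nonempty: "root_path j p \<Longrightarrow> p \<noteq> []"
  unfolding root_path_def by (auto simp: vpath_def vwalk_def)

lemma root_path_prefix: "root_path j (p @ q) \<Longrightarrow> p \<noteq> [] \<Longrightarrow> root_path (last p) p"
  unfolding root_path_def vpath_def using vwalkI_append_l by auto

lemma root_path_snoc:
  assumes "root_path x p" "(x, y) \<in> parcs T" "y \<notin> set p"
  shows "root_path y (p @ [y])"
  using assms root_path_nonempty[OF assms(1)] arc_in_nodes[OF assms(2)]
  unfolding root_path_def vpath_def
  by (auto simp: vwalk_def vwalk_arcs_append)

text \<open>Follow reachability from the root. A node that is already on the path cuts the path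
  there instead of prolonging it, so no node repeats.\<close>

lemma root_path_exists:
  assumes "j \<in> pverts T"
  shows "\<exists>p. root_path j p"
proof -
  interpret pair_graph T using tree by (simp add: undirected_tree_def)
  \<comment> \<open>Connectedness is defined through the symmetric closure, which adds no arcs
    here.\<close>
  have "parcs (mk_symmetric (with_proj T)) = parcs T"
    by (auto simp: parcs_mk_symmetric arcs_sym)
  then have "(rt, j) \<in> rtrancl_on (pverts T) (parcs T)"
    using tree assms root unfolding undirected_tree_def connected_def strongly_connected_def
    by (auto simp: reachable_def)
  then show ?thesis
  proof (induction rule: rtrancl_on_induct)
    case base
    then show ?case
      by (intro exI[of _ "[rt]"]) (auto simp: root_path_def vpath_def vwalk_def)
  next
    case (step y z)
    then obtain p where p: "root_path y p" by blast
    show ?case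
    proof (cases "z \<in> set p")
      case True
      then obtain p1 p2 where "p = (p1 @ [z]) @ p2"
        by (metis append.assoc append_Cons append_Nil split_list)
      then have "root_path z (p1 @ [z])"
        using root_path_prefix[of y "p1 @ [z]" p2] p by simp
      then show ?thesis by blast
    next
      case False
      then show ?thesis using root_path_snoc p step by blast
    qed
  qed
qed

definition path_to :: "'i \<Rightarrow> 'i list" where
  "path_to j = (THE p. root_path j p)"

lemma path_to: "j \<in> pverts T \<Longrightarrow> root_path j (path_to j)"
  unfolding path_to_def using root_path_exists root_path_unique by (metis theI)

lemma path_to_eq: "root_path j p \<Longrightarrow> path_to j = p"
  unfolding path_to_def using root_path_unique by blast

lemma root_path_node: "root_path j p \<Longrightarrow> set p \<subseteq> pverts T \<and> j \<in> set p"
  unfolding root_path_def vpath_def vwalk_def by (auto dest: last_in_set)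

text \<open>Reduces the child relation to list prefixes; parents, subtrees and disjointness are then
  read off root paths. The conjunct \<open>root_path j (path_to j)\<close> says that
  \<open>j\<close> is a node, as \<open>path_to\<close> is unspecified elsewhere.\<close>

lemma children_iff: "j \<in> children T rt i \<longleftrightarrow> root_path j (path_to j) \<and> i \<in> pverts T \<and> path_to j = path_to i @ [j]"
proof
  assume "j \<in> children T rt i"
  then obtain q where "root_path j (q @ [i, j])"
    by (auto simp: children_def root_path_def)
  moreover from this have "root_path i (q @ [i])"
    using root_path_prefix[of j "q @ [i]" "[j]"] by simp
  ultimately show "root_path j (path_to j) \<and> i \<in> pverts T \<and> path_to j = path_to i @ [j]"
    using path_to_eq root_path_node by fastforce
next
  assume *: "root_path j (path_to j) \<and> i \<in> pverts T \<and> path_to j = path_to i @ [j]"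
  then have "root_path i (path_to i)"
    using path_to by blast
  then obtain q where "path_to i = q @ [i]"
    using root_path_nonempty by (metis append_butlast_last_id root_path_def)
  with * show "j \<in> children T rt i"
    by (auto simp: children_def root_path_def)
qed

lemma children_nodes: "j \<in> children T rt i \<Longrightarrow> j \<in> pverts T \<and> i \<in> pverts T"
  using children_iff root_path_node by blast

lemma unique_parent: "j \<in> children T rt i \<Longrightarrow> j \<in> children T rt i' \<Longrightarrow> i = i'"
  using children_iff path_to root_path_def
  by (metis append1_eq_conv)

lemma root_not_child: "rt \<notin> children T rt i"
proof
  assume "rt \<in> children T rt i"
  then have *: "root_path rt (path_to rt)" "path_to rt = path_to i @ [rt]" "i \<in> pverts T"
    using children_iff by auto
  moreover have "root_path rt [rt]"
    using root by (auto simp: root_path_def vpath_def vwalk_def)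
  ultimately have "path_to i @ [rt] = [rt]"
    using path_to_eq by metis
  then show False
    using root_path_nonempty[OF path_to[OF *(3)]] by simp
qed

text \<open>If \<open>y\<close> is off the root path of \<open>x\<close>, appending it yields the
  root path of \<open>y\<close>. Otherwise the path up to \<open>y\<close> avoids \<open>x\<close>
  and can be prolonged by \<open>x\<close>, and uniqueness makes the result the root path of
  \<open>x\<close>.\<close>

lemma arc_child:
  assumes "(x, y) \<in> parcs T"
  shows "y \<in> children T rt x \<or> x \<in> children T rt y"
proof -
  have p: "root_path x (path_to x)"
    using arc_in_nodes assms path_to by blast
  show ?thesis
  proof (cases "y \<in> set (path_to x)")
    case False
    then have "root_path y (path_to x @ [y])"
      using root_path_snoc p assms by blast
    then show ?thesis
      using path_to_eq children_iff arc_in_nodes[OF assms] by metis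
  next
    case True
    then obtain p1 p2 where s: "path_to x = (p1 @ [y]) @ p2"
      by (metis append.assoc append_Cons append_Nil split_list)
    then have y: "root_path y (p1 @ [y])"
      using root_path_prefix[of x "p1 @ [y]" p2] p by simp
    have "p2 \<noteq> []"
      using s p arcs_irrefl assms unfolding root_path_def by auto
    then have "x \<notin> set (p1 @ [y])"
      using s p unfolding root_path_def vpath_def by (metis disjoint_iff distinct_append last_appendR last_in_set)
    then have "root_path x ((p1 @ [y]) @ [x])"
      using root_path_snoc y arcs_sym assms by blast
    then show ?thesis
      using path_to_eq y children_iff arc_in_nodes[OF assms] by metis
  qed
qed

section \<open>Subtrees and the arcs that leave them\<close>

definition subtree :: "'i \<Rightarrow> 'i set" where
  "subtree i = {j \<in> pverts T. \<exists>zs. path_to j = path_to i @ zs}"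

lemma subtree_root: "subtree rt = pverts T"
proof -
  have "path_to rt = [rt]"
    using root by (intro path_to_eq) (auto simp: root_path_def vpath_def vwalk_def)
  moreover have "\<exists>zs. path_to j = rt # zs" if "j \<in> pverts T" for j
    using path_to[OF that] root_path_nonempty unfolding root_path_def by (metis list.collapse)
  ultimately show ?thesis
    by (auto simp: subtree_def)
qed

lemma subtree_children:
  assumes "i \<in> pverts T"
  shows "subtree i = insert i (\<Union>c \<in> children T rt i. subtree c)"
proof (intro equalityI subsetI)
  fix j assume "j \<in> subtree i"
  then obtain zs where j: "j \<in> pverts T" "path_to j = path_to i @ zs"
    by (auto simp: subtree_def)
  show "j \<in> insert i (\<Union>c \<in> children T rt i. subtree c)"
  proof (cases zs)
    case Nil
    then show ?thesis
      using j path_to assms unfolding root_path_def by (metis append_Nil2 insertI1)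
  next
    case (Cons z zs')
    then have eq: "path_to j = (path_to i @ [z]) @ zs'"
      using j by simp
    then have z: "root_path z (path_to i @ [z])"
      using root_path_prefix[of j "path_to i @ [z]" zs'] path_to[OF j(1)] by simp
    then have "z \<in> children T rt i"
      using children_iff path_to_eq assms by metis
    moreover have "j \<in> subtree z"
      using j eq path_to_eq[OF z] by (auto simp: subtree_def)
    ultimately show ?thesis by blast
  qed
next
  fix j assume "j \<in> insert i (\<Union>c \<in> children T rt i. subtree c)"
  then show "j \<in> subtree i"
    using assms by (auto simp: subtree_def children_iff)
qed

lemma subtree_disjoint:
  assumes "c \<in> children T rt i" "d \<in> children T rt i" "c \<noteq> d"
  shows "subtree c \<inter> subtree d = {}"
  using assms by (auto simp: subtree_def children_iff)

lemma parent_notin_subtree: "c \<in> children T rt i \<Longrightarrow> i \<notin> subtree c"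
  by (auto simp: subtree_def children_iff)

text \<open>The end \<open>y\<close> cannot be a child of \<open>x\<close>, or it would lie in the
  subtree too, so \<open>x\<close> is a child of \<open>y\<close>. If the root path of
  \<open>x\<close> went beyond \<open>c\<close>, that of \<open>y\<close> would still pass through
  \<open>c\<close>.\<close>

lemma arc_leaves_subtree:
  assumes "(x, y) \<in> parcs T" "x \<in> subtree c" "y \<notin> subtree c" "c \<in> children T rt i"
  shows "x = c \<and> y = i"
proof -
  obtain zs where x: "path_to x = path_to c @ zs" "x \<in> pverts T"
    using assms(2) by (auto simp: subtree_def)
  have y: "y \<in> pverts T"
    using arc_in_nodes assms(1) by blast
  have cx: "root_path c (path_to c)" "root_path x (path_to x)"
    using children_iff[of c i] assms(4) path_to[OF x(2)] by blast+
  have "y \<notin> children T rt x"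
    using x assms(3) y by (auto simp: subtree_def children_iff)
  then have "path_to x = path_to y @ [x]" "x \<in> children T rt y"
    using arc_child[OF assms(1)] children_iff by auto
  moreover have "zs = []"
    using x calculation y assms(3) by (cases zs rule: rev_cases) (auto simp: subtree_def)
  ultimately show ?thesis
    using x cx root_path_def unique_parent[OF assms(4)] by auto
qed

text \<open>A connected set of nodes can leave a subtree only along the arc from its top to the
  parent. Later \<open>S\<close> is the set of nodes whose bag contains a given vertex.\<close>

lemma connected_meets_boundary:
  assumes con: "Digraph_Component.connected (with_proj T \<restriction> S)"
    and "a \<in> S" "b \<in> S" "a \<in> subtree c" "b \<notin> subtree c" "c \<in> children T rt i"
  shows "c \<in> S \<and> i \<in> S"
proof -
  have "(a, b) \<in> rtrancl_on S (parcs (mk_symmetric (with_proj T \<restriction> S)))"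
    using con assms(2,3) unfolding connected_def strongly_connected_def
    by (auto simp: reachable_def)
  then have "b \<in> subtree c \<or> c \<in> S \<and> i \<in> S"
  proof (induction rule: rtrancl_on_induct)
    case base
    then show ?case using assms by blast
  next
    case (step y z)
    then have "(y, z) \<in> parcs T" "y \<in> S" "z \<in> S"
      by (auto simp: parcs_mk_symmetric arcs_sym)
    then show ?case
      using step arc_leaves_subtree[of y z c i] assms(6) by blast
  qed
  then show ?thesis using assms by blast
qed

end

section \<open>Running programs\<close>

text \<open>Total correctness with a time budget. \<open>k\<close> is an upper bound, whereas
  \<open>runs\<close> counts exactly, so that budgets can be weakened and branches of different cost
  can share one.\<close>

definition tri :: "com \<Rightarrow> ram_state \<Rightarrow> nat \<Rightarrow> (ram_state \<Rightarrow> bool) \<Rightarrow> bool" where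
  "tri c s k Q \<longleftrightarrow> (\<exists>k' s'. runs c s k' s' \<and> k' \<le> k \<and> Q s')"

lemma tri_mono: "tri c s k Q \<Longrightarrow> k \<le> k' \<Longrightarrow> (\<And>s'. Q s' \<Longrightarrow> Q' s') \<Longrightarrow> tri c s k' Q'"
  unfolding tri_def by (meson le_trans)

lemma tri_Skip: "Q s \<Longrightarrow> 1 \<le> k \<Longrightarrow> tri Skip s k Q"
  unfolding tri_def using runs.Skip by blast

lemma tri_Assign:
  "Q (s\<lparr>reg := (reg s)(x := aval e s)\<rparr>) \<Longrightarrow> acost e + 1 \<le> k \<Longrightarrow> tri (Assign x e) s k Q"
  unfolding tri_def using runs.Assign by blast

lemma tri_Store:
  "Q (s\<lparr>cell := (cell s)(a := (cell s a)(aval i s := aval e s))\<rparr>) \<Longrightarrow>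
    acost i + acost e + 1 \<le> k \<Longrightarrow> tri (Store a i e) s k Q"
  unfolding tri_def using runs.Store by blast

lemma tri_Seq:
  "tri c1 s k1 (\<lambda>s'. tri c2 s' k2 Q) \<Longrightarrow> tri (Seq c1 c2) s (k1 + k2) Q"
  unfolding tri_def using runs.Seq by (meson add_mono)

lemma tri_Cond:
  "(bval b s \<Longrightarrow> tri c1 s k Q) \<Longrightarrow> (\<not> bval b s \<Longrightarrow> tri c2 s k Q) \<Longrightarrow>
    bcost b + k + 1 \<le> k' \<Longrightarrow> tri (Cond b c1 c2) s k' Q"
  unfolding tri_def using runs.CondTrue runs.CondFalse
  by (metis add_le_mono1 add_left_mono le_trans)

text \<open>The invariant is indexed by the value of the counter, and the bound \<open>e\<close>
  must keep its value. One test with the loop step costs \<open>acost e + 3\<close>; the summand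
  outside the sum pays for the test that ends the loop.\<close>

lemma tri_while_from:
  assumes step: "\<And>i s. m \<le> i \<Longrightarrow> i < n \<Longrightarrow> I i s \<Longrightarrow> tri body s (\<kappa> i) (I (Suc i))"
    and guard: "\<And>i s. I i s \<Longrightarrow> reg s x = i \<and> aval e s = n"
  shows "I m s \<Longrightarrow> m \<le> n \<Longrightarrow>
    tri (While (Less (Reg x) e) body) s ((\<Sum>i=m..<n. \<kappa> i + acost e + 3) + acost e + 3) (I n)"
  using step
proof (induction "n - m" arbitrary: m s)
  case 0
  then have "\<not> bval (Less (Reg x) e) s"
    using guard[of m s] by auto
  from runs.WhileFalse[OF this, of body] show ?case
    using 0 unfolding tri_def by force
next
  case (Suc k)
  have b: "bval (Less (Reg x) e) s" and m: "m < n"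
    using guard[of m s] Suc.hyps(2) Suc.prems by auto
  obtain k1 s1 where 1: "runs body s k1 s1" "k1 \<le> \<kappa> m" "I (Suc m) s1"
    using Suc.prems(3)[OF le_refl m Suc.prems(1)] unfolding tri_def by auto
  have "tri (While (Less (Reg x) e) body) s1 ((\<Sum>i=Suc m..<n. \<kappa> i + acost e + 3) + acost e + 3) (I n)"
    by (rule Suc.hyps(1)) (use Suc.hyps(2) Suc.prems 1 m in auto)
  then obtain k2 s2 where 2: "runs (While (Less (Reg x) e) body) s1 k2 s2" "I n s2"
    "k2 \<le> (\<Sum>i=Suc m..<n. \<kappa> i + acost e + 3) + acost e + 3"
    unfolding tri_def by auto
  show ?case
    using runs.WhileTrue[OF b 1(1) 2(1)] 1 2 unfolding tri_def sum.atLeast_Suc_lessThan[OF m] by force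
qed

primrec wregs :: "com \<Rightarrow> string set" where
  "wregs Skip = {}"
| "wregs (Assign x e) = {x}"
| "wregs (Store a i e) = {}"
| "wregs (Seq c1 c2) = wregs c1 \<union> wregs c2"
| "wregs (Cond b c1 c2) = wregs c1 \<union> wregs c2"
| "wregs (While b c) = wregs c"

primrec warrs :: "com \<Rightarrow> string set" where
  "warrs Skip = {}"
| "warrs (Assign x e) = {}"
| "warrs (Store a i e) = {a}"
| "warrs (Seq c1 c2) = warrs c1 \<union> warrs c2"
| "warrs (Cond b c1 c2) = warrs c1 \<union> warrs c2"
| "warrs (While b c) = warrs c"

lemma runs_frame:
  "runs c s k s' \<Longrightarrow>
    (\<forall>x. x \<notin> wregs c \<longrightarrow> reg s' x = reg s x) \<and> (\<forall>a. a \<notin> warrs c \<longrightarrow> cell s' a = cell s a)"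
  by (induction rule: runs.induct) auto

text \<open>Lets each phase be specified without listing what it leaves alone; that follows from the
  program text.\<close>

lemma tri_frame:
  assumes "tri c s k Q"
    and "\<And>s'. Q s' \<Longrightarrow> (\<And>x. x \<notin> wregs c \<Longrightarrow> reg s' x = reg s x) \<Longrightarrow>
      (\<And>a. a \<notin> warrs c \<Longrightarrow> cell s' a = cell s a) \<Longrightarrow> Q' s'"
  shows "tri c s k Q'"
  using assms runs_frame unfolding tri_def by metis

section \<open>A compiled expression language\<close>

text \<open>
  Variables are de Bruijn indices; the body of \<open>ExB\<close> sees the search variable as index 0, that of
  \<open>Iter\<close> sees the counter as index 0 and the accumulator as index 1. The body of \<open>App\<close> sees only its arguments.
\<close>

datatype fx =
    Var nat
  | Const nat
  | Glob string
  | Arr string fx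
  | Add fx fx
  | Sub fx fx
  | Lt fx fx
  | Eql fx fx
  | Ite fx fx fx
  | ExB fx fx
  | Iter fx fx fx
  | App fx "fx list"

primrec iterate :: "(nat \<Rightarrow> nat \<Rightarrow> nat) \<Rightarrow> nat \<Rightarrow> nat \<Rightarrow> nat" where
  "iterate g a 0 = a"
| "iterate g a (Suc n) = g n (iterate g a n)"

text \<open>State and environment are abstracted on the right so that the recursive calls of
  \<open>App\<close> can take the form \<open>map fval es\<close>, as primitive recursion through a
  list requires.\<close>

primrec fval :: "fx \<Rightarrow> ram_state \<Rightarrow> nat list \<Rightarrow> nat" where
  "fval (Var i) = (\<lambda>s env. env ! i)"
| "fval (Const k) = (\<lambda>s env. k)"
| "fval (Glob x) = (\<lambda>s env. reg s x)"
| "fval (Arr a e) = (\<lambda>s env. cell s a (fval e s env))"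
| "fval (Add a b) = (\<lambda>s env. fval a s env + fval b s env)"
| "fval (Sub a b) = (\<lambda>s env. fval a s env - fval b s env)"
| "fval (Lt a b) = (\<lambda>s env. of_bool (fval a s env < fval b s env))"
| "fval (Eql a b) = (\<lambda>s env. of_bool (fval a s env = fval b s env))"
| "fval (Ite c a b) = (\<lambda>s env. if fval c s env \<noteq> 0 then fval a s env else fval b s env)"
| "fval (ExB b f) = (\<lambda>s env. of_bool (\<exists>i < fval b s env. fval f s (i # env) \<noteq> 0))"
| "fval (Iter b a f) = (\<lambda>s env.
    iterate (\<lambda>i acc. fval f s (i # acc # env)) (fval a s env) (fval b s env))"
| "fval (App f es) = (\<lambda>s env. fval f s (map (\<lambda>g. g s env) (map fval es)))"

text \<open>Scratch registers are named in unary, by \<open>#\<close>, \<open>##\<close> and so on.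
  The registers of the program proper start with other characters, so the two kinds never
  clash.\<close>

definition slot :: "nat \<Rightarrow> string" where
  "slot k = replicate (Suc k) (CHR ''#'')"

text \<open>Bounds only the loops that are actually executed: of a conditional, only the branch
  taken counts, and a loop body is examined only at the values that its variables assume.\<close>

primrec ok :: "fx \<Rightarrow> ram_state \<Rightarrow> nat list \<Rightarrow> nat \<Rightarrow> bool" where
  "ok (Var i) = (\<lambda>s env Q. i < length env)"
| "ok (Const k) = (\<lambda>s env Q. True)"
| "ok (Glob x) = (\<lambda>s env Q. x \<notin> range slot)"
| "ok (Arr a e) = ok e"
| "ok (Add a b) = (\<lambda>s env Q. ok a s env Q \<and> ok b s env Q)"
| "ok (Sub a b) = (\<lambda>s env Q. ok a s env Q \<and> ok b s env Q)"
| "ok (Lt a b) = (\<lambda>s env Q. ok a s env Q \<and> ok b s env Q)"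
| "ok (Eql a b) = (\<lambda>s env Q. ok a s env Q \<and> ok b s env Q)"
| "ok (Ite c a b) = (\<lambda>s env Q. ok c s env Q \<and>
    (fval c s env \<noteq> 0 \<longrightarrow> ok a s env Q) \<and> (fval c s env = 0 \<longrightarrow> ok b s env Q))"
| "ok (ExB b f) = (\<lambda>s env Q. ok b s env Q \<and> fval b s env \<le> Q \<and>
    (\<forall>i < fval b s env. ok f s (i # env) Q))"
| "ok (Iter b a f) = (\<lambda>s env Q. ok b s env Q \<and> ok a s env Q \<and> fval b s env \<le> Q \<and>
    (\<forall>i < fval b s env.
      ok f s (i # iterate (\<lambda>i acc. fval f s (i # acc # env)) (fval a s env) i # env) Q))"
| "ok (App f es) = (\<lambda>s env Q. list_all (\<lambda>g. g s env Q) (map ok es) \<and>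
    ok f s (map (\<lambda>e. fval e s env) es) Q)"

primrec seq_coms :: "(nat list \<Rightarrow> nat \<Rightarrow> com) list \<Rightarrow> nat list \<Rightarrow> nat \<Rightarrow> com" where
  "seq_coms [] vs d = Skip"
| "seq_coms (c # cs) vs d = Seq (c vs d) (seq_coms cs vs (Suc d))"

abbreviation sreg :: "nat \<Rightarrow> aexp" where "sreg k \<equiv> Reg (slot k)"

abbreviation incr :: "string \<Rightarrow> com" where "incr x \<equiv> Assign x (Plus (Reg x) (Num 1))"

text \<open>Slot \<open>d\<close> holds the bound, slot \<open>d + 1\<close> the accumulator, slot \<open>d + 2\<close> the counter.\<close>

definition loop_com :: "nat \<Rightarrow> com \<Rightarrow> com \<Rightarrow> com \<Rightarrow> com" where
  "loop_com d cb ca cf = Seq cb (Seq ca (Seq (Assign (slot (d + 2)) (Num 0))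
    (Seq (While (Less (sreg (d + 2)) (sreg d))
      (Seq cf (Seq (Assign (slot (d + 1)) (sreg (d + 3))) (incr (slot (d + 2))))))
    (Assign (slot d) (sreg (d + 1))))))"

text \<open>
  \<open>compile e vs d\<close> leaves the value in slot \<open>d\<close> and touches no slot below \<open>d\<close>; \<open>vs\<close> lists the
  slots of the variables.
\<close>

primrec compile :: "fx \<Rightarrow> nat list \<Rightarrow> nat \<Rightarrow> com" where
  "compile (Var i) = (\<lambda>vs d. Assign (slot d) (sreg (vs ! i)))"
| "compile (Const k) = (\<lambda>vs d. Assign (slot d) (Num k))"
| "compile (Glob x) = (\<lambda>vs d. Assign (slot d) (Reg x))"
| "compile (Arr a e) = (\<lambda>vs d. Seq (compile e vs d) (Assign (slot d) (Cell a (sreg d))))"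
| "compile (Add a b) = (\<lambda>vs d. Seq (compile a vs d) (Seq (compile b vs (Suc d))
    (Assign (slot d) (Plus (sreg d) (sreg (Suc d))))))"
| "compile (Sub a b) = (\<lambda>vs d. Seq (compile a vs d) (Seq (compile b vs (Suc d))
    (Assign (slot d) (Minus (sreg d) (sreg (Suc d))))))"
| "compile (Lt a b) = (\<lambda>vs d. Seq (compile a vs d) (Seq (compile b vs (Suc d))
    (Cond (Less (sreg d) (sreg (Suc d))) (Assign (slot d) (Num 1)) (Assign (slot d) (Num 0)))))"
| "compile (Eql a b) = (\<lambda>vs d. Seq (compile a vs d) (Seq (compile b vs (Suc d))
    (Cond (Equal (sreg d) (sreg (Suc d))) (Assign (slot d) (Num 1)) (Assign (slot d) (Num 0)))))"
| "compile (Ite c a b) = (\<lambda>vs d. Seq (compile c vs d)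
    (Cond (Equal (sreg d) (Num 0)) (compile b vs d) (compile a vs d)))"
| "compile (ExB b f) = (\<lambda>vs d. loop_com d (compile b vs d) (Assign (slot (d + 1)) (Num 0))
    (Seq (compile f ((d + 2) # vs) (d + 3))
      (Cond (Equal (sreg (d + 3)) (Num 0)) (Assign (slot (d + 3)) (sreg (d + 1))) (Assign (slot (d + 3)) (Num 1)))))"
| "compile (Iter b a f) = (\<lambda>vs d. loop_com d (compile b vs d) (compile a vs (d + 1))
    (compile f ((d + 2) # (d + 1) # vs) (d + 3)))"
| "compile (App f es) = (\<lambda>vs d. Seq (seq_coms (map compile es) vs d)
    (Seq (compile f [d..<d + length es] (d + length es))
      (Assign (slot d) (sreg (d + length es)))))"

text \<open>\<open>kc e * Q ^ dp e\<close> bounds the time. Exponents are added over subexpressions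
  where a maximum would do; for expressions fixed in advance the loss is harmless, and all estimates
  reduce to monotonicity of powers. The 38 for \<open>ExB\<close> is the 30 of a loop plus 2 for the
  accumulator and 6 for the conditional after the body.\<close>

primrec kc :: "fx \<Rightarrow> nat" where
  "kc (Var i) = 2"
| "kc (Const k) = 2"
| "kc (Glob x) = 2"
| "kc (Arr a e) = kc e + 3"
| "kc (Add a b) = kc a + kc b + 4"
| "kc (Sub a b) = kc a + kc b + 4"
| "kc (Lt a b) = kc a + kc b + 6"
| "kc (Eql a b) = kc a + kc b + 6"
| "kc (Ite c a b) = kc c + kc a + kc b + 4"
| "kc (ExB b f) = kc b + kc f + 38"
| "kc (Iter b a f) = kc b + kc a + kc f + 30"
| "kc (App f es) = sum_list (map kc es) + kc f + 3"

primrec dp :: "fx \<Rightarrow> nat" where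
  "dp (Var i) = 0"
| "dp (Const k) = 0"
| "dp (Glob x) = 0"
| "dp (Arr a e) = dp e"
| "dp (Add a b) = dp a + dp b"
| "dp (Sub a b) = dp a + dp b"
| "dp (Lt a b) = dp a + dp b"
| "dp (Eql a b) = dp a + dp b"
| "dp (Ite c a b) = dp c + dp a + dp b"
| "dp (ExB b f) = dp b + dp f + 1"
| "dp (Iter b a f) = dp b + dp a + dp f + 1"
| "dp (App f es) = sum_list (map dp es) + dp f"

lemma slot_eq_iff [simp]: "slot i = slot j \<longleftrightarrow> i = j"
  by (metis slot_def Suc_inject length_replicate)

section \<open>Correctness and cost of compiled expressions\<close>

definition agree :: "nat \<Rightarrow> ram_state \<Rightarrow> ram_state \<Rightarrow> bool" where
  "agree d s s' \<longleftrightarrow> cell s' = cell s \<and> (\<forall>x. x \<notin> slot ` {d..} \<longrightarrow> reg s' x = reg s x)"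

text \<open>Variables live in slots below \<open>d\<close>, which is the part that code compiled at
  depth \<open>d\<close> preserves.\<close>

definition sim :: "ram_state \<Rightarrow> nat list \<Rightarrow> nat list \<Rightarrow> nat \<Rightarrow> ram_state \<Rightarrow> bool" where
  "sim s env vs d s' \<longleftrightarrow> agree 0 s s' \<and> length vs = length env \<and>
    (\<forall>i < length env. vs ! i < d \<and> reg s' (slot (vs ! i)) = env ! i)"

lemma agree_refl: "agree d s s"
  by (simp add: agree_def)

lemma agree_trans: "agree d s s' \<Longrightarrow> agree d s' s'' \<Longrightarrow> agree d s s''"
  by (simp add: agree_def)

lemma agree_mono: "agree d s s' \<Longrightarrow> d' \<le> d \<Longrightarrow> agree d' s s'"
  by (fastforce simp: agree_def)

lemma agree_trans': "agree d s s' \<Longrightarrow> agree d' s' s'' \<Longrightarrow> d \<le> d' \<Longrightarrow> agree d s s''"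
  using agree_trans agree_mono by blast

lemma agree_slot: "agree d s s' \<Longrightarrow> i < d \<Longrightarrow> reg s' (slot i) = reg s (slot i)"
proof -
  assume "agree d s s'" "i < d"
  moreover have "slot i \<notin> slot ` {d..}" using \<open>i < d\<close> by auto
  ultimately show ?thesis by (simp add: agree_def)
qed

lemma agree_cell: "agree d s s' \<Longrightarrow> cell s' = cell s"
  by (auto simp: agree_def)

lemma agree_update [simp]:
  "d \<le> i \<Longrightarrow> agree d s (s'\<lparr>reg := f(slot i := v)\<rparr>) \<longleftrightarrow> agree d s (s'\<lparr>reg := f\<rparr>)"
  by (auto simp: agree_def)

lemma agree_reg [simp]: "agree d s (s'\<lparr>reg := reg s'\<rparr>) \<longleftrightarrow> agree d s s'"
  by (auto simp: agree_def)

lemma sim_agree: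
  assumes "sim s env vs d s'" "agree d s' s''" "d \<le> d'"
  shows "sim s env vs d' s''"
proof -
  have "agree 0 s s''"
    using assms agree_trans[OF _ agree_mono[OF assms(2), of 0]] by (auto simp: sim_def)
  moreover have "reg s'' (slot (vs ! i)) = env ! i \<and> vs ! i < d'" if "i < length env" for i
    using assms(1,3) that agree_slot[OF assms(2), of "vs ! i"] by (auto simp: sim_def)
  ultimately show ?thesis
    using assms(1) by (simp add: sim_def)
qed

lemma sim_Cons:
  "sim s env vs d s' \<Longrightarrow> j < d \<Longrightarrow> reg s' (slot j) = v \<Longrightarrow> sim s (v # env) (j # vs) d s'"
  unfolding sim_def by (auto simp: nth_Cons split: nat.splits)

definition computes :: "com \<Rightarrow> nat \<Rightarrow> nat \<Rightarrow> nat \<Rightarrow> ram_state \<Rightarrow> bool" where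
  "computes c d k v s \<longleftrightarrow> tri c s k (\<lambda>s'. agree d s s' \<and> reg s' (slot d) = v)"

lemma computes_mono: "computes c d k v s \<Longrightarrow> k \<le> k' \<Longrightarrow> computes c d k' v s"
  unfolding computes_def by (erule tri_mono)

lemma le_mult_power: "1 \<le> (Q::nat) \<Longrightarrow> x \<le> y \<Longrightarrow> k * Q ^ x \<le> k * Q ^ y"
  by (simp add: power_increasing)

lemma add_cost2:
  assumes "1 \<le> (Q::nat)"
  shows "a * Q ^ x + (b * Q ^ y + c) \<le> (a + b + c) * Q ^ (x + y)"
proof -
  have "a * Q ^ x \<le> a * Q ^ (x + y)" "b * Q ^ y \<le> b * Q ^ (x + y)" "c * Q ^ 0 \<le> c * Q ^ (x + y)"
    by (rule le_mult_power[OF assms], simp)+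
  then show ?thesis unfolding distrib_right power_0 mult_1_right by linarith
qed

lemma add_cost3:
  assumes "1 \<le> (Q::nat)"
  shows "a * Q ^ x + (b * Q ^ y + (c * Q ^ z + e)) \<le> (a + b + c + e) * Q ^ (x + y + z)"
proof -
  have "a * Q ^ x \<le> a * Q ^ (x + y + z)" "b * Q ^ y \<le> b * Q ^ (x + y + z)"
    "c * Q ^ z \<le> c * Q ^ (x + y + z)" "e * Q ^ 0 \<le> e * Q ^ (x + y + z)"
    by (rule le_mult_power[OF assms], simp)+
  then show ?thesis unfolding distrib_right power_0 mult_1_right by linarith
qed

lemma computes_then:
  assumes "computes c d k v s"
    and "\<And>s'. agree d s s' \<Longrightarrow> reg s' (slot d) = v \<Longrightarrow> tri c' s' k' Q"
  shows "tri (Seq c c') s (k + k') Q"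
  using assms unfolding computes_def by (intro tri_Seq) (auto intro: tri_mono)

lemma tri_Assign_Seq:
  assumes "tri c (s\<lparr>reg := (reg s)(x := aval e s)\<rparr>) k Q"
  shows "tri (Seq (Assign x e) c) s (acost e + 1 + k) Q"
  using assms by (intro tri_Seq tri_Assign) auto

lemma tri_Store_Seq:
  assumes "tri c (s\<lparr>cell := (cell s)(a := (cell s a)(aval i s := aval e s))\<rparr>) k Q"
  shows "tri (Seq (Store a i e) c) s (acost i + acost e + 1 + k) Q"
  using assms by (intro tri_Seq tri_Store) auto

lemma loop_cost:
  fixes Q :: nat
  assumes "n \<le> Q" "1 \<le> Q"
  shows "kb * Q ^ db + ka * Q ^ da + (n * (kf * Q ^ df + c) + c')
    \<le> (kb + ka + kf + c + c') * Q ^ (db + da + df + 1)"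
proof -
  have *: "x * Q ^ y \<le> x * Q ^ (db + da + df + 1)" if "y \<le> db + da + df + 1" for x y
    using le_mult_power assms(2) that .
  have "n * (kf * Q ^ df + c) \<le> Q * (kf * Q ^ df + c)"
    using assms by simp
  also have "\<dots> = kf * Q ^ (df + 1) + c * Q ^ 1"
    by (simp add: algebra_simps)
  also have "\<dots> \<le> kf * Q ^ (db + da + df + 1) + c * Q ^ (db + da + df + 1)"
    by (intro add_mono *) auto
  finally have "n * (kf * Q ^ df + c) \<le> (kf + c) * Q ^ (db + da + df + 1)"
    by (simp add: algebra_simps)
  moreover have "c' \<le> c' * Q ^ (db + da + df + 1)"
    using *[of 0 c'] by simp
  moreover note *[of db kb] *[of da ka]
  ultimately show ?thesis
    unfolding distrib_right by linarith
qed

text \<open>The body works at depth \<open>d + 3\<close>, so it cannot disturb the bound, the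
  accumulator and the counter in the three slots below.\<close>

lemma computes_loop:
  assumes b: "computes cb d (kb * Q ^ db) n s"
    and a: "\<And>s'. agree d s s' \<Longrightarrow> computes ca (d + 1) (ka * Q ^ da) v s'"
    and f: "\<And>i s'. i < n \<Longrightarrow> agree d s s' \<Longrightarrow> reg s' (slot (d + 2)) = i \<Longrightarrow>
      reg s' (slot (d + 1)) = iterate g v i \<Longrightarrow>
      computes cf (d + 3) (kf * Q ^ df) (g i (iterate g v i)) s'"
    and "n \<le> Q" "1 \<le> Q"
  shows "computes (loop_com d cb ca cf) d ((kb + ka + kf + 30) * Q ^ (db + da + df + 1))
    (iterate g v n) s"
proof -
  define I where "I = (\<lambda>i s'. agree d s s' \<and> reg s' (slot d) = n \<and> reg s' (slot (d + 2)) = i \<and>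
    reg s' (slot (d + 1)) = iterate g v i)"
  let ?body = "Seq cf (Seq (Assign (slot (d + 1)) (sreg (d + 3))) (incr (slot (d + 2))))"
  have body: "tri ?body s' (kf * Q ^ df + 6) (I (Suc i))" if i: "i < n" and I: "I i s'" for i s'
  proof -
    have c: "computes cf (d + 3) (kf * Q ^ df) (g i (iterate g v i)) s'"
      using f i I unfolding I_def by blast
    have "tri (Seq (Assign (slot (d + 1)) (sreg (d + 3))) (incr (slot (d + 2)))) s'' 6 (I (Suc i))"
      if a: "agree (d + 3) s' s''" and v: "reg s'' (slot (d + 3)) = g i (iterate g v i)" for s''
    proof -
      have s'': "agree d s s''" "reg s'' (slot d) = n" "reg s'' (slot (d + 2)) = i"
        using I a agree_slot[OF a] agree_trans' unfolding I_def by auto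
      then show ?thesis
        using v
        by (intro tri_mono[OF tri_Assign_Seq[OF tri_Assign[where k = 4]]])
          (auto simp: I_def)
    qed
    then show ?thesis
      by (intro tri_mono[OF computes_then[OF c]]) auto
  qed
  have loop: "tri (While (Less (sreg (d + 2)) (sreg d)) ?body) s'
      ((\<Sum>i=0..<n. (kf * Q ^ df + 6) + acost (sreg d) + 3) + acost (sreg d) + 3) (I n)" if "I 0 s'" for s'
  proof (rule tri_while_from[where I = I])
    show "tri ?body t (kf * Q ^ df + 6) (I (Suc i))" if "i < n" "I i t" for i t
      using that by (rule body)
  qed (use that in \<open>auto simp: I_def\<close>)
  have "tri (Seq (While (Less (sreg (d + 2)) (sreg d)) ?body) (Assign (slot d) (sreg (d + 1)))) s'
      (((\<Sum>i=0..<n. (kf * Q ^ df + 6) + acost (sreg d) + 3) + acost (sreg d) + 3) + 2)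
      (\<lambda>s'. agree d s s' \<and> reg s' (slot d) = iterate g v n)"
    if "I 0 s'" for s'
    by (rule tri_Seq[OF tri_mono[OF loop[OF that]]]) (auto simp: I_def intro!: tri_Assign)
  moreover have "I 0 (s''\<lparr>reg := (reg s'')(slot (d + 2) := 0)\<rparr>)"
    if "agree d s s'" "reg s' (slot d) = n" "agree (d + 1) s' s''" "reg s'' (slot (d + 1)) = v" for s' s''
    using that agree_slot[OF that(3), of d] agree_trans'[OF that(1,3)]
    by (auto simp: I_def)
  ultimately have "tri (loop_com d cb ca cf) s (kb * Q ^ db + (ka * Q ^ da + (2 +
      (((\<Sum>i=0..<n. (kf * Q ^ df + 6) + acost (sreg d) + 3) + acost (sreg d) + 3) + 2))))
      (\<lambda>s'. agree d s s' \<and> reg s' (slot d) = iterate g v n)"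
    unfolding loop_com_def
    by (intro computes_then[OF b] computes_then[OF a] tri_mono[OF tri_Assign_Seq]) auto
  then show ?thesis
    unfolding computes_def
    using loop_cost[OF assms(4,5), of kb db ka da kf df 10 8]
    by (elim tri_mono) (auto simp: algebra_simps)
qed

lemma computes_binary:
  assumes a: "computes ca d (ka * Q ^ da) va s" and Q: "1 \<le> Q"
    and b: "\<And>s'. agree d s s' \<Longrightarrow> computes cb (Suc d) (kb * Q ^ db) vb s'"
    and op: "\<And>s'. agree d s s' \<Longrightarrow> reg s' (slot d) = va \<Longrightarrow> reg s' (slot (Suc d)) = vb \<Longrightarrow>
      tri cop s' kop (\<lambda>s''. agree d s s'' \<and> reg s'' (slot d) = v)"
  shows "computes (Seq ca (Seq cb cop)) d ((ka + kb + kop) * Q ^ (da + db)) v s"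
  unfolding computes_def
proof (rule tri_mono[OF computes_then[OF a] add_cost2[OF Q]])
  fix s' assume s': "agree d s s'" "reg s' (slot d) = va"
  show "tri (Seq cb cop) s' (kb * Q ^ db + kop) (\<lambda>s''. agree d s s'' \<and> reg s'' (slot d) = v)"
  proof (rule computes_then[OF b[OF s'(1)]])
    fix t assume t: "agree (Suc d) s' t" "reg t (slot (Suc d)) = vb"
    show "tri cop t kop (\<lambda>s''. agree d s s'' \<and> reg s'' (slot d) = v)"
      using s' t agree_slot[OF t(1), of d] agree_trans'[OF s'(1) t(1)] by (intro op) auto
  qed
qed

text \<open>The premise covers every depth from \<open>d\<close> on because each argument is
  compiled one slot above the results of its predecessors.\<close>

lemma seq_coms_computes:
  assumes "\<And>e s'. e \<in> set es \<Longrightarrow> \<forall>d' \<ge> d. agree d s s' \<longrightarrow> computes (compile e vs d') d' (k e) (v e) s'"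
  shows "tri (seq_coms (map compile es) vs d) s (sum_list (map k es) + 1)
    (\<lambda>s'. agree d s s' \<and> (\<forall>i < length es. reg s' (slot (d + i)) = v (es ! i)))"
  using assms
proof (induction es arbitrary: d s)
  case Nil
  then show ?case by (auto intro!: tri_Skip simp: agree_refl)
next
  case (Cons e es)
  have c: "computes (compile e vs d) d (k e) (v e) s"
    using Cons.prems[of e s] agree_refl by simp
  have "tri (seq_coms (map compile es) vs (Suc d)) s' (sum_list (map k es) + 1)
      (\<lambda>s''. agree d s s'' \<and> (\<forall>i < length (e # es). reg s'' (slot (d + i)) = v ((e # es) ! i)))"
    if s': "agree d s s'" "reg s' (slot d) = v e" for s'
  proof (rule tri_mono[OF Cons.IH])
    fix f s'' assume f: "f \<in> set es"
    show "\<forall>d' \<ge> Suc d. agree (Suc d) s' s'' \<longrightarrow> computes (compile f vs d') d' (k f) (v f) s''"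
      using Cons.prems[of f s''] f s' agree_trans'[of d s s' "Suc d" s''] by (auto simp: Suc_le_eq)
  next
    fix s'' assume s'': "agree (Suc d) s' s'' \<and> (\<forall>i < length es. reg s'' (slot (Suc d + i)) = v (es ! i))"
    then have "reg s'' (slot d) = v e"
      using s' agree_slot[of "Suc d" s' s'' d] by simp
    then show "agree d s s'' \<and> (\<forall>i < length (e # es). reg s'' (slot (d + i)) = v ((e # es) ! i))"
      using s'' s' agree_trans'[of d s s' "Suc d" s''] by (auto simp: less_Suc_eq_0_disj)
  qed simp
  then show ?case
    using c by (auto intro!: tri_mono[OF computes_then[OF c]])
qed

text \<open>Values and bounds refer to the fixed state \<open>s\<close>. The running state
  \<open>s'\<close> differs from it only in slots, so arrays and named registers read alike in both,
  however deep the recursion.\<close>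

theorem compile_correct:
  assumes "1 \<le> Q"
  shows "ok e s env Q \<Longrightarrow> sim s env vs d s' \<Longrightarrow>
    computes (compile e vs d) d (kc e * Q ^ dp e) (fval e s env) s'"
proof (induction e arbitrary: env vs d s')
  case (Var i)
  then show ?case
    by (auto simp: computes_def sim_def agree_refl intro!: tri_Assign agree_update)
next
  case (Const k)
  then show ?case
    by (auto simp: computes_def agree_refl intro!: tri_Assign agree_update)
next
  case (Glob x)
  then show ?case
    by (auto simp: computes_def sim_def agree_refl agree_def intro!: tri_Assign)
next
  case (Arr a e)
  then have "computes (compile e vs d) d (kc e * Q ^ dp e) (fval e s env) s'"
    by simp
  then have "computes (compile (Arr a e) vs d) d (kc e * Q ^ dp e + 3) (fval (Arr a e) s env) s'"
    unfolding compile.simps computes_def[of "Seq c1 c2" for c1 c2]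
    by (rule computes_then) (use Arr.prems in \<open>auto simp: agree_cell sim_def intro!: tri_Assign\<close>)
  moreover have "kc e * Q ^ dp e + 3 \<le> kc (Arr a e) * Q ^ dp (Arr a e)"
    using assms by (simp add: algebra_simps)
  ultimately show ?case by (rule computes_mono)
next
  case (Add a b)
  then show ?case
    unfolding compile.simps kc.simps dp.simps
    by (intro computes_binary[OF _ assms, where va = "fval a s env" and vb = "fval b s env"])
      (auto intro!: Add.IH tri_Assign intro: sim_agree)
next
  case (Sub a b)
  then show ?case
    unfolding compile.simps kc.simps dp.simps
    by (intro computes_binary[OF _ assms, where va = "fval a s env" and vb = "fval b s env"])
      (auto intro!: Sub.IH tri_Assign intro: sim_agree)
next
  case (Lt a b)
  then show ?case
    unfolding compile.simps kc.simps dp.simps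
    by (intro computes_binary[OF _ assms, where va = "fval a s env" and vb = "fval b s env"])
      (auto intro!: Lt.IH tri_Cond[where k = 2] tri_Assign intro: sim_agree)
next
  case (Eql a b)
  then show ?case
    unfolding compile.simps kc.simps dp.simps
    by (intro computes_binary[OF _ assms, where va = "fval a s env" and vb = "fval b s env"])
      (auto intro!: Eql.IH tri_Cond[where k = 2] tri_Assign intro: sim_agree)
next
  case (Ite c a b)
  let ?k = "kc a * Q ^ dp a + kc b * Q ^ dp b"
  have c: "computes (compile c vs d) d (kc c * Q ^ dp c) (fval c s env) s'"
    using Ite by simp
  have "tri (Cond (Equal (sreg d) (Num 0)) (compile b vs d) (compile a vs d)) s''
      (4 + ?k) (\<lambda>t. agree d s' t \<and> reg t (slot d) = fval (Ite c a b) s env)"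
    if s'': "agree d s' s''" "reg s'' (slot d) = fval c s env" for s''
  proof (rule tri_Cond)
    have sim: "sim s env vs d s''"
      using s'' Ite.prems sim_agree by blast
    show "tri (compile b vs d) s'' ?k (\<lambda>t. agree d s' t \<and> reg t (slot d) = fval (Ite c a b) s env)"
      if "bval (Equal (sreg d) (Num 0)) s''"
      using that Ite.IH(3)[OF _ sim] Ite.prems(1) s'' agree_trans unfolding computes_def
      by (auto elim!: tri_mono)
    show "tri (compile a vs d) s'' ?k (\<lambda>t. agree d s' t \<and> reg t (slot d) = fval (Ite c a b) s env)"
      if "\<not> bval (Equal (sreg d) (Num 0)) s''"
      using that Ite.IH(2)[OF _ sim] Ite.prems(1) s'' agree_trans unfolding computes_def
      by (auto elim!: tri_mono)
  qed simp
  then have "computes (compile (Ite c a b) vs d) d (kc c * Q ^ dp c + (4 + ?k)) (fval (Ite c a b) s env) s'"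
    unfolding compile.simps computes_def[of "Seq c1 c2" for c1 c2]
    by (intro computes_then[OF c])
  moreover have "kc c * Q ^ dp c + (4 + ?k) \<le> kc (Ite c a b) * Q ^ dp (Ite c a b)"
    using add_cost3[OF assms, of "kc c" "dp c" "kc a" "dp a" "kc b" "dp b" 4] by simp
  ultimately show ?case by (rule computes_mono)
next
  case (ExB b f)
  let ?n = "fval b s env" and ?v = "\<lambda>i. fval f s (i # env)"
  \<comment> \<open>A search is an iteration whose accumulator remembers whether a witness has been
    met; it does not stop early.\<close>
  let ?g = "\<lambda>i acc. if ?v i = 0 then acc else 1"
  let ?cf = "Seq (compile f ((d + 2) # vs) (d + 3)) (Cond (Equal (sreg (d + 3)) (Num 0))
      (Assign (slot (d + 3)) (sreg (d + 1))) (Assign (slot (d + 3)) (Num 1)))"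
  have "computes (compile (ExB b f) vs d) d ((kc b + 2 + (kc f + 6) + 30) * Q ^ (dp b + 0 + dp f + 1))
    (iterate ?g 0 ?n) s'"
    unfolding compile.simps
  proof (rule computes_loop)
    show "computes (compile b vs d) d (kc b * Q ^ dp b) ?n s'"
      using ExB by simp
    show "computes (Assign (slot (d + 1)) (Num 0)) (d + 1) (2 * Q ^ 0) 0 s''" for s''
      by (auto simp: computes_def agree_refl intro!: tri_Assign)
    fix i s'' assume i: "i < ?n" "agree d s' s''" "reg s'' (slot (d + 2)) = i"
      and acc: "reg s'' (slot (d + 1)) = iterate ?g 0 i"
    have f: "computes (compile f ((d + 2) # vs) (d + 3)) (d + 3) (kc f * Q ^ dp f) (?v i) s''"
      using ExB.prems i by (intro ExB.IH(2) sim_Cons) (auto intro: sim_agree)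
    have "tri ?cf s'' (kc f * Q ^ dp f + 6)
      (\<lambda>t. agree (d + 3) s'' t \<and> reg t (slot (d + 3)) = ?g i (iterate ?g 0 i))"
      by (rule computes_then[OF f])
        (use acc in \<open>auto intro!: tri_Cond[where k = 2] tri_Assign dest: agree_slot[where i = "Suc d"]\<close>)
    then show "computes ?cf (d + 3) ((kc f + 6) * Q ^ dp f) (?g i (iterate ?g 0 i)) s''"
      unfolding computes_def
      by (rule tri_mono) (use add_cost2[OF assms, of "kc f" "dp f" 0 0 6] in auto)
  qed (use ExB.prems assms in auto)
  moreover have "iterate ?g 0 m = of_bool (\<exists>i < m. ?v i \<noteq> 0)" for m
    by (induction m) (auto simp: less_Suc_eq)
  then have val: "iterate ?g 0 ?n = fval (ExB b f) s env"
    by simp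
  moreover have "kc b + 2 + (kc f + 6) + 30 = kc (ExB b f)" "dp b + 0 + dp f + 1 = dp (ExB b f)"
    by simp_all
  ultimately show ?case by metis
next
  case (Iter b a f)
  let ?g = "\<lambda>i acc. fval f s (i # acc # env)"
  have "computes (compile (Iter b a f) vs d) d ((kc b + kc a + kc f + 30) * Q ^ (dp b + dp a + dp f + 1))
    (iterate ?g (fval a s env) (fval b s env)) s'"
    unfolding compile.simps
  proof (rule computes_loop)
    show "computes (compile b vs d) d (kc b * Q ^ dp b) (fval b s env) s'"
      using Iter by simp
    show "computes (compile a vs (d + 1)) (d + 1) (kc a * Q ^ dp a) (fval a s env) s''" if "agree d s' s''" for s''
      using Iter.prems that by (intro Iter.IH(2)) (auto intro: sim_agree)
    fix i s'' assume "i < fval b s env" "agree d s' s''" "reg s'' (slot (d + 2)) = i"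
      "reg s'' (slot (d + 1)) = iterate ?g (fval a s env) i"
    then show "computes (compile f ((d + 2) # (d + 1) # vs) (d + 3)) (d + 3) (kc f * Q ^ dp f)
        (fval f s (i # iterate ?g (fval a s env) i # env)) s''"
      using Iter.prems by (intro Iter.IH(3) sim_Cons) (auto intro: sim_agree)
  qed (use Iter.prems assms in auto)
  then show ?case by simp
next
  case (App f es)
  let ?n = "length es" and ?vals = "map (\<lambda>e. fval e s env) es"
  let ?k = "kc f * Q ^ dp f"
  have args: "tri (seq_coms (map compile es) vs d) s' (sum_list (map (\<lambda>e. kc e * Q ^ dp e) es) + 1)
    (\<lambda>s''. agree d s' s'' \<and> (\<forall>i < ?n. reg s'' (slot (d + i)) = fval (es ! i) s env))"
  proof (rule seq_coms_computes, intro allI impI)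
    fix e s'' d' assume "e \<in> set es" "d \<le> d'" "agree d s' s''"
    then show "computes (compile e vs d') d' (kc e * Q ^ dp e) (fval e s env) s''"
      using App.prems by (intro App.IH(2)) (auto simp: list_all_iff intro: sim_agree)
  qed
  have "tri (Seq (compile f [d..<d + ?n] (d + ?n)) (Assign (slot d) (sreg (d + ?n)))) s'' (?k + 2)
      (\<lambda>t. agree d s' t \<and> reg t (slot d) = fval (App f es) s env)"
    if s'': "agree d s' s''" "\<forall>i < ?n. reg s'' (slot (d + i)) = fval (es ! i) s env" for s''
  proof -
    have "agree 0 s s''"
      using App.prems(2) s''(1) unfolding sim_def by (meson agree_trans' le0)
    then have "sim s ?vals [d..<d + ?n] (d + ?n) s''"
      using s'' unfolding sim_def by auto
    then have c: "computes (compile f [d..<d + ?n] (d + ?n)) (d + ?n) ?k (fval f s ?vals) s''"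
      using App.prems by (intro App.IH(1)) auto
    show ?thesis
      using s''(1)
      by (intro computes_then[OF c] tri_Assign)
        (auto intro!: intro: agree_trans' simp: comp_def)
  qed
  then have "computes (compile (App f es) vs d) d
      ((sum_list (map (\<lambda>e. kc e * Q ^ dp e) es) + 1) + (?k + 2)) (fval (App f es) s env) s'"
    unfolding computes_def compile.simps by (intro tri_Seq[OF tri_mono[OF args]]) auto
  moreover have "(sum_list (map (\<lambda>e. kc e * Q ^ dp e) es) + 1) + (?k + 2) \<le> kc (App f es) * Q ^ dp (App f es)"
  proof -
    have "sum_list (map (\<lambda>e. kc e * Q ^ dp e) es) \<le> sum_list (map kc es) * Q ^ sum_list (map dp es)"
    proof (induction es)
      case (Cons e es)
      then show ?case
        using add_cost2[OF assms, of "kc e" "dp e" "sum_list (map kc es)" "sum_list (map dp es)" 0] by simp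
    qed simp
    then show ?thesis
      using add_cost2[OF assms, of "sum_list (map kc es)" "sum_list (map dp es)" "kc f" "dp f" 3] by simp
  qed
  ultimately show ?case by (rule computes_mono)
qed

lemma wregs_seq_coms:
  "(\<And>c d. c \<in> set cs \<Longrightarrow> wregs (c vs d) \<subseteq> range slot) \<Longrightarrow> wregs (seq_coms cs vs d) \<subseteq> range slot"
  by (induction cs arbitrary: d) auto

lemma wregs_compile: "wregs (compile e vs d) \<subseteq> range slot"
proof (induction e arbitrary: vs d)
  case (App f es)
  then have "wregs (seq_coms (map compile es) vs d) \<subseteq> range slot"
    by (intro wregs_seq_coms) (metis (no_types, lifting) image_iff list.set_map)
  with App show ?case by simp
qed (auto simp: loop_com_def)

lemma warrs_seq_coms:
  "(\<And>c d. c \<in> set cs \<Longrightarrow> warrs (c vs d) = {}) \<Longrightarrow> warrs (seq_coms cs vs d) = {}"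
  by (induction cs arbitrary: d) auto

lemma warrs_compile: "warrs (compile e vs d) = {}"
proof (induction e arbitrary: vs d)
  case (App f es)
  then have "warrs (seq_coms (map compile es) vs d) = {}"
    by (intro warrs_seq_coms) auto
  with App show ?case by simp
qed (auto simp: loop_com_def)

section \<open>States of the dynamic program\<close>

lemma nat_of_bits:
  "\<exists>c < 2 ^ k. \<forall>y < k. bit (c :: nat) y \<longleftrightarrow> P y"
proof (intro exI conjI allI impI)
  let ?c = "horner_sum of_bool 2 (map P [0..<k]) :: nat"
  show "?c < 2 ^ k"
    using horner_sum_of_bool_2_less[of "map P [0..<k]", where 'a = nat] by simp
  show "bit ?c y \<longleftrightarrow> P y" if "y < k" for y
    using that by (simp add: bit_horner_sum_bit_iff)
qed

lemma bit_less_power: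
  assumes "(c :: nat) < 2 ^ k" "bit c y"
  shows "y < k"
proof (rule ccontr)
  assume "\<not> y < k"
  then have "(2 :: nat) ^ k \<le> 2 ^ y" by simp
  with assms(1) have "c < 2 ^ y" by (rule less_le_trans)
  then have "c div 2 ^ y = 0" by simp
  then show False using assms(2) by (simp add: bit_iff_odd)
qed

lemma nat_eq_if_bits:
  assumes "(c :: nat) < 2 ^ k" "c' < 2 ^ k" "\<And>y. y < k \<Longrightarrow> bit c y \<longleftrightarrow> bit c' y"
  shows "c = c'"
proof (rule bit_eqI)
  show "bit c y \<longleftrightarrow> bit c' y" for y
    using assms bit_less_power[OF assms(1), of y] bit_less_power[OF assms(2), of y] by blast
qed

lemma nat_of_digits:
  fixes B :: nat
  assumes "\<And>h. h < r \<Longrightarrow> d h < B"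
  shows "\<exists>\<tau> < B ^ r. \<forall>h < r. \<tau> div B ^ h mod B = d h"
  using assms
proof (induction r)
  case 0
  show ?case by (rule exI[of _ 0]) simp
next
  case (Suc r)
  then obtain \<tau> where \<tau>: "\<tau> < B ^ r" "\<And>h. h < r \<Longrightarrow> \<tau> div B ^ h mod B = d h"
    by auto
  have B: "0 < B" "d r < B"
    using Suc.prems[of r] by auto
  have "\<tau> + d r * B ^ r < B ^ Suc r"
  proof -
    have "\<tau> + d r * B ^ r < (1 + d r) * B ^ r"
      using \<tau> by simp
    also have "\<dots> \<le> B * B ^ r"
      using B by (intro mult_le_mono1) auto
    finally show ?thesis by simp
  qed
  moreover have "(\<tau> + d r * B ^ r) div B ^ h mod B = d h" if "h < Suc r" for h
  proof (cases "h = r")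
    case True
    then show ?thesis using \<tau> B by simp
  next
    case False
    then have "h < r" using that by simp
    then obtain k where k: "r = h + Suc k"
      using less_iff_Suc_add by auto
    then have eq: "\<tau> + d r * B ^ r = \<tau> + (B * (d r * B ^ k)) * B ^ h"
      by (simp add: power_add algebra_simps)
    have "(\<tau> + d r * B ^ r) div B ^ h = \<tau> div B ^ h + B * (d r * B ^ k)"
      unfolding eq using B(1) by simp
    then show ?thesis
      using \<tau>(2)[OF \<open>h < r\<close>] by simp
  qed
  ultimately show ?case by blast
qed

lemma digits_zero:
  assumes "\<tau> < B ^ r" "\<And>h. h < r \<Longrightarrow> \<tau> div B ^ h mod B = 0"
  shows "\<tau> = (0 :: nat)"
  using assms
proof (induction r arbitrary: \<tau>)
  case (Suc r)
  have "\<tau> mod B = 0"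
    using Suc.prems(2)[of 0] by simp
  then obtain \<sigma> where \<sigma>: "\<tau> = B * \<sigma>" by auto
  have "B \<noteq> 0"
    using Suc.prems(1) by (cases B) auto
  have "\<sigma> = 0"
  proof (rule Suc.IH)
    show "\<sigma> < B ^ r"
      using Suc.prems(1) \<sigma> \<open>B \<noteq> 0\<close> by simp
    show "\<sigma> div B ^ h mod B = 0" if "h < r" for h
      using Suc.prems(2)[of "Suc h"] that \<sigma> \<open>B \<noteq> 0\<close> by (simp add: div_mult2_eq)
  qed
  then show ?case using \<sigma> by simp
qed simp

text \<open>
  A digit records where a vertex of \<open>H\<close> is mapped by a partial embedding into the part of \<open>G\<close>
  below a node: 0 if it is not mapped, 1 if it is mapped outside the bag, and \<open>p + 2\<close> if it is
  mapped to the vertex at position \<open>p\<close> of the bag.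
\<close>

locale states =
  fixes r B :: nat and hadj :: "nat \<Rightarrow> nat \<Rightarrow> bool" and E :: "(nat \<times> nat) set"
    and bl :: "nat \<Rightarrow> nat \<Rightarrow> nat" and bs :: "nat \<Rightarrow> nat" and V :: "nat \<Rightarrow> nat set"
  assumes r: "1 \<le> r"
    and hadj_sym: "hadj h h' \<Longrightarrow> hadj h' h" and hadj_irrefl: "\<not> hadj h h"
    and E_sym: "(u, v) \<in> E \<Longrightarrow> (v, u) \<in> E"
begin

definition L :: nat where "L = B ^ r"

definition bag :: "nat \<Rightarrow> nat set" where "bag i = bl i ` {..<bs i}"

definition vx :: "nat \<Rightarrow> nat \<Rightarrow> nat" where "vx i d = bl i (d - 2)"

definition pos :: "nat \<Rightarrow> nat \<Rightarrow> nat" where "pos i v = the_inv_into {..<bs i} (bl i) v"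

text \<open>The 2 in \<open>bs i + 2 \<le> B\<close> makes room for the digits 0 and 1.\<close>

definition node :: "nat \<Rightarrow> bool" where
  "node i \<longleftrightarrow> inj_on (bl i) {..<bs i} \<and> bs i + 2 \<le> B \<and> bag i \<subseteq> V i"

text \<open>These are the partial, not necessarily induced, subgraph embeddings of H into the graph
  on \<open>A\<close>.\<close>

definition emb :: "nat set \<Rightarrow> (nat \<Rightarrow> nat option) \<Rightarrow> bool" where
  "emb A \<phi> \<longleftrightarrow> (\<forall>h < r. \<forall>v. \<phi> h = Some v \<longrightarrow> v \<in> A \<and>
     (\<forall>h' < r. \<forall>v'. \<phi> h' = Some v' \<longrightarrow> (v = v' \<longrightarrow> h = h') \<and> (hadj h h' \<longrightarrow> (v, v') \<in> E)))"

definition dig :: "nat \<Rightarrow> nat option \<Rightarrow> nat" where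
  "dig i x = (case x of None \<Rightarrow> 0 | Some v \<Rightarrow> if v \<in> bag i then pos i v + 2 else 1)"

definition has_type :: "nat \<Rightarrow> nat set \<Rightarrow> (nat \<Rightarrow> nat) \<Rightarrow> bool" where
  "has_type i A d \<longleftrightarrow> (\<exists>\<phi>. emb A \<phi> \<and> (\<forall>h < r. d h = dig i (\<phi> h)))"

text \<open>
  \<open>okd i j d dj\<close>: an embedding may have digit \<open>d\<close> at node \<open>i\<close> while its part below the child \<open>j\<close>
  has digit \<open>dj\<close>. A vertex of \<open>H\<close> that is unmapped below one child may be mapped below the other.
\<close>

definition okd :: "nat \<Rightarrow> nat \<Rightarrow> nat \<Rightarrow> nat \<Rightarrow> bool" where
  "okd i j d dj \<longleftrightarrow>
     (if dj = 0 then d < 2 \<or> vx i d \<notin> bag j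
      else if dj = 1 then d = 1
      else if vx j dj \<in> bag i then 2 \<le> d \<and> vx i d = vx j dj
      else d = 1)"

text \<open>Compatibility of a type with the types of its two restrictions. An image outside the bag
  lies below exactly one child, hence the exclusive choice for digit 1. Edges between bag positions
  are looked up in \<open>E\<close>; an edge with an end outside the bag lies below one child, so it
  suffices that this child's embedding maps both ends. Injectivity is tested inside the bag;
  elsewhere it is inherited from one child.\<close>

definition rel :: "nat \<Rightarrow> nat \<Rightarrow> nat \<Rightarrow> (nat \<Rightarrow> nat) \<Rightarrow> (nat \<Rightarrow> nat) \<Rightarrow> (nat \<Rightarrow> nat) \<Rightarrow> bool" where
  "rel i j1 j2 d d1 d2 \<longleftrightarrow> (\<forall>h < r. okd i j1 (d h) (d1 h) \<and> okd i j2 (d h) (d2 h) \<and>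
     (d h = 1 \<longrightarrow> (d1 h \<noteq> 0) \<noteq> (d2 h \<noteq> 0)) \<and>
     (\<forall>h' < r. (2 \<le> d h \<and> d h = d h' \<longrightarrow> h = h') \<and>
       (hadj h h' \<longrightarrow>
         (2 \<le> d h \<and> 2 \<le> d h' \<longrightarrow> (vx i (d h), vx i (d h')) \<in> E) \<and>
         (d h = 1 \<and> d h' \<noteq> 0 \<longrightarrow> d1 h \<noteq> 0 \<and> d1 h' \<noteq> 0 \<or> d2 h \<noteq> 0 \<and> d2 h' \<noteq> 0))))"

text \<open>The separation properties of a node of the decomposition, stated without the tree. Each
  of the four kinds of node has them once missing children are replaced by ones with nothing
  below.\<close>

definition split_node :: "nat \<Rightarrow> nat \<Rightarrow> nat \<Rightarrow> bool" where
  "split_node i j1 j2 \<longleftrightarrow> node i \<and> node j1 \<and> node j2 \<and>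
     V i = bag i \<union> V j1 \<union> V j2 \<and> V j1 \<inter> V j2 \<subseteq> bag i \<and>
     bag i \<inter> V j1 \<subseteq> bag j1 \<and> bag i \<inter> V j2 \<subseteq> bag j2 \<and>
     (\<forall>(u, v) \<in> E. u \<notin> bag i \<longrightarrow> v \<in> V i \<longrightarrow> (u \<in> V j1 \<longrightarrow> v \<in> V j1) \<and> (u \<in> V j2 \<longrightarrow> v \<in> V j2))"

definition digit :: "nat \<Rightarrow> nat \<Rightarrow> nat" where "digit \<tau> h = \<tau> div B ^ h mod B"

text \<open>The number \<open>c\<close> is a set of types, with one block of \<open>L\<close> bits
  per colour. The equivalence, rather than one implication, makes the absence of a type
  visible.\<close>

definition realises :: "nat \<Rightarrow> nat \<Rightarrow> (nat \<Rightarrow> nat) \<Rightarrow> bool" where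
  "realises i c col \<longleftrightarrow> c < 2 ^ (2 * L) \<and> (\<forall>v. col v < 2) \<and>
     (\<forall>q < 2. \<forall>\<tau> < L. bit c (q * L + \<tau>) \<longleftrightarrow> has_type i {v \<in> V i. col v = q} (digit \<tau>))"

definition feas :: "nat \<Rightarrow> nat \<Rightarrow> bool" where
  "feas i c \<longleftrightarrow> (\<exists>col. realises i c col)"

text \<open>In the block of colour 0, bit \<open>p + 2\<close> tells whether the bag vertex at
  position \<open>p\<close> has that colour; see \<open>typ_singleton\<close>.\<close>

definition same_colours :: "nat \<Rightarrow> nat \<Rightarrow> nat \<Rightarrow> nat \<Rightarrow> bool" where
  "same_colours i c j cj \<longleftrightarrow>
     (\<forall>p < bs i. \<forall>p' < bs j. bl i p = bl j p' \<longrightarrow> (bit c (p + 2) \<longleftrightarrow> bit cj (p' + 2)))"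

text \<open>Bag positions used by the type must exist and carry colour \<open>q\<close>. The colours
  are taken from \<open>c\<close> itself, since a bag vertex may be new at \<open>i\<close> and
  unknown to both children.\<close>

definition joins :: "nat \<Rightarrow> nat \<Rightarrow> nat \<Rightarrow> nat \<Rightarrow> nat \<Rightarrow> nat \<Rightarrow> nat \<Rightarrow> nat \<Rightarrow> bool" where
  "joins i c j1 c1 j2 c2 q \<tau> \<longleftrightarrow>
     (\<forall>h < r. 2 \<le> digit \<tau> h \<longrightarrow> digit \<tau> h - 2 < bs i \<and> bit c (q * L + digit \<tau> h)) \<and>
     (\<exists>\<tau>1 < L. \<exists>\<tau>2 < L. bit c1 (q * L + \<tau>1) \<and> bit c2 (q * L + \<tau>2) \<and>
       rel i j1 j2 (digit \<tau>) (digit \<tau>1) (digit \<tau>2))"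

text \<open>The first conjunct makes the guessed singleton bits a 2-colouring of the bag. The last
  one checks every bit against the children, the singleton bits included.\<close>

definition local_ok :: "nat \<Rightarrow> nat \<Rightarrow> nat \<Rightarrow> nat \<Rightarrow> nat \<Rightarrow> nat \<Rightarrow> bool" where
  "local_ok i c j1 c1 j2 c2 \<longleftrightarrow>
     (\<forall>p < bs i. bit c (p + 2) \<noteq> bit c (L + (p + 2))) \<and>
     same_colours i c j1 c1 \<and> same_colours i c j2 c2 \<and>
     (\<forall>q < 2. \<forall>\<tau> < L. bit c (q * L + \<tau>) \<longleftrightarrow> joins i c j1 c1 j2 c2 q \<tau>)"

section \<open>Splitting and gluing partial embeddings\<close>

lemma pos_props:
  assumes "node i" "v \<in> bag i"
  shows "pos i v < bs i" "bl i (pos i v) = v"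
proof -
  have "v \<in> bl i ` {..<bs i}" "inj_on (bl i) {..<bs i}"
    using assms by (auto simp: bag_def node_def)
  then show "pos i v < bs i" "bl i (pos i v) = v"
    unfolding pos_def using the_inv_into_into[of "bl i" "{..<bs i}" v "{..<bs i}"]
    by (auto simp: f_the_inv_into_f)
qed

lemma pos_bl: "node i \<Longrightarrow> p < bs i \<Longrightarrow> pos i (bl i p) = p"
  unfolding node_def pos_def by (simp add: the_inv_into_f_f)

lemma bl_in_bag: "p < bs i \<Longrightarrow> bl i p \<in> bag i"
  by (auto simp: bag_def)

lemma dig_simps:
  "dig i None = 0" "v \<in> bag i \<Longrightarrow> dig i (Some v) = pos i v + 2" "v \<notin> bag i \<Longrightarrow> dig i (Some v) = 1"
  by (auto simp: dig_def)

lemma dig_eq_1: "dig i x = Suc 0 \<longleftrightarrow> (\<exists>v. x = Some v \<and> v \<notin> bag i)"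
  by (auto simp: dig_def split: option.splits)

lemma dig_ge_2: "2 \<le> dig i x \<longleftrightarrow> (\<exists>v. x = Some v \<and> v \<in> bag i)"
  by (auto simp: dig_def split: option.splits)

lemma dig_less: "node i \<Longrightarrow> dig i x < B"
  unfolding dig_def using pos_props(1)[of i] by (fastforce simp: node_def split: option.splits)

lemma vx_dig: "node i \<Longrightarrow> 2 \<le> dig i (Some v) \<Longrightarrow> v \<in> bag i \<and> vx i (dig i (Some v)) = v"
  unfolding dig_def vx_def using pos_props(2)[of i v] by (auto split: if_splits)

lemma dig_eq_0: "dig i x = 0 \<longleftrightarrow> x = None"
  by (auto simp: dig_def split: option.splits)

definition restr :: "nat set \<Rightarrow> nat option \<Rightarrow> nat option" where
  "restr A x = (case x of None \<Rightarrow> None | Some v \<Rightarrow> if v \<in> A then Some v else None)"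

lemma restr_Some: "restr A x = Some v \<longleftrightarrow> x = Some v \<and> v \<in> A"
  by (auto simp: restr_def split: option.splits)

lemma restr_None: "restr A x = None \<longleftrightarrow> (\<forall>v. x = Some v \<longrightarrow> v \<notin> A)"
  by (auto simp: restr_def split: option.splits)

lemma emb_restr: "emb A \<phi> \<Longrightarrow> emb (A \<inter> W) (\<lambda>h. restr W (\<phi> h))"
  unfolding emb_def by (auto simp: restr_Some)

lemma okd_restr:
  assumes "node i" "node j" "bag i \<inter> V j \<subseteq> bag j"
  shows "okd i j (dig i x) (dig j (restr (V j) x))"
proof (cases x)
  case (Some v)
  have [simp]: "v \<in> bag j \<Longrightarrow> v \<in> V j" for v
    using assms by (auto simp: node_def)
  show ?thesis
    using assms(3) pos_props(2)[OF assms(1), of v] pos_props(2)[OF assms(2), of v] Some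
    by (cases "v \<in> V j"; cases "v \<in> bag i"; cases "v \<in> bag j")
      (auto simp: okd_def restr_def dig_simps vx_def)
qed (simp add: restr_def dig_simps okd_def)

text \<open>Restrict the embedding to the parts below the two children. Separation sends every image
  outside the bag into exactly one part and keeps both ends of its edges together there.\<close>

lemma typ_splits:
  assumes sp: "split_node i j1 j2" and A: "A \<subseteq> V i" and t: "has_type i A d"
  shows "(\<forall>h < r. 2 \<le> d h \<longrightarrow> d h - 2 < bs i \<and> vx i (d h) \<in> A) \<and>
    (\<exists>d1 d2. has_type j1 (A \<inter> V j1) d1 \<and> has_type j2 (A \<inter> V j2) d2 \<and> rel i j1 j2 d d1 d2)"
proof -
  obtain \<phi> where \<phi>: "emb A \<phi>" and d: "\<And>h. h < r \<Longrightarrow> d h = dig i (\<phi> h)"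
    using t unfolding has_type_def by blast
  have n: "node i" "node j1" "node j2"
    using sp by (auto simp: split_node_def)
  define d1 where "d1 = (\<lambda>h. dig j1 (restr (V j1) (\<phi> h)))"
  define d2 where "d2 = (\<lambda>h. dig j2 (restr (V j2) (\<phi> h)))"
  have "has_type j1 (A \<inter> V j1) d1" "has_type j2 (A \<inter> V j2) d2"
    unfolding has_type_def d1_def d2_def using emb_restr[OF \<phi>] by blast+
  moreover have "rel i j1 j2 d d1 d2"
    unfolding rel_def
  proof (intro allI impI conjI; (elim conjE)?)
    fix h assume h: "h < r"
    show "okd i j1 (d h) (d1 h)" "okd i j2 (d h) (d2 h)"
      using okd_restr n sp d[OF h] by (auto simp: d1_def d2_def split_node_def)
    {
      assume 1: "d h = 1"
      then have "dig i (\<phi> h) = Suc 0"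
        using d[OF h] by simp
      then obtain v where v: "\<phi> h = Some v" "v \<notin> bag i"
        unfolding dig_eq_1 by blast
      then have "v \<in> V i"
        using \<phi> A h by (auto simp: emb_def)
      moreover have "V i = bag i \<union> V j1 \<union> V j2" "V j1 \<inter> V j2 \<subseteq> bag i"
        using sp by (auto simp: split_node_def)
      moreover have "d1 h \<noteq> 0 \<longleftrightarrow> v \<in> V j1" "d2 h \<noteq> 0 \<longleftrightarrow> v \<in> V j2"
        using v by (auto simp: d1_def d2_def dig_eq_0 restr_None)
      ultimately show "(d1 h \<noteq> 0) \<noteq> (d2 h \<noteq> 0)"
        using v(2) by blast
    }
    fix h' assume h': "h' < r"
    {
      assume "2 \<le> d h" "d h = d h'"
      moreover from this have "2 \<le> dig i (\<phi> h)" "2 \<le> dig i (\<phi> h')"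
        using d[OF h] d[OF h'] by simp_all
      then obtain v v' where "\<phi> h = Some v" "\<phi> h' = Some v'"
        unfolding dig_ge_2 by blast
      ultimately show "h = h'"
        using vx_dig[OF n(1)] d h h' \<phi> unfolding emb_def by metis
    }
    assume H: "hadj h h'"
    {
      assume "2 \<le> d h" "2 \<le> d h'"
      moreover from this have "2 \<le> dig i (\<phi> h)" "2 \<le> dig i (\<phi> h')"
        using d[OF h] d[OF h'] by simp_all
      then obtain v v' where "\<phi> h = Some v" "\<phi> h' = Some v'"
        unfolding dig_ge_2 by blast
      ultimately show "(vx i (d h), vx i (d h')) \<in> E"
        using vx_dig[OF n(1)] d h h' \<phi> H unfolding emb_def by metis
    }
    assume 1: "d h = 1" "d h' \<noteq> 0"
    then have "dig i (\<phi> h) = Suc 0"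
      using d[OF h] by simp
    then obtain v where v: "\<phi> h = Some v" "v \<notin> bag i"
      unfolding dig_eq_1 by blast
    have "dig i (\<phi> h') \<noteq> 0"
      using 1 d[OF h'] by simp
    then obtain v' where v': "\<phi> h' = Some v'"
      unfolding dig_eq_0 not_None_eq by blast
    have "v \<in> V i" "v' \<in> V i" "(v, v') \<in> E"
      using \<phi> A h h' v v' H by (auto simp: emb_def)
    then have "v \<in> V j1 \<and> v' \<in> V j1 \<or> v \<in> V j2 \<and> v' \<in> V j2"
      using v sp unfolding split_node_def by fastforce
    then show "d1 h \<noteq> 0 \<and> d1 h' \<noteq> 0 \<or> d2 h \<noteq> 0 \<and> d2 h' \<noteq> 0"
      using v v' by (auto simp: d1_def d2_def dig_eq_0 restr_None)
  qed
  moreover have "d h - 2 < bs i \<and> vx i (d h) \<in> A" if h: "h < r" "2 \<le> d h" for h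
  proof -
    have "2 \<le> dig i (\<phi> h)"
      using h d[OF h(1)] by simp
    then obtain v where v: "\<phi> h = Some v"
      unfolding dig_ge_2 by blast
    then have "v \<in> bag i" "vx i (d h) = v" "v \<in> A"
      using vx_dig[OF n(1), of v] h d \<phi> by (auto simp: emb_def)
    then show ?thesis
      using pos_props[OF n(1)] d[OF h(1)] v by (auto simp: dig_simps)
  qed
  ultimately show ?thesis by blast
qed

lemma okd_nonzero: "okd i j d dj \<Longrightarrow> dj \<noteq> 0 \<Longrightarrow> d = 1 \<or> 2 \<le> d \<and> 2 \<le> dj \<and> vx i d = vx j dj"
  by (auto simp: okd_def split: if_splits)

text \<open>Glue the two embeddings: images in the bag are read off the digits, the others are taken
  from whichever child has them. Images outside the bag can coincide only below the same child,
  whose embedding is injective, and an edge at such an image comes from one child's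
  embedding.\<close>

lemma typ_combines:
  assumes sp: "split_node i j1 j2"
    and valid: "\<And>h. h < r \<Longrightarrow> 2 \<le> d h \<Longrightarrow> d h - 2 < bs i \<and> vx i (d h) \<in> A"
    and t1: "has_type j1 (A \<inter> V j1) d1" and t2: "has_type j2 (A \<inter> V j2) d2"
    and rel: "rel i j1 j2 d d1 d2"
  shows "has_type i A d"
proof -
  obtain \<phi>1 where \<phi>1: "emb (A \<inter> V j1) \<phi>1" and d1: "\<And>h. h < r \<Longrightarrow> d1 h = dig j1 (\<phi>1 h)"
    using t1 unfolding has_type_def by blast
  obtain \<phi>2 where \<phi>2: "emb (A \<inter> V j2) \<phi>2" and d2: "\<And>h. h < r \<Longrightarrow> d2 h = dig j2 (\<phi>2 h)"
    using t2 unfolding has_type_def by blast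
  have n: "node i" "node j1" "node j2"
    using sp by (auto simp: split_node_def)
  define \<phi> where "\<phi> = (\<lambda>h. if 2 \<le> d h then Some (vx i (d h))
    else if d h = 1 then (if d1 h \<noteq> 0 then \<phi>1 h else \<phi>2 h) else None)"
  have ok: "okd i j1 (d h) (d1 h)" "okd i j2 (d h) (d2 h)"
    "d h = 1 \<Longrightarrow> (d1 h \<noteq> 0) \<noteq> (d2 h \<noteq> 0)" if "h < r" for h
    using rel that unfolding rel_def by blast+
  \<comment> \<open>Where a child's embedding is defined, the glued one agrees with it, inside the
    bag as well.\<close>
  have lift: "\<phi> h = \<psi> h" if h: "h < r" and nz: "dj \<noteq> 0" and dj: "dj = dig j (\<psi> h)" and j: "node j"
      "okd i j (d h) dj" and 1: "d h = 1 \<Longrightarrow> \<phi> h = \<psi> h" for h j dj \<psi>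
  proof -
    obtain v where v: "\<psi> h = Some v"
      using nz unfolding dj dig_eq_0 not_None_eq by blast
    from okd_nonzero[OF j(2) nz] show ?thesis
    proof (elim disjE conjE)
      assume *: "2 \<le> d h" "2 \<le> dj" "vx i (d h) = vx j dj"
      then have "vx j dj = v"
        using vx_dig[OF j(1), of v] dj v by simp
      then show ?thesis
        using * v by (simp add: \<phi>_def)
    qed (rule 1)
  qed
  have from1: "\<phi> h = \<phi>1 h" if "h < r" "d1 h \<noteq> 0" for h
    using lift[where \<psi> = \<phi>1, OF that d1[OF that(1)] n(2) ok(1)[OF that(1)]] that by (simp add: \<phi>_def)
  have from2: "\<phi> h = \<phi>2 h" if "h < r" "d2 h \<noteq> 0" for h
    using lift[where \<psi> = \<phi>2, OF that d2[OF that(1)] n(3) ok(2)[OF that(1)]] that ok(3)[OF that(1)] by (simp add: \<phi>_def)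
  \<comment> \<open>A bag vertex that occurs below \<open>j\<close> is in the bag of
    \<open>j\<close>, so its digit there is at least 2, and \<open>okd\<close> would then forbid
    digit 1 at \<open>i\<close>.\<close>
  have notin_bag: "v \<notin> bag i" if "okd i j 1 dj" "dj = dig j (Some v)" "node j" "v \<in> V j" "bag i \<inter> V j \<subseteq> bag j" for v j dj
  proof
    assume b: "v \<in> bag i"
    then have "2 \<le> dj" "vx j dj = v"
      using that vx_dig[of j v] dig_simps(2)[of v j] by auto
    then show False
      using that(1) b by (simp add: okd_def)
  qed
  have outside: "v \<notin> bag i \<and>
      (d1 h \<noteq> 0 \<and> \<phi>1 h = Some v \<and> v \<in> V j1 \<and> v \<notin> V j2 \<or> d2 h \<noteq> 0 \<and> \<phi>2 h = Some v \<and> v \<in> V j2 \<and> v \<notin> V j1)"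
    if h: "h < r" and 1: "d h = 1" and v: "\<phi> h = Some v" for h v
  proof (cases "d1 h = 0")
    case False
    then have v1: "\<phi>1 h = Some v" "v \<in> V j1"
      using from1[OF h] v \<phi>1 h by (auto simp: emb_def)
    then have "v \<notin> bag i"
      using notin_bag[of j1 "d1 h" v] ok(1)[OF h] 1 d1[OF h] n sp by (simp add: split_node_def)
    then show ?thesis
      using False v1 sp by (auto simp: split_node_def)
  next
    case True
    then have 2: "d2 h \<noteq> 0" using ok(3)[OF h 1] by simp
    then have v2: "\<phi>2 h = Some v" "v \<in> V j2"
      using from2[OF h] v \<phi>2 h by (auto simp: emb_def)
    then have "v \<notin> bag i"
      using notin_bag[of j2 "d2 h" v] ok(2)[OF h] 1 d2[OF h] n sp by (simp add: split_node_def)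
    then show ?thesis
      using 2 v2 sp by (auto simp: split_node_def)
  qed
  have inside: "v \<in> bag i \<and> v \<in> A \<and> dig i (Some v) = d h"
    if h: "h < r" and 2: "2 \<le> d h" and v: "\<phi> h = Some v" for h v
  proof -
    have "v = bl i (d h - 2)" "d h - 2 < bs i" "v \<in> A"
      using valid[OF h 2] v 2 by (auto simp: \<phi>_def vx_def)
    then show ?thesis
      using pos_bl[OF n(1)] bl_in_bag 2 by (simp add: dig_simps)
  qed
  have cases: "2 \<le> d h \<or> d h = 1" if "\<phi> h = Some v" for h v
    using that by (auto simp: \<phi>_def split: if_splits)
  have edge: "(v, v') \<in> E" if "h < r" "h' < r" "\<phi> h = Some v" "\<phi> h' = Some v'" "hadj h h'" "d h = 1"
    for h h' v v'
  proof -
    have "d h' \<noteq> 0" using cases that by fastforce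
    then have "d1 h \<noteq> 0 \<and> d1 h' \<noteq> 0 \<or> d2 h \<noteq> 0 \<and> d2 h' \<noteq> 0"
      using rel that unfolding rel_def by blast
    then have "\<phi>1 h = Some v \<and> \<phi>1 h' = Some v' \<or> \<phi>2 h = Some v \<and> \<phi>2 h' = Some v'"
      using from1 from2 that by metis
    then show ?thesis
      using \<phi>1 \<phi>2 that unfolding emb_def by blast
  qed
  have "emb A \<phi>"
    unfolding emb_def
  proof (intro allI impI conjI)
    fix h v assume h: "h < r" and v: "\<phi> h = Some v"
    show "v \<in> A"
      using cases[OF v] inside[OF h _ v] outside[OF h _ v] \<phi>1 \<phi>2 h unfolding emb_def by blast
    fix h' v' assume h': "h' < r" and v': "\<phi> h' = Some v'"
    {
      assume "hadj h h'"
      show "(v, v') \<in> E"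
      proof (cases "d h = 1 \<or> d h' = 1")
        case True
        then show ?thesis
          using edge h h' v v' \<open>hadj h h'\<close> E_sym hadj_sym by blast
      next
        case False
        then have "2 \<le> d h" "2 \<le> d h'" using cases v v' by blast+
        then show ?thesis
          using rel h h' \<open>hadj h h'\<close> v v' unfolding rel_def \<phi>_def by auto
      qed
    }
    assume eq: "v = v'"
    consider "2 \<le> d h" "2 \<le> d h'" | "2 \<le> d h" "d h' = 1" | "d h = 1" "2 \<le> d h'" | "d h = 1" "d h' = 1"
      using cases v v' by blast
    then show "h = h'"
    proof cases
      case 1
      then have "d h = d h'"
        using inside h h' v v' eq by metis
      then show ?thesis using rel h h' 1 unfolding rel_def by blast
    next
      case 4
      then have "\<phi>1 h = Some v \<and> \<phi>1 h' = Some v' \<or> \<phi>2 h = Some v \<and> \<phi>2 h' = Some v'"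
        using outside[OF h _ v] outside[OF h' _ v'] eq by blast
      then show ?thesis
        using \<phi>1 \<phi>2 h h' eq unfolding emb_def by blast
    qed (use inside outside h h' v v' eq in blast)+
  qed
  moreover have "d h = dig i (\<phi> h)" if h: "h < r" for h
  proof (cases "\<phi> h")
    case None
    have "d h \<noteq> 1"
    proof
      assume 1: "d h = 1"
      then show False
        using None ok(3)[OF h 1] d1[OF h] d2[OF h] by (auto simp: \<phi>_def dig_eq_0 split: if_splits)
    qed
    then show ?thesis
      using None by (auto simp: \<phi>_def dig_simps split: if_splits)
  next
    case (Some v)
    then show ?thesis
      using cases[OF Some] inside[OF h _ Some] outside[OF h _ Some] by (auto simp: dig_simps)
  qed
  ultimately show ?thesis unfolding has_type_def by blast
qed

lemma typ_cong: "(\<And>h. h < r \<Longrightarrow> d h = d' h) \<Longrightarrow> has_type i A d \<longleftrightarrow> has_type i A d'"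
  unfolding has_type_def by auto

lemma rel_cong:
  "(\<And>h. h < r \<Longrightarrow> d1 h = d1' h) \<Longrightarrow> (\<And>h. h < r \<Longrightarrow> d2 h = d2' h) \<Longrightarrow>
    rel i j1 j2 d d1 d2 \<longleftrightarrow> rel i j1 j2 d d1' d2'"
  unfolding rel_def by auto

lemma typ_encode:
  assumes "node i" "has_type i A d"
  shows "\<exists>\<tau> < L. \<forall>h < r. digit \<tau> h = d h"
proof -
  have "d h < B" if "h < r" for h
    using assms that dig_less unfolding has_type_def by auto
  then show ?thesis
    using nat_of_digits[of r d B] unfolding L_def digit_def by blast
qed

text \<open>Replaces the digit functions of the children by their codes below \<open>L\<close>,
  which makes the search finite.\<close>

lemma typ_step:
  assumes sp: "split_node i j1 j2" and A: "A \<subseteq> V i"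
  shows "has_type i A d \<longleftrightarrow>
    (\<forall>h < r. 2 \<le> d h \<longrightarrow> d h - 2 < bs i \<and> vx i (d h) \<in> A) \<and>
    (\<exists>\<tau>1 < L. \<exists>\<tau>2 < L. has_type j1 (A \<inter> V j1) (digit \<tau>1) \<and> has_type j2 (A \<inter> V j2) (digit \<tau>2) \<and>
      rel i j1 j2 d (digit \<tau>1) (digit \<tau>2))" (is "_ \<longleftrightarrow> ?valid \<and> ?R")
proof
  assume t: "has_type i A d"
  from typ_splits[OF sp A t] obtain d1 d2 where
    *: "has_type j1 (A \<inter> V j1) d1" "has_type j2 (A \<inter> V j2) d2" "rel i j1 j2 d d1 d2" and v: ?valid
    by blast
  have n: "node j1" "node j2"
    using sp by (auto simp: split_node_def)
  obtain \<tau>1 \<tau>2 where \<tau>: "\<tau>1 < L" "\<tau>2 < L" "\<forall>h < r. digit \<tau>1 h = d1 h" "\<forall>h < r. digit \<tau>2 h = d2 h"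
    using typ_encode n * by meson
  have "has_type j1 (A \<inter> V j1) (digit \<tau>1)" "has_type j2 (A \<inter> V j2) (digit \<tau>2)" "rel i j1 j2 d (digit \<tau>1) (digit \<tau>2)"
    using * \<tau> typ_cong[of "digit \<tau>1" d1] typ_cong[of "digit \<tau>2" d2]
      rel_cong[of "digit \<tau>1" d1 "digit \<tau>2" d2] by blast+
  with v \<tau> show "?valid \<and> ?R" by blast
next
  assume "?valid \<and> ?R"
  then show "has_type i A d"
    using typ_combines[OF sp] by blast
qed

section \<open>Colours read off a state, and the recursion for feasible states\<close>

lemma B_le_L: "B \<le> L"
proof (cases "B = 0")
  case False
  then have "B ^ 1 \<le> B ^ r"
    using r by (intro power_increasing) auto
  then show ?thesis by (simp add: L_def)
qed simp

lemma digit_small: "x < B \<Longrightarrow> digit x h = (if h = 0 then x else 0)"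
proof -
  assume x: "x < B"
  have "x < B ^ h" if "h \<noteq> 0"
  proof -
    have "B ^ 1 \<le> B ^ h"
      using that x by (intro power_increasing) auto
    then show ?thesis using x by simp
  qed
  then show ?thesis
    using x by (auto simp: digit_def)
qed

text \<open>Since \<open>p + 2 < B\<close>, the only non-zero digit of \<open>p + 2\<close> is the
  lowest one, that of vertex 0 of H, which exists by \<open>1 \<le> r\<close>.\<close>

lemma typ_singleton:
  assumes "node i" "p < bs i"
  shows "has_type i A (digit (p + 2)) \<longleftrightarrow> bl i p \<in> A"
proof
  have p: "p + 2 < B"
    using assms by (auto simp: node_def)
  {
    assume "has_type i A (digit (p + 2))"
    then obtain \<phi> where \<phi>: "emb A \<phi>" "\<forall>h < r. digit (p + 2) h = dig i (\<phi> h)"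
      unfolding has_type_def by blast
    then have d: "dig i (\<phi> 0) = p + 2"
      using r digit_small[OF p, of 0] by fastforce
    then have "dig i (\<phi> 0) \<noteq> 0"
      by simp
    then obtain v where v: "\<phi> 0 = Some v"
      unfolding dig_eq_0 not_None_eq by blast
    then have "v = bl i p"
      using vx_dig[OF assms(1), of v] d by (auto simp: vx_def)
    then show "bl i p \<in> A"
      using v \<phi>(1) r unfolding emb_def by auto
  next
    assume A: "bl i p \<in> A"
    let ?\<phi> = "\<lambda>h. if h = 0 then Some (bl i p) else None"
    have "emb A ?\<phi>"
      using A hadj_irrefl by (auto simp: emb_def)
    moreover have "digit (p + 2) h = dig i (?\<phi> h)" for h
      using digit_small[OF p] assms bl_in_bag[OF assms(2)] by (auto simp: dig_simps pos_bl)
    ultimately show "has_type i A (digit (p + 2))"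
      unfolding has_type_def by blast
  }
qed

lemma realises_colour:
  assumes "realises i c col" "node i" "p < bs i" "q < 2"
  shows "bit c (q * L + (p + 2)) \<longleftrightarrow> col (bl i p) = q"
proof -
  have "p + 2 < L"
    using assms(2,3) B_le_L by (auto simp: node_def)
  moreover have "bl i p \<in> V i"
    using assms bl_in_bag by (auto simp: node_def)
  moreover from calculation have
    "bit c (q * L + (p + 2)) \<longleftrightarrow> has_type i {v \<in> V i. col v = q} (digit (p + 2))"
    using assms(1,4) unfolding realises_def by blast
  ultimately show ?thesis
    unfolding typ_singleton[OF assms(2,3)] by simp
qed

lemma less_2_iff: "(q :: nat) < 2 \<longleftrightarrow> q = 0 \<or> q = 1"
  by auto

lemma realises_exists:
  assumes "\<And>v. col v < 2"
  shows "\<exists>c. realises i c col"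
proof -
  obtain c :: nat where c: "c < 2 ^ (2 * L)"
    "\<forall>y < 2 * L. bit c y \<longleftrightarrow> has_type i {v \<in> V i. col v = y div L} (digit (y mod L))"
    using nat_of_bits[of "2 * L" "\<lambda>y. has_type i {v \<in> V i. col v = y div L} (digit (y mod L))"] by blast
  have "bit c (q * L + \<tau>) \<longleftrightarrow> has_type i {v \<in> V i. col v = q} (digit \<tau>)" if "q < 2" "\<tau> < L" for q \<tau>
  proof -
    have "q * L + \<tau> < 2 * L" "(q * L + \<tau>) div L = q" "(q * L + \<tau>) mod L = \<tau>"
      using that by (auto simp: less_2_iff)
    then show ?thesis using c(2) by metis
  qed
  then have "realises i c col"
    using c(1) assms unfolding realises_def by blast
  then show ?thesis ..
qed

text \<open>Asks of \<open>c\<close> only that its singleton bits encode \<open>col\<close>. In the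
  forward direction of \<open>feas_step\<close> this follows from \<open>realises\<close>; in the
  backward direction it is known before the other bits are.\<close>

lemma joins_iff:
  assumes sp: "split_node i j1 j2"
    and colour: "\<And>p q. p < bs i \<Longrightarrow> q < 2 \<Longrightarrow> bit c (q * L + (p + 2)) \<longleftrightarrow> col (bl i p) = q"
    and c1: "realises j1 c1 col1" and c2: "realises j2 c2 col2"
    and V1: "{v \<in> V j1. col v = q} = {v \<in> V j1. col1 v = q}"
    and V2: "{v \<in> V j2. col v = q} = {v \<in> V j2. col2 v = q}"
    and q: "q < 2"
  shows "has_type i {v \<in> V i. col v = q} (digit \<tau>) \<longleftrightarrow> joins i c j1 c1 j2 c2 q \<tau>"
proof -
  let ?A = "{v \<in> V i. col v = q}"
  have "?A \<inter> V j1 = {v \<in> V j1. col1 v = q}" "?A \<inter> V j2 = {v \<in> V j2. col2 v = q}"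
    using sp V1 V2 by (auto simp: split_node_def)
  moreover have "vx i d \<in> ?A \<longleftrightarrow> bit c (q * L + d)" if "d - 2 < bs i" "2 \<le> d" for d
  proof -
    have "d - 2 + 2 = d" "bl i (d - 2) \<in> V i"
      using that bl_in_bag sp by (auto simp: split_node_def)
    then show ?thesis
      using colour[OF that(1) q] unfolding vx_def by simp
  qed
  then have "(\<forall>h < r. 2 \<le> digit \<tau> h \<longrightarrow> digit \<tau> h - 2 < bs i \<and> vx i (digit \<tau> h) \<in> ?A) \<longleftrightarrow>
      (\<forall>h < r. 2 \<le> digit \<tau> h \<longrightarrow> digit \<tau> h - 2 < bs i \<and> bit c (q * L + digit \<tau> h))"
    by blast
  moreover have "?A \<subseteq> V i" by auto
  ultimately show ?thesis
    using c1 c2 q unfolding typ_step[OF sp \<open>?A \<subseteq> V i\<close>] joins_def realises_def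
    by (simp cong: conj_cong)
qed

text \<open>Forwards, one colouring restricts to both children. Backwards, colourings of the two
  parts are glued; the parts overlap only in the bag, where both agree with the colours in
  \<open>c\<close>.\<close>

theorem feas_step:
  assumes sp: "split_node i j1 j2"
  shows "feas i c \<longleftrightarrow> c < 2 ^ (2 * L) \<and> (\<exists>c1 c2. feas j1 c1 \<and> feas j2 c2 \<and> local_ok i c j1 c1 j2 c2)"
proof
  have n: "node i" "node j1" "node j2"
    using sp by (auto simp: split_node_def)
  {
    assume "feas i c"
    then obtain col where col: "realises i c col"
      unfolding feas_def by blast
    then have lt: "\<And>v. col v < 2"
      by (auto simp: realises_def)
    obtain c1 where c1: "realises j1 c1 col"
      using realises_exists[of col j1] lt by blast
    obtain c2 where c2: "realises j2 c2 col"
      using realises_exists[of col j2] lt by blast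
    have colour: "bit c (q * L + (p + 2)) \<longleftrightarrow> col (bl i p) = q" if "p < bs i" "q < 2" for p q
      using realises_colour[OF col n(1)] that by blast
    have "local_ok i c j1 c1 j2 c2"
      unfolding local_ok_def
    proof (intro conjI allI impI)
      fix p assume p: "p < bs i"
      show "bit c (p + 2) \<noteq> bit c (L + (p + 2))"
        using colour[OF p, of 0] colour[OF p, of 1] lt[of "bl i p"] by (auto simp: less_2_iff)
    next
      show "same_colours i c j1 c1"
        unfolding same_colours_def
        using colour[of _ 0] realises_colour[OF c1 n(2), of _ 0] by auto
      show "same_colours i c j2 c2"
        unfolding same_colours_def
        using colour[of _ 0] realises_colour[OF c2 n(3), of _ 0] by auto
    next
      fix q \<tau> :: nat assume q: "q < 2" and \<tau>: "\<tau> < L"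
      then show "bit c (q * L + \<tau>) \<longleftrightarrow> joins i c j1 c1 j2 c2 q \<tau>"
        using col joins_iff[OF sp colour c1 c2 refl refl q] unfolding realises_def by blast
    qed
    then show "c < 2 ^ (2 * L) \<and> (\<exists>c1 c2. feas j1 c1 \<and> feas j2 c2 \<and> local_ok i c j1 c1 j2 c2)"
      using c1 c2 col unfolding feas_def realises_def by blast
  next
    assume "c < 2 ^ (2 * L) \<and> (\<exists>c1 c2. feas j1 c1 \<and> feas j2 c2 \<and> local_ok i c j1 c1 j2 c2)"
    then obtain c1 c2 col1 col2 where c: "c < 2 ^ (2 * L)" and loc: "local_ok i c j1 c1 j2 c2"
      and c1: "realises j1 c1 col1" and c2: "realises j2 c2 col2"
      unfolding feas_def by blast
    define col where "col = (\<lambda>v. if v \<in> bag i then (if bit c (pos i v + 2) then 0 else 1)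
      else if v \<in> V j1 then col1 v else col2 v)"
    have lt: "col v < 2" "col1 v < 2" "col2 v < 2" for v
      using c1 c2 by (auto simp: col_def realises_def)
    have colour: "bit c (q * L + (p + 2)) \<longleftrightarrow> col (bl i p) = q" if p: "p < bs i" and q: "q < 2" for p q
      using loc p q bl_in_bag[OF p] pos_bl[OF n(1) p]
      by (auto simp: local_ok_def col_def less_2_iff)
    have child: "col v = cj v" if "v \<in> V j" "v \<in> bag i" "bag i \<inter> V j \<subseteq> bag j" "node j"
      "same_colours i c j cc" "realises j cc cj" for v j cc cj
    proof -
      have "v \<in> bag j" using that by blast
      then have p: "pos i v < bs i" "pos j v < bs j" "bl i (pos i v) = v" "bl j (pos j v) = v"
        using pos_props n that by auto
      then have "bit c (pos i v + 2) \<longleftrightarrow> bit cc (pos j v + 2)"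
        using that(5) unfolding same_colours_def by auto
      then have "col v = 0 \<longleftrightarrow> cj v = 0"
        using colour[OF p(1), of 0] realises_colour[OF that(6,4) p(2), of 0] p by auto
      moreover have "col v < 2" "cj v < 2"
        using lt that(6) by (auto simp: realises_def)
      ultimately show ?thesis by (auto simp: less_2_iff)
    qed
    have "col v = col1 v" if "v \<in> V j1" for v
      using child[OF that _ _ n(2) _ c1] loc sp that
      by (cases "v \<in> bag i") (auto simp: local_ok_def split_node_def col_def)
    then have e1: "{v \<in> V j1. col v = q} = {v \<in> V j1. col1 v = q}" for q by auto
    have "col v = col2 v" if "v \<in> V j2" for v
    proof (cases "v \<in> bag i")
      case True
      then show ?thesis
        using child[OF that _ _ n(3) _ c2] loc sp by (auto simp: local_ok_def split_node_def)
    next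
      case False
      then show ?thesis
        using sp that by (auto simp: split_node_def col_def)
    qed
    then have e2: "{v \<in> V j2. col v = q} = {v \<in> V j2. col2 v = q}" for q by auto
    have "realises i c col"
      unfolding realises_def
    proof (intro conjI allI impI c lt)
      fix q \<tau> :: nat assume q: "q < 2" and \<tau>: "\<tau> < L"
      then show "bit c (q * L + \<tau>) \<longleftrightarrow> has_type i {v \<in> V i. col v = q} (digit \<tau>)"
        using loc joins_iff[OF sp colour c1 c2 e1 e2 q] unfolding local_ok_def by blast
    qed
    then show "feas i c" unfolding feas_def by blast
  }
qed

section \<open>Empty parts and acceptance at the root\<close>

lemma digit_zero: "digit 0 h = 0"
  by (simp add: digit_def)

text \<open>With no vertices only the empty embedding remains. Its code is 0, which sets the lowest
  bit in each of the two blocks.\<close>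

lemma feas_empty:
  assumes "V j = {}" "2 \<le> B"
  shows "feas j c \<longleftrightarrow> c = 1 + 2 ^ L"
proof -
  have L: "1 \<le> L" "2 \<le> L"
    using B_le_L assms by auto
  have "has_type j {} d \<longleftrightarrow> (\<forall>h < r. d h = 0)" for d
  proof
    assume "has_type j {} d"
    then obtain \<phi> where "emb {} \<phi>" "\<forall>h < r. d h = dig j (\<phi> h)"
      unfolding has_type_def by blast
    then show "\<forall>h < r. d h = 0"
      unfolding emb_def by (auto simp: dig_eq_0 intro: option.exhaust)
  next
    assume "\<forall>h < r. d h = 0"
    then show "has_type j {} d"
      unfolding has_type_def by (intro exI[of _ "\<lambda>_. None"]) (auto simp: emb_def dig_simps)
  qed
  then have t: "has_type j {} (digit \<tau>) \<longleftrightarrow> \<tau> = 0" if "\<tau> < L" for \<tau>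
    using digits_zero[of \<tau> B r] that digit_zero unfolding L_def digit_def by auto
  have b: "bit (1 + 2 ^ L :: nat) y \<longleftrightarrow> y = 0 \<or> y = L" for y
    using even_bit_succ_iff[of "2 ^ L :: nat" y] L by (auto simp: bit_exp_iff)
  have bound: "(1 + 2 ^ L :: nat) < 2 ^ (2 * L)"
  proof -
    have "(4::nat) \<le> 2 ^ L"
      using L power_increasing[of 2 L "2::nat"] by simp
    then have "4 * 2 ^ L \<le> (2 ^ L * 2 ^ L :: nat)" by (intro mult_le_mono1)
    moreover have "(2 ^ (2 * L) :: nat) = 2 ^ L * 2 ^ L" by (simp add: mult_2 power_add)
    ultimately show ?thesis
      using \<open>4 \<le> 2 ^ L\<close> by linarith
  qed
  have "realises j c col \<longleftrightarrow> c = 1 + 2 ^ L \<and> (\<forall>v. col v < 2)" for col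
  proof
    assume R: "realises j c col"
    have "c = 1 + 2 ^ L"
    proof (rule nat_eq_if_bits[of _ "2 * L"])
      show "c < 2 ^ (2 * L)" using R by (simp add: realises_def)
      fix y assume y: "y < 2 * L"
      let ?q = "y div L" and ?\<tau> = "y mod L"
      have "y = ?q * L + ?\<tau>"
        by (rule div_mult_mod_eq[symmetric])
      moreover have "?q < 2" "?\<tau> < L"
        using y L by (auto simp: less_mult_imp_div_less)
      moreover from this have "bit c (?q * L + ?\<tau>) \<longleftrightarrow> ?\<tau> = 0"
        using R t assms(1) by (auto simp: realises_def)
      ultimately show "bit c y \<longleftrightarrow> bit (1 + 2 ^ L :: nat) y"
        using b[of y] L y by (auto simp: less_2_iff)
    qed (rule bound)
    with R show "c = 1 + 2 ^ L \<and> (\<forall>v. col v < 2)" by (simp add: realises_def)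
  next
    assume *: "c = 1 + 2 ^ L \<and> (\<forall>v. col v < 2)"
    have "bit (1 + 2 ^ L :: nat) (q * L + \<tau>) \<longleftrightarrow> has_type j {} (digit \<tau>)" if "q < 2" "\<tau> < L" for q \<tau>
      using b[of "q * L + \<tau>"] t that by (auto simp: less_2_iff)
    with * bound assms(1) show "realises j c col"
      unfolding realises_def by auto
  qed
  then show ?thesis unfolding feas_def by (auto intro: exI[of _ "\<lambda>_. 0"])
qed

text \<open>A class with a vertex realises some type other than 0, by mapping one vertex of H there.
  A type without a digit 0 is an embedding of all of H.\<close>

definition accepting :: "nat \<Rightarrow> bool" where
  "accepting c \<longleftrightarrow> (\<forall>q < 2. (\<exists>\<tau> < L. \<tau> \<noteq> 0 \<and> bit c (q * L + \<tau>)) \<and>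
     \<not> (\<exists>\<tau> < L. (\<forall>h < r. digit \<tau> h \<noteq> 0) \<and> bit c (q * L + \<tau>)))"

definition full_emb :: "nat set \<Rightarrow> bool" where
  "full_emb A \<longleftrightarrow> (\<exists>f. inj_on f {..<r} \<and> f ` {..<r} \<subseteq> A \<and>
     (\<forall>h < r. \<forall>h' < r. hadj h h' \<longrightarrow> (f h, f h') \<in> E))"

lemma typ_full: 
  assumes "node i"
  shows "(\<exists>\<tau> < L. (\<forall>h < r. digit \<tau> h \<noteq> 0) \<and> has_type i A (digit \<tau>)) \<longleftrightarrow> full_emb A"
proof
  assume "\<exists>\<tau> < L. (\<forall>h < r. digit \<tau> h \<noteq> 0) \<and> has_type i A (digit \<tau>)"
  then obtain \<tau> \<phi> where *: "\<forall>h < r. digit \<tau> h \<noteq> 0" "emb A \<phi>" "\<forall>h < r. digit \<tau> h = dig i (\<phi> h)"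
    unfolding has_type_def by blast
  then have "\<forall>h < r. \<exists>v. \<phi> h = Some v"
    by (auto simp: dig_eq_0)
  then obtain f where "\<forall>h < r. \<phi> h = Some (f h)" by metis
  then show "full_emb A"
    using *(2) unfolding full_emb_def emb_def inj_on_def by (intro exI[of _ f]) auto
next
  assume "full_emb A"
  then obtain f where f: "inj_on f {..<r}" "f ` {..<r} \<subseteq> A"
    "\<forall>h < r. \<forall>h' < r. hadj h h' \<longrightarrow> (f h, f h') \<in> E"
    unfolding full_emb_def by blast
  let ?d = "\<lambda>h. dig i (Some (f h))"
  have t: "has_type i A ?d"
    using f unfolding has_type_def emb_def inj_on_def by (intro exI[of _ "\<lambda>h. Some (f h)"]) auto
  then obtain \<tau> where \<tau>: "\<tau> < L" "\<forall>h < r. digit \<tau> h = ?d h"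
    using typ_encode[OF assms] by blast
  then have "has_type i A (digit \<tau>)" "\<forall>h < r. digit \<tau> h \<noteq> 0"
    using t typ_cong[of "digit \<tau>" ?d] by (auto simp: dig_eq_0)
  with \<tau> show "\<exists>\<tau> < L. (\<forall>h < r. digit \<tau> h \<noteq> 0) \<and> has_type i A (digit \<tau>)" by blast
qed

lemma typ_nonempty:
  assumes "node i"
  shows "(\<exists>\<tau> < L. \<tau> \<noteq> 0 \<and> has_type i A (digit \<tau>)) \<longleftrightarrow> A \<noteq> {}"
proof
  assume "\<exists>\<tau> < L. \<tau> \<noteq> 0 \<and> has_type i A (digit \<tau>)"
  then obtain \<tau> \<phi> where *: "\<tau> < L" "\<tau> \<noteq> 0" "emb A \<phi>" "\<forall>h < r. digit \<tau> h = dig i (\<phi> h)"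
    unfolding has_type_def by blast
  obtain h where "h < r" "\<phi> h \<noteq> None"
  proof (rule ccontr)
    assume "\<not> thesis"
    then have "\<forall>h < r. \<phi> h = None"
      using that by blast
    then have "\<tau> div B ^ h mod B = 0" if "h < r" for h
      using *(4) that unfolding digit_def by (simp add: dig_simps)
    then show False
      using digits_zero[of \<tau> B r] *(1,2) unfolding L_def by blast
  qed
  then show "A \<noteq> {}"
    using *(3) unfolding emb_def by auto
next
  assume "A \<noteq> {}"
  then obtain v where v: "v \<in> A" by blast
  let ?\<phi> = "\<lambda>h. if h = (0::nat) then Some v else None"
  let ?d = "\<lambda>h. dig i (?\<phi> h)"
  have t: "has_type i A ?d"
    using v hadj_irrefl unfolding has_type_def emb_def by (intro exI[of _ ?\<phi>]) auto
  then obtain \<tau> where \<tau>: "\<tau> < L" "\<forall>h < r. digit \<tau> h = ?d h"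
    using typ_encode[OF assms] by blast
  then have "has_type i A (digit \<tau>)"
    using t typ_cong[of "digit \<tau>" ?d] by blast
  moreover have "\<tau> \<noteq> 0"
  proof
    assume "\<tau> = 0"
    moreover have "digit \<tau> 0 = ?d 0" using \<tau>(2) r by auto
    ultimately show False using digit_zero[of 0] dig_eq_0[of i "Some v"] by simp
  qed
  ultimately show "\<exists>\<tau> < L. \<tau> \<noteq> 0 \<and> has_type i A (digit \<tau>)" using \<tau> by blast
qed

theorem accepting_iff:
  assumes n: "node i"
  shows "(\<exists>c. feas i c \<and> accepting c) \<longleftrightarrow>
    (\<exists>A B. A \<union> B = V i \<and> A \<inter> B = {} \<and> A \<noteq> {} \<and> B \<noteq> {} \<and> \<not> full_emb A \<and> \<not> full_emb B)"
proof -
  have acc: "accepting c \<longleftrightarrow> (\<forall>q < 2. {v \<in> V i. col v = q} \<noteq> {} \<and> \<not> full_emb {v \<in> V i. col v = q})"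
    if "realises i c col" for c col
  proof -
    have b: "bit c (q * L + \<tau>) \<longleftrightarrow> has_type i {v \<in> V i. col v = q} (digit \<tau>)" if "q < 2" "\<tau> < L" for q \<tau>
      using \<open>realises i c col\<close> that unfolding realises_def by blast
    show ?thesis
      unfolding accepting_def typ_full[OF n, symmetric] typ_nonempty[OF n, symmetric]
      using b by (auto cong: conj_cong)
  qed
  show ?thesis
  proof
    assume "\<exists>c. feas i c \<and> accepting c"
    then obtain c col where "realises i c col" "accepting c"
      unfolding feas_def by blast
    then have "\<forall>q < 2. {v \<in> V i. col v = q} \<noteq> {} \<and> \<not> full_emb {v \<in> V i. col v = q}" "\<forall>v. col v < 2"
      using acc by (auto simp: realises_def)
    then show "\<exists>A B. A \<union> B = V i \<and> A \<inter> B = {} \<and> A \<noteq> {} \<and> B \<noteq> {} \<and> \<not> full_emb A \<and> \<not> full_emb B"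
      by (intro exI[of _ "{v \<in> V i. col v = 0}"] exI[of _ "{v \<in> V i. col v = 1}"])
        (auto simp: less_2_iff)
  next
    assume "\<exists>A B. A \<union> B = V i \<and> A \<inter> B = {} \<and> A \<noteq> {} \<and> B \<noteq> {} \<and> \<not> full_emb A \<and> \<not> full_emb B"
    then obtain A C where AC: "A \<union> C = V i" "A \<inter> C = {}" "A \<noteq> {}" "C \<noteq> {}" "\<not> full_emb A" "\<not> full_emb C"
      by blast
    define col where "col = (\<lambda>v. if v \<in> A then 0 else (1::nat))"
    have eq: "{v \<in> V i. col v = 0} = A" "{v \<in> V i. col v = 1} = C"
      using AC by (auto simp: col_def)
    have "\<And>v. col v < 2"
      by (simp add: col_def)
    then obtain c where "realises i c col"
      using realises_exists[of col i] by blast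
    moreover have "{v \<in> V i. col v = q} \<noteq> {} \<and> \<not> full_emb {v \<in> V i. col v = q}" if "q < 2" for q
    proof -
      consider "q = 0" | "q = 1" using \<open>q < 2\<close> by (auto simp: less_2_iff)
      then show ?thesis using AC eq by cases metis+
    qed
    ultimately show "\<exists>c. feas i c \<and> accepting c"
      using acc unfolding feas_def by blast
  qed
qed

end

section \<open>Expressions for the dynamic program\<close>

definition holds :: "fx \<Rightarrow> ram_state \<Rightarrow> nat list \<Rightarrow> bool" where
  "holds e s env \<longleftrightarrow> fval e s env \<noteq> 0"

text \<open>Both connectives go through \<open>Ite\<close>, so the loop bounds of the second
  argument matter only where it is evaluated.\<close>

definition AndF :: "fx \<Rightarrow> fx \<Rightarrow> fx" where "AndF a b = Ite a b (Const 0)"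
definition OrF :: "fx \<Rightarrow> fx \<Rightarrow> fx" where "OrF a b = Ite a (Const 1) b"
definition NotF :: "fx \<Rightarrow> fx" where "NotF a = Eql a (Const 0)"
definition IffF :: "fx \<Rightarrow> fx \<Rightarrow> fx" where "IffF a b = Ite a b (NotF b)"
definition AllF :: "fx \<Rightarrow> fx \<Rightarrow> fx" where "AllF b f = NotF (ExB b (NotF f))"

lemma holds_simps [simp]:
  "holds (AndF a b) s env \<longleftrightarrow> holds a s env \<and> holds b s env"
  "holds (OrF a b) s env \<longleftrightarrow> holds a s env \<or> holds b s env"
  "holds (NotF a) s env \<longleftrightarrow> \<not> holds a s env"
  "holds (IffF a b) s env \<longleftrightarrow> (holds a s env \<longleftrightarrow> holds b s env)"
  "holds (AllF e a) s env \<longleftrightarrow> (\<forall>i < fval e s env. holds a s (i # env))"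
  "holds (ExB e a) s env \<longleftrightarrow> (\<exists>i < fval e s env. holds a s (i # env))"
  "holds (Lt a b) s env \<longleftrightarrow> fval a s env < fval b s env"
  "holds (Eql a b) s env \<longleftrightarrow> fval a s env = fval b s env"
  "holds (Ite c a b) s env \<longleftrightarrow> (if holds c s env then holds a s env else holds b s env)"
  "holds (App f es) s env \<longleftrightarrow> holds f s (map (\<lambda>e. fval e s env) es)"
  "holds (Var i) s env \<longleftrightarrow> env ! i \<noteq> 0"
  "holds (Const k) s env \<longleftrightarrow> k \<noteq> 0"
  "holds (Arr x e) s env \<longleftrightarrow> cell s x (fval e s env) \<noteq> 0"
  by (auto simp: holds_def AndF_def OrF_def NotF_def IffF_def AllF_def comp_def)

lemma fval_bool_simps [simp]:
  "fval (NotF a) s env = of_bool (\<not> holds a s env)"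
  "fval (Ite c a b) s env = (if holds c s env then fval a s env else fval b s env)"
  "fval (App f es) s env = fval f s (map (\<lambda>e. fval e s env) es)"
  by (auto simp: holds_def NotF_def comp_def)

declare fval.simps(9,12) [simp del]

lemma ok_simps [simp]:
  "ok (AndF a b) s env Q \<longleftrightarrow> ok a s env Q \<and> (holds a s env \<longrightarrow> ok b s env Q)"
  "ok (OrF a b) s env Q \<longleftrightarrow> ok a s env Q \<and> (\<not> holds a s env \<longrightarrow> ok b s env Q)"
  "ok (NotF a) s env Q \<longleftrightarrow> ok a s env Q"
  "ok (IffF a b) s env Q \<longleftrightarrow> ok a s env Q \<and> ok b s env Q"
  "ok (AllF e a) s env Q \<longleftrightarrow> ok e s env Q \<and> fval e s env \<le> Q \<and> (\<forall>i < fval e s env. ok a s (i # env) Q)"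
  "ok (Ite c a b) s env Q \<longleftrightarrow> ok c s env Q \<and> (if holds c s env then ok a s env Q else ok b s env Q)"
  "ok (App f es) s env Q \<longleftrightarrow> (\<forall>e \<in> set es. ok e s env Q) \<and> ok f s (map (\<lambda>e. fval e s env) es) Q"
  by (auto simp: AndF_def OrF_def NotF_def IffF_def AllF_def holds_def list_all_iff comp_def)

declare ok.simps(9,12) [simp del]

lemma not_slot [simp]: "c \<noteq> CHR ''#'' \<Longrightarrow> c # cs \<notin> range slot"
  by (auto simp: slot_def)

section \<open>Arithmetic by bounded iteration\<close>

definition mult_fx :: fx where
  "mult_fx = Iter (Var 0) (Const 0) (Add (Var 1) (Var 3))"

lemma fval_mult [simp]: "fval mult_fx s [a, b] = a * b"
proof -
  have "iterate (\<lambda>i acc. acc + b) 0 n = n * b" for n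
    by (induction n) auto
  then show ?thesis by (simp add: mult_fx_def)
qed

text \<open>Only the first factor has to be bounded by \<open>Q\<close>. Table addresses
  \<open>c * m + i\<close> rely on this, since \<open>m\<close> may be arbitrarily large compared
  with \<open>Q\<close>.\<close>

lemma ok_mult [simp]: "ok mult_fx s [a, b] Q \<longleftrightarrow> a \<le> Q"
  by (simp add: mult_fx_def)

definition pow_fx :: fx where
  "pow_fx = Iter (Var 1) (Const 1) (App mult_fx [Var 1, Var 2])"

lemma iterate_pow: "iterate (\<lambda>i acc. acc * b) (Suc 0) n = b ^ n"
  by (induction n) auto

lemma fval_pow [simp]: "fval pow_fx s [b, k] = b ^ k"
  by (simp add: pow_fx_def iterate_pow)

text \<open>The accumulator is the first factor of each product, so only the powers before the last
  one are compared with \<open>Q\<close>.\<close>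

lemma ok_pow [simp]: "ok pow_fx s [b, k] Q \<longleftrightarrow> k \<le> Q \<and> (\<forall>i < k. b ^ i \<le> Q)"
  by (simp add: pow_fx_def iterate_pow)

text \<open>The accumulator counts upwards until it reaches the quotient.\<close>

definition div_fx :: fx where
  "div_fx = Iter (Var 0) (Const 0)
    (Ite (Lt (Var 2) (App mult_fx [Add (Var 1) (Const 1), Var 3])) (Var 1) (Add (Var 1) (Const 1)))"

lemma iterate_div:
  "0 < b \<Longrightarrow> iterate (\<lambda>i acc. if a < b + acc * b then acc else Suc acc) 0 n = min n (a div b)"
proof (induction n)
  case (Suc n)
  have *: "a < b + min n (a div b) * b \<longleftrightarrow> a div b < Suc (min n (a div b))"
    using Suc.prems by (metis div_less_iff_less_mult mult_Suc)
  then show ?case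
    using Suc by auto
qed simp

lemma fval_div [simp]: "0 < b \<Longrightarrow> fval div_fx s [a, b] = a div b"
  using div_le_dividend[of a b] by (simp add: div_fx_def iterate_div cong: if_cong)

lemma ok_div [simp]: "0 < b \<Longrightarrow> ok div_fx s [a, b] Q \<longleftrightarrow> a \<le> Q"
  by (auto simp: div_fx_def iterate_div cong: if_cong)

definition mod_fx :: fx where
  "mod_fx = Sub (Var 0) (App mult_fx [App div_fx [Var 0, Var 1], Var 1])"

lemma fval_mod [simp]: "0 < b \<Longrightarrow> fval mod_fx s [a, b] = a mod b"
  by (simp add: mod_fx_def minus_div_mult_eq_mod)

lemma ok_mod [simp]: "0 < b \<Longrightarrow> ok mod_fx s [a, b] Q \<longleftrightarrow> a \<le> Q"
  by (auto simp: mod_fx_def intro: le_trans[OF div_le_dividend])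

definition bit_fx :: fx where
  "bit_fx = App mod_fx [App div_fx [Var 0, App pow_fx [Const 2, Var 1]], Const 2]"

lemma holds_bit [simp]: "holds bit_fx s [c, y] \<longleftrightarrow> bit c y"
  by (simp add: bit_fx_def holds_def bit_iff_odd odd_iff_mod_2_eq_one)

lemma ok_bit [simp]: "ok bit_fx s [c, y] Q \<longleftrightarrow> y \<le> Q \<and> (\<forall>i < y. 2 ^ i \<le> Q) \<and> c \<le> Q"
  by (auto simp: bit_fx_def intro: le_trans[OF div_le_dividend])

section \<open>Formulas for transition and acceptance\<close>

definition digit_fx :: fx where
  "digit_fx = App mod_fx [App div_fx [Var 0, App pow_fx [Glob ''B'', Var 1]], Glob ''B'']"

definition bl_fx :: fx where
  "bl_fx = Arr ''bag'' (Add (Arr ''bag_off'' (Var 0)) (Var 1))"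

text \<open>Offsets are given only up to index \<open>m\<close>. The guard gives the dummy child
  \<open>m\<close> an empty bag.\<close>

definition bs_fx :: fx where
  "bs_fx = Ite (Lt (Var 0) (Glob ''m''))
    (Sub (Arr ''bag_off'' (Add (Var 0) (Const 1))) (Arr ''bag_off'' (Var 0))) (Const 0)"

definition vx_fx :: fx where
  "vx_fx = App bl_fx [Var 0, Sub (Var 1) (Const 2)]"

definition inbag_fx :: fx where
  "inbag_fx = ExB (App bs_fx [Var 0]) (Eql (App bl_fx [Var 1, Var 0]) (Var 2))"

text \<open>Digits may name positions past the end of the bag, so that \<open>vx\<close> yields
  arbitrary numbers. The comparison with n keeps them from being read as entries of another
  row.\<close>

definition edge_fx :: fx where
  "edge_fx = AndF (Lt (Var 0) (Glob ''n'')) (AndF (Lt (Var 1) (Glob ''n''))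
    (Arr ''mat'' (Add (Arr ''row'' (Var 0)) (Var 1))))"

definition okd_fx :: fx where
  "okd_fx = Ite (Eql (Var 3) (Const 0))
      (OrF (Lt (Var 2) (Const 2)) (NotF (App inbag_fx [Var 1, App vx_fx [Var 0, Var 2]])))
    (Ite (Eql (Var 3) (Const 1)) (Eql (Var 2) (Const 1))
    (Ite (App inbag_fx [Var 0, App vx_fx [Var 1, Var 3]])
      (AndF (NotF (Lt (Var 2) (Const 2))) (Eql (App vx_fx [Var 0, Var 2]) (App vx_fx [Var 1, Var 3])))
      (Eql (Var 2) (Const 1))))"

text \<open>H is fixed, so its arcs are built into the program as constants.\<close>

definition hadj_fx :: "(nat \<times> nat) list \<Rightarrow> fx" where
  "hadj_fx es = foldr (\<lambda>(a, b). OrF (AndF (Eql (Var 0) (Const a)) (Eql (Var 1) (Const b)))) es (Const 0)"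

lemma holds_hadj [simp]: "holds (hadj_fx es) s [h, h'] \<longleftrightarrow> (h, h') \<in> set es"
  by (induction es) (auto simp: hadj_fx_def)

lemma ok_hadj [simp]: "ok (hadj_fx es) s [h, h'] Q"
  by (induction es) (auto simp: hadj_fx_def)

definition rel1_fx :: fx where
  "rel1_fx = AndF (App okd_fx [Var 0, Var 1, Var 3, Var 4]) (AndF (App okd_fx [Var 0, Var 2, Var 3, Var 5])
    (OrF (NotF (Eql (Var 3) (Const 1))) (NotF (IffF (Var 4) (Var 5)))))"

text \<open>The arguments are the node, two vertices of H, the digits of the first at the node and
  its two children, then those of the second.\<close>

definition rel2_fx :: "(nat \<times> nat) list \<Rightarrow> fx" where
  "rel2_fx es = AndF
    (OrF (Lt (Var 3) (Const 2)) (OrF (NotF (Eql (Var 3) (Var 6))) (Eql (Var 1) (Var 2))))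
    (OrF (NotF (App (hadj_fx es) [Var 1, Var 2])) (AndF
      (OrF (Lt (Var 3) (Const 2)) (OrF (Lt (Var 6) (Const 2))
        (App edge_fx [App vx_fx [Var 0, Var 3], App vx_fx [Var 0, Var 6]])))
      (OrF (NotF (Eql (Var 3) (Const 1))) (OrF (Eql (Var 6) (Const 0))
        (OrF (AndF (Var 4) (Var 7)) (AndF (Var 5) (Var 8)))))))"

definition dg :: "nat \<Rightarrow> nat \<Rightarrow> fx" where
  "dg \<tau> h = App digit_fx [Var \<tau>, Var h]"

definition rel_fx :: "nat \<Rightarrow> (nat \<times> nat) list \<Rightarrow> fx" where
  "rel_fx r es = AllF (Const r) (AndF
    (App rel1_fx [Var 1, Var 2, Var 3, dg 4 0, dg 5 0, dg 6 0])
    (AllF (Const r) (App (rel2_fx es)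
      [Var 2, Var 1, Var 0, dg 5 1, dg 6 1, dg 7 1, dg 5 0, dg 6 0, dg 7 0])))"

definition bit_pos :: "nat \<Rightarrow> fx \<Rightarrow> fx \<Rightarrow> fx" where
  "bit_pos q e c = App bit_fx [c, Add (App mult_fx [Var q, Glob ''L'']) e]"

definition same_fx :: fx where
  "same_fx = AllF (App bs_fx [Var 0]) (AllF (App bs_fx [Var 3])
    (OrF (NotF (Eql (App bl_fx [Var 2, Var 1]) (App bl_fx [Var 4, Var 0])))
      (IffF (App bit_fx [Var 3, Add (Var 1) (Const 2)]) (App bit_fx [Var 5, Add (Var 0) (Const 2)]))))"

definition valid_fx :: "nat \<Rightarrow> fx" where
  "valid_fx r = AllF (Const r) (OrF (Lt (dg 4 0) (Const 2))
    (AndF (Lt (Sub (dg 4 0) (Const 2)) (App bs_fx [Var 1])) (bit_pos 3 (dg 4 0) (Var 2))))"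

definition ex_fx :: "nat \<Rightarrow> (nat \<times> nat) list \<Rightarrow> fx" where
  "ex_fx r es = ExB (Glob ''L'') (ExB (Glob ''L'')
    (AndF (bit_pos 5 (Var 1) (Var 7)) (AndF (bit_pos 5 (Var 0) (Var 8))
      (App (rel_fx r es) [Var 2, Var 3, Var 4, Var 6, Var 1, Var 0]))))"

definition local_fx :: "nat \<Rightarrow> (nat \<times> nat) list \<Rightarrow> fx" where
  "local_fx r es = AndF
    (AllF (App bs_fx [Var 0]) (NotF (IffF (App bit_fx [Var 2, Add (Var 0) (Const 2)])
      (App bit_fx [Var 2, Add (Glob ''L'') (Add (Var 0) (Const 2))]))))
    (AndF (App same_fx [Var 0, Var 1, Var 2, Var 3])
    (AndF (App same_fx [Var 0, Var 1, Var 4, Var 5])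
    (AllF (Const 2) (AllF (Glob ''L'') (IffF (bit_pos 1 (Var 0) (Var 3))
      (AndF (App (valid_fx r) [Var 2, Var 3, Var 1, Var 0])
        (App (ex_fx r es) [Var 2, Var 4, Var 6, Var 1, Var 0, Var 5, Var 7])))))))"

text \<open>
  A node with fewer than two children is padded with the dummy child \<open>m\<close>. Its bag is empty, and its
  only feasible state, in which just the empty embedding is realised, is \<open>1 + 2 ^ L\<close>.
\<close>

definition tab_fx :: fx where
  "tab_fx = Ite (Lt (Var 0) (Glob ''m''))
    (Arr ''tab'' (Add (App mult_fx [Var 1, Glob ''m'']) (Var 0)))
    (Eql (Var 1) (Add (Const 1) (App pow_fx [Const 2, Glob ''L''])))"

definition kid_fx :: "nat \<Rightarrow> fx" where
  "kid_fx k = Ite (Lt (Const k) (Sub (Arr ''child_off'' (Add (Var 0) (Const 1))) (Arr ''child_off'' (Var 0))))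
    (Arr ''child'' (Add (Arr ''child_off'' (Var 0)) (Const k))) (Glob ''m'')"

definition step_fx :: "nat \<Rightarrow> (nat \<times> nat) list \<Rightarrow> fx" where
  "step_fx r es = ExB (Glob ''N'') (ExB (Glob ''N'')
    (AndF (App tab_fx [App (kid_fx 0) [Var 2], Var 1])
    (AndF (App tab_fx [App (kid_fx 1) [Var 2], Var 0])
      (App (local_fx r es) [Var 2, Var 3, App (kid_fx 0) [Var 2], Var 1, App (kid_fx 1) [Var 2], Var 0]))))"

definition accept_fx :: "nat \<Rightarrow> fx" where
  "accept_fx r = AllF (Const 2) (AndF
    (ExB (Glob ''L'') (AndF (Var 0) (bit_pos 1 (Var 0) (Var 2))))
    (NotF (ExB (Glob ''L'') (AndF (AllF (Const r) (dg 1 0)) (bit_pos 1 (Var 0) (Var 2))))))"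

definition final_fx :: "nat \<Rightarrow> fx" where
  "final_fx r = ExB (Glob ''N'') (AndF (App tab_fx [Glob ''root'', Var 0]) (App (accept_fx r) [Var 0]))"

definition tab_at :: "ram_state \<Rightarrow> nat \<Rightarrow> nat \<Rightarrow> bool" where
  "tab_at s j c \<longleftrightarrow> (if j < reg s ''m'' then cell s ''tab'' (c * reg s ''m'' + j) \<noteq> 0
    else c = 1 + 2 ^ reg s ''L'')"

definition kid :: "ram_state \<Rightarrow> nat \<Rightarrow> nat \<Rightarrow> nat" where
  "kid s k i = (if k < cell s ''child_off'' (i + 1) - cell s ''child_off'' i
    then cell s ''child'' (cell s ''child_off'' i + k) else reg s ''m'')"

lemma fval_kid [simp]: "fval (kid_fx k) s [i] = kid s k i"
  by (simp add: kid_fx_def kid_def)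

lemma ok_kid [simp]: "ok (kid_fx k) s [i] Q"
  by (simp add: kid_fx_def)

text \<open>Ties the abstract states to one machine state. Each expression then gets two rules, its
  meaning and its loop bound; \<open>2 ^ (2 * L)\<close> dominates all bounds that occur.\<close>

locale dp_state = states +
  fixes s :: ram_state and es :: "(nat \<times> nat) list" and Q :: nat
  assumes reg_B: "reg s ''B'' = B" and B2: "2 \<le> B"
    and reg_L: "reg s ''L'' = L" and reg_N: "reg s ''N'' = 2 ^ (2 * L)" and Q: "2 ^ (2 * L) \<le> Q"
    and hadj_es: "hadj h h' \<longleftrightarrow> (h, h') \<in> set es"
    and E_mat: "(u, v) \<in> E \<longleftrightarrow>
      u < reg s ''n'' \<and> v < reg s ''n'' \<and> cell s ''mat'' (cell s ''row'' u + v) \<noteq> 0"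
    and bl_bag: "bl j p = cell s ''bag'' (cell s ''bag_off'' j + p)"
    and bs_bag: "bs j = (if j < reg s ''m'' then cell s ''bag_off'' (j + 1) - cell s ''bag_off'' j else 0)"
    and bs_B: "bs j + 2 \<le> B"
begin

lemma pow2_le_Q: "y < 2 * L \<Longrightarrow> (2::nat) ^ y \<le> Q"
  using Q by (meson le_trans less_imp_le one_le_numeral power_increasing)

lemma two_L_le_Q: "2 * L \<le> Q"
  using Q less_exp[of "2 * L"] by linarith

lemma r_le_L: "r \<le> L"
proof -
  have "r \<le> 2 ^ r" using less_exp[of r] by simp
  also have "\<dots> \<le> L" unfolding L_def using B2 by (rule power_mono) simp
  finally show ?thesis .
qed

lemma r_le_Q: "r \<le> Q"
  using r_le_L two_L_le_Q by linarith

lemma B_pow_le_Q: "h < r \<Longrightarrow> i < h \<Longrightarrow> B ^ i \<le> Q"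
proof -
  assume "h < r" "i < h"
  then have "B ^ i \<le> L"
    unfolding L_def using B2 by (intro power_increasing) auto
  then show ?thesis using two_L_le_Q by linarith
qed

lemma digit_less: "digit \<tau> h < B"
  unfolding digit_def using B2 by simp

lemma fval_digit [simp]: "fval digit_fx s [\<tau>, h] = digit \<tau> h"
  using B2 by (simp add: digit_fx_def reg_B digit_def)

lemma ok_digit [simp]: "h < r \<Longrightarrow> \<tau> < L \<Longrightarrow> ok digit_fx s [\<tau>, h] Q"
  using B2 B_pow_le_Q r_le_Q two_L_le_Q
  by (auto simp: digit_fx_def reg_B intro: le_trans[OF div_le_dividend])

lemma fval_bl [simp]: "fval bl_fx s [j, p] = bl j p"
  by (simp add: bl_fx_def bl_bag)

lemma ok_bl [simp]: "ok bl_fx s [j, p] Q"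
  by (simp add: bl_fx_def)

lemma fval_bs [simp]: "fval bs_fx s [j] = bs j"
  by (simp add: bs_fx_def bs_bag)

lemma ok_bs [simp]: "ok bs_fx s [j] Q"
  by (simp add: bs_fx_def)

lemma fval_vx [simp]: "fval vx_fx s [j, d] = vx j d"
  by (simp add: vx_fx_def vx_def)

lemma ok_vx [simp]: "ok vx_fx s [j, d] Q"
  by (simp add: vx_fx_def)

lemma bs_le_Q: "bs j \<le> Q"
  using bs_B[of j] B_le_L two_L_le_Q by linarith

lemma holds_inbag [simp]: "holds inbag_fx s [j, v] \<longleftrightarrow> v \<in> bag j"
  by (auto simp: inbag_fx_def bag_def)

lemma ok_inbag [simp]: "ok inbag_fx s [j, v] Q"
  by (simp add: inbag_fx_def bs_le_Q)

lemma holds_edge [simp]: "holds edge_fx s [u, v] \<longleftrightarrow> (u, v) \<in> E"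
  by (simp add: edge_fx_def E_mat)

lemma ok_edge [simp]: "ok edge_fx s [u, v] Q"
  by (simp add: edge_fx_def)

lemma holds_okd [simp]: "holds okd_fx s [i, j, d, dj] \<longleftrightarrow> okd i j d dj"
  by (auto simp: okd_fx_def okd_def)

lemma ok_okd [simp]: "ok okd_fx s [i, j, d, dj] Q"
  by (simp add: okd_fx_def)

lemma holds_rel1 [simp]:
  "holds rel1_fx s [i, j1, j2, d, d1, d2] \<longleftrightarrow>
    okd i j1 d d1 \<and> okd i j2 d d2 \<and> (d = 1 \<longrightarrow> (d1 \<noteq> 0) \<noteq> (d2 \<noteq> 0))"
  by (auto simp: rel1_fx_def)

lemma ok_rel1 [simp]: "ok rel1_fx s [i, j1, j2, d, d1, d2] Q"
  by (simp add: rel1_fx_def)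

lemma holds_rel2 [simp]:
  "holds (rel2_fx es) s [i, h, h', d, d1, d2, d', d1', d2'] \<longleftrightarrow>
    (2 \<le> d \<and> d = d' \<longrightarrow> h = h') \<and>
    (hadj h h' \<longrightarrow> (2 \<le> d \<and> 2 \<le> d' \<longrightarrow> (vx i d, vx i d') \<in> E) \<and>
      (d = 1 \<and> d' \<noteq> 0 \<longrightarrow> d1 \<noteq> 0 \<and> d1' \<noteq> 0 \<or> d2 \<noteq> 0 \<and> d2' \<noteq> 0))"
  by (auto simp: rel2_fx_def hadj_es not_less)

lemma ok_rel2 [simp]: "ok (rel2_fx es) s [i, h, h', d, d1, d2, d', d1', d2'] Q"
  by (simp add: rel2_fx_def)

lemma holds_rel [simp]:
  "holds (rel_fx r es) s [i, j1, j2, \<tau>, \<tau>1, \<tau>2] \<longleftrightarrow> rel i j1 j2 (digit \<tau>) (digit \<tau>1) (digit \<tau>2)"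
  unfolding rel_fx_def rel_def dg_def by simp

lemma ok_rel [simp]:
  "\<tau> < L \<Longrightarrow> \<tau>1 < L \<Longrightarrow> \<tau>2 < L \<Longrightarrow> ok (rel_fx r es) s [i, j1, j2, \<tau>, \<tau>1, \<tau>2] Q"
  by (simp add: rel_fx_def dg_def r_le_Q)

lemma ok_bit_less: "y < 2 * L \<Longrightarrow> c \<le> Q \<Longrightarrow> ok bit_fx s [c, y] Q"
  using two_L_le_Q pow2_le_Q by auto

lemma block_less: "q < 2 \<Longrightarrow> x < L \<Longrightarrow> q * L + x < 2 * L"
  by (auto simp: less_2_iff)

lemma two_le_Q: "2 \<le> Q"
  using two_L_le_Q B_le_L B2 by linarith

lemma holds_same [simp]: "holds same_fx s [i, c, j, cj] \<longleftrightarrow> same_colours i c j cj"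
  by (auto simp: same_fx_def same_colours_def)

lemma pos_less: "p < bs j \<Longrightarrow> p + 2 < L"
  using bs_B[of j] B_le_L by linarith

lemma ok_same [simp]: "c \<le> Q \<Longrightarrow> cj \<le> Q \<Longrightarrow> ok same_fx s [i, c, j, cj] Q"
  using pos_less by (fastforce simp: same_fx_def bs_le_Q simp del: ok_bit intro!: ok_bit_less)

lemma holds_valid [simp]:
  "holds (valid_fx r) s [i, c, q, \<tau>] \<longleftrightarrow>
    (\<forall>h < r. 2 \<le> digit \<tau> h \<longrightarrow> digit \<tau> h - 2 < bs i \<and> bit c (q * L + digit \<tau> h))"
  by (auto simp: valid_fx_def dg_def bit_pos_def reg_L not_less)

lemma ok_valid [simp]: "c \<le> Q \<Longrightarrow> q < 2 \<Longrightarrow> \<tau> < L \<Longrightarrow> ok (valid_fx r) s [i, c, q, \<tau>] Q"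
  using two_le_Q less_le_trans[OF digit_less B_le_L]
  by (auto simp: valid_fx_def dg_def bit_pos_def reg_L r_le_Q simp del: ok_bit intro!: ok_bit_less block_less)

lemma holds_ex [simp]:
  "holds (ex_fx r es) s [i, j1, j2, q, \<tau>, c1, c2] \<longleftrightarrow>
    (\<exists>\<tau>1 < L. \<exists>\<tau>2 < L. bit c1 (q * L + \<tau>1) \<and> bit c2 (q * L + \<tau>2) \<and>
         rel i j1 j2 (digit \<tau>) (digit \<tau>1) (digit \<tau>2))"
  by (simp add: ex_fx_def bit_pos_def reg_L)

lemma ok_ex [simp]:
  "q < 2 \<Longrightarrow> \<tau> < L \<Longrightarrow> c1 \<le> Q \<Longrightarrow> c2 \<le> Q \<Longrightarrow> ok (ex_fx r es) s [i, j1, j2, q, \<tau>, c1, c2] Q"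
  using two_L_le_Q two_le_Q
  by (auto simp: ex_fx_def bit_pos_def reg_L simp del: ok_bit intro!: ok_bit_less block_less)

lemma holds_local [simp]:
  "holds (local_fx r es) s [i, c, j1, c1, j2, c2] \<longleftrightarrow> local_ok i c j1 c1 j2 c2"
  by (simp add: local_fx_def local_ok_def joins_def bit_pos_def reg_L)

lemma ok_local [simp]:
  "c \<le> Q \<Longrightarrow> c1 \<le> Q \<Longrightarrow> c2 \<le> Q \<Longrightarrow> ok (local_fx r es) s [i, c, j1, c1, j2, c2] Q"
  using two_L_le_Q two_le_Q pos_less[of _ i]
  by (auto simp: local_fx_def bit_pos_def reg_L bs_le_Q simp del: ok_bit
      intro!: ok_bit_less block_less) fastforce+

lemma holds_tab [simp]: "holds tab_fx s [j, c] \<longleftrightarrow> tab_at s j c"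
  by (simp add: tab_fx_def tab_at_def)

lemma ok_tab [simp]: "c \<le> Q \<Longrightarrow> ok tab_fx s [j, c] Q"
  using two_L_le_Q pow2_le_Q by (simp add: tab_fx_def reg_L)

lemma holds_step:
  "holds (step_fx r es) s [i, c] \<longleftrightarrow>
    (\<exists>c1 < 2 ^ (2 * L). \<exists>c2 < 2 ^ (2 * L). tab_at s (kid s 0 i) c1 \<and> tab_at s (kid s 1 i) c2 \<and>
      local_ok i c (kid s 0 i) c1 (kid s 1 i) c2)"
  by (simp add: step_fx_def reg_N)

lemma ok_step: "c \<le> Q \<Longrightarrow> ok (step_fx r es) s [i, c] Q"
  using Q by (simp add: step_fx_def reg_N)

lemma holds_accept [simp]: "holds (accept_fx r) s [c] \<longleftrightarrow> accepting c"
  by (simp add: accept_fx_def accepting_def bit_pos_def dg_def holds_def[of digit_fx] reg_L)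

lemma ok_accept [simp]: "c \<le> Q \<Longrightarrow> ok (accept_fx r) s [c] Q"
  using two_L_le_Q two_le_Q r_le_Q
  by (auto simp: accept_fx_def bit_pos_def dg_def reg_L simp del: ok_bit intro!: ok_bit_less block_less)

lemma fval_final:
  "fval (final_fx r) s [] = of_bool (\<exists>c < 2 ^ (2 * L). tab_at s (reg s ''root'') c \<and> accepting c)"
proof -
  have "fval (final_fx r) s [] = of_bool (holds (final_fx r) s [])"
    unfolding holds_def final_fx_def by simp
  then show ?thesis by (simp add: final_fx_def reg_N)
qed

lemma ok_final: "ok (final_fx r) s [] Q"
  using Q by (simp add: final_fx_def reg_N)

end

section \<open>The program\<close>

definition mat_inner :: com where
  "mat_inner = Seq (Store ''mat'' (Plus (Reg ''base'') (Cell ''adj'' (Reg ''j''))) (Num 1)) (incr ''j'')"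

definition mat_body :: com where
  "mat_body = Seq (Store ''row'' (Reg ''u'') (Reg ''base''))
    (Seq (Assign ''j'' (Cell ''adj_off'' (Reg ''u'')))
    (Seq (While (Less (Reg ''j'') (Cell ''adj_off'' (Plus (Reg ''u'') (Num 1)))) mat_inner)
    (Seq (Assign ''base'' (Plus (Reg ''base'') (Reg ''n''))) (incr ''u''))))"

text \<open>
  The adjacency matrix is spread sparsely over the unbounded array \<open>mat\<close>, whose cells are initially 0:
  only the entries of arcs are written, so that the phase takes time linear in the size of the graph.
\<close>

definition mat_phase :: com where
  "mat_phase = While (Less (Reg ''u'') (Reg ''n'')) mat_body"

definition bfs_inner :: com where
  "bfs_inner = Seq (Store ''q'' (Reg ''tail'') (Cell ''child'' (Reg ''j''))) (Seq (incr ''tail'') (incr ''j''))"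

definition bfs_body :: com where
  "bfs_body = Seq (Assign ''i'' (Cell ''q'' (Reg ''h'')))
    (Seq (Assign ''j'' (Cell ''child_off'' (Reg ''i'')))
    (Seq (While (Less (Reg ''j'') (Cell ''child_off'' (Plus (Reg ''i'') (Num 1)))) bfs_inner) (incr ''h'')))"

definition bfs_phase :: com where
  "bfs_phase = Seq (Store ''q'' (Num 0) (Reg ''root'')) (Seq (Assign ''tail'' (Num 1))
    (While (Less (Reg ''h'') (Reg ''m'')) bfs_body))"

text \<open>Row \<open>u\<close> starts at \<open>u * n\<close>, and \<open>v < n\<close> keeps the
  rows apart. The inner loops together make one round per arc, which gives \<open>card R\<close> in
  the bound.\<close>

lemma mat_phase_correct:
  assumes n: "reg s ''n'' = n" and zero: "reg s ''u'' = 0" "reg s ''base'' = 0" "cell s ''mat'' = (\<lambda>_. 0)"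
    and st: "stores_sets s ''adj_off'' ''adj'' n (\<lambda>u. {v. (u, v) \<in> R})"
    and R: "R \<subseteq> {..<n} \<times> {..<n}"
  shows "tri mat_phase s (40 * (n + card R) + 10)
    (\<lambda>s'. \<forall>u < n. \<forall>v < n. cell s' ''mat'' (cell s' ''row'' u + v) \<noteq> 0 \<longleftrightarrow> (u, v) \<in> R)"
proof -
  let ?off = "cell s ''adj_off''" and ?adj = "cell s ''adj''"
  have off: "?off (Suc u) = ?off u + card {v. (u, v) \<in> R}"
    and adj: "?adj ` {?off u..<?off (Suc u)} = {v. (u, v) \<in> R}" if "u < n" for u
    using st that unfolding stores_sets_def Suc_eq_plus1 bij_betw_def by blast+
  define base where "base = (\<lambda>s' :: ram_state. (\<forall>a. a \<notin> {''row'', ''mat''} \<longrightarrow> cell s' a = cell s a) \<and> reg s' ''n'' = n)"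
  define I where "I = (\<lambda>u s'. base s' \<and> reg s' ''u'' = u \<and> reg s' ''base'' = u * n \<and>
    (\<forall>u' < u. cell s' ''row'' u' = u' * n) \<and>
    (\<forall>x. cell s' ''mat'' x \<noteq> 0 \<longleftrightarrow> (\<exists>u' < u. \<exists>v. (u', v) \<in> R \<and> x = u' * n + v)))"
  define J where "J = (\<lambda>u j s'. base s' \<and> reg s' ''u'' = u \<and> reg s' ''base'' = u * n \<and> reg s' ''j'' = j \<and>
    (\<forall>u' < Suc u. cell s' ''row'' u' = u' * n) \<and>
    (\<forall>x. cell s' ''mat'' x \<noteq> 0 \<longleftrightarrow> (\<exists>u' < u. \<exists>v. (u', v) \<in> R \<and> x = u' * n + v) \<or>
      (\<exists>j' \<in> {?off u..<j}. x = u * n + ?adj j')))"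
  let ?guard = "Cell ''adj_off'' (Plus (Reg ''u'') (Num 1))"
  have inner: "tri mat_inner s' 10 (J u (Suc j))" if "?off u \<le> j" "J u j s'" for u j s'
    unfolding mat_inner_def using that
    by (intro tri_mono[OF tri_Store_Seq[OF tri_Assign[where k = 4]]])
      (auto simp: J_def base_def atLeastLessThanSuc)
  have outer: "tri mat_body s' (20 * card {v. (u, v) \<in> R} + 30) (I (Suc u))" if u: "u < n" and I: "I u s'" for u s'
  proof -
    let ?c = "(\<Sum>j=?off u..<?off (Suc u). 10 + acost ?guard + 3) + acost ?guard + 3"
    have loop: "tri (While (Less (Reg ''j'') ?guard) mat_inner) s'' ?c (J u (?off (Suc u)))"
      if "J u (?off u) s''" for s''
      using inner
      by (rule tri_while_from[where I = "J u"]) (use that off[OF u] in \<open>auto simp: J_def base_def\<close>)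
    have c: "?c \<le> 17 * card {v. (u, v) \<in> R} + 7"
      using off[OF u] by simp
    have fin: "I (Suc u) (s''\<lparr>reg := (reg s'')(''base'' := reg s'' ''base'' + reg s'' ''n'',
        ''u'' := reg s'' ''u'' + 1)\<rparr>)" if "J u (?off (Suc u)) s''" for s''
    proof -
      have "(\<exists>j' \<in> {?off u..<?off (Suc u)}. x = u * n + ?adj j') \<longleftrightarrow> (\<exists>v. (u, v) \<in> R \<and> x = u * n + v)" for x
        unfolding adj[OF u, symmetric, THEN eqset_imp_iff, unfolded mem_Collect_eq] by blast
      then show ?thesis
        using that unfolding J_def I_def base_def by (auto simp: less_Suc_eq)
    qed
    have "tri mat_body s' (3 + (3 + (?c + (4 + 4)))) (I (Suc u))"
      unfolding mat_body_def
    proof (intro tri_mono[OF tri_Store_Seq[OF tri_Assign_Seq[OF tri_Seq[OF tri_mono[OF loop]]]]])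
      show "tri (Seq (Assign ''base'' (Plus (Reg ''base'') (Reg ''n''))) (incr ''u'')) s'' (4 + 4) (I (Suc u))"
        if "J u (?off (Suc u)) s''" for s''
        using fin[OF that] by (intro tri_mono[OF tri_Assign_Seq[OF tri_Assign[where k = 4]]]) auto
    qed (use I in \<open>auto simp: I_def J_def base_def\<close>)
    then show ?thesis
      using c by (elim tri_mono) auto
  qed
  have "tri mat_phase s ((\<Sum>u=0..<n. (20 * card {v. (u, v) \<in> R} + 30) + acost (Reg ''n'') + 3) + acost (Reg ''n'') + 3) (I n)"
    unfolding mat_phase_def
    by (rule tri_while_from[where I = I and \<kappa> = "\<lambda>u. 20 * card {v. (u, v) \<in> R} + 30"])
      (use outer n zero in \<open>auto simp: I_def base_def\<close>)
  moreover have "(\<Sum>u=0..<n. card {v. (u, v) \<in> R}) = card R"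
  proof -
    have "finite {v. (u, v) \<in> R}" for u
      using R by (auto intro: finite_subset[of _ "{..<n}"])
    then have "(\<Sum>u=0..<n. card {v. (u, v) \<in> R}) = card (SIGMA u:{0..<n}. {v. (u, v) \<in> R})"
      by simp
    also have "(SIGMA u:{0..<n}. {v. (u, v) \<in> R}) = R"
      using R by auto
    finally show ?thesis .
  qed
  then have "(\<Sum>u=0..<n. (20 * card {v. (u, v) \<in> R} + 30) + acost (Reg ''n'') + 3) + acost (Reg ''n'') + 3
      \<le> 40 * (n + card R) + 10"
    by (simp add: sum.distrib sum_distrib_left[symmetric])
  moreover have "cell s' ''mat'' (cell s' ''row'' u + v) \<noteq> 0 \<longleftrightarrow> (u, v) \<in> R"
    if I: "I n s'" and u: "u < n" and v: "v < n" for s' u v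
  proof -
    have "u' = u \<and> v' = v" if "u * n + v = u' * n + v'" "(u', v') \<in> R" for u' v'
    proof -
      have "v' < n" using R that by auto
      have "(u * n + v) div n = u" "(u' * n + v') div n = u'"
        using v \<open>v' < n\<close> by auto
      then show ?thesis using that(1) by auto
    qed
    then show ?thesis
      using I u unfolding I_def by (metis)
  qed
  ultimately show ?thesis
    by (elim tri_mono) auto
qed

text \<open>The dynamic program reads this order backwards, so that children are treated before
  their parent.\<close>

definition bfs_order :: "(nat \<Rightarrow> nat) \<Rightarrow> nat \<Rightarrow> (nat \<Rightarrow> nat set) \<Rightarrow> bool" where
  "bfs_order q m ch \<longleftrightarrow> bij_betw q {..<m} {..<m} \<and>
     (\<forall>g < m. \<forall>c \<in> ch (q g). \<exists>g'. g < g' \<and> g' < m \<and> q g' = c)"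

text \<open>The premises on \<open>ch\<close> say that it is the child relation of a tree rooted at
  \<open>rt\<close>. Unique parents keep nodes from entering the queue twice, and reachability keeps
  it from running dry, so a loop of exactly \<open>m\<close> rounds suffices.\<close>

lemma bfs_phase_correct:
  assumes m: "reg s ''m'' = m" and zero: "reg s ''h'' = 0" and root: "reg s ''root'' = rt" "rt < m"
    and st: "stores_sets s ''child_off'' ''child'' m ch"
    and ch: "\<And>i. i < m \<Longrightarrow> ch i \<subseteq> {..<m}" "\<And>i. i < m \<Longrightarrow> card (ch i) \<le> 2"
    and parent: "\<And>i i' c. i < m \<Longrightarrow> i' < m \<Longrightarrow> c \<in> ch i \<Longrightarrow> c \<in> ch i' \<Longrightarrow> i = i'"
    and rt_ch: "\<And>i. i < m \<Longrightarrow> rt \<notin> ch i"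
    and reach: "\<And>S. rt \<in> S \<Longrightarrow> (\<And>i. i < m \<Longrightarrow> i \<in> S \<Longrightarrow> ch i \<subseteq> S) \<Longrightarrow> {..<m} \<subseteq> S"
  shows "tri bfs_phase s (70 * m + 20) (\<lambda>s'. bfs_order (cell s' ''q'') m ch)"
proof -
  let ?off = "cell s ''child_off''" and ?child = "cell s ''child''"
  have off: "?off (Suc i) = ?off i + card (ch i)"
    and child: "bij_betw ?child {?off i..<?off (Suc i)} (ch i)" if "i < m" for i
    using st that unfolding stores_sets_def Suc_eq_plus1 by blast+
  define base where "base = (\<lambda>s' :: ram_state. (\<forall>a. a \<notin> {''q''} \<longrightarrow> cell s' a = cell s a) \<and> reg s' ''m'' = m)"
  define queue where "queue = (\<lambda>(h::nat) t (q :: nat \<Rightarrow> nat). h \<le> t \<and> inj_on q {..<t} \<and> q ` {..<t} \<subseteq> {..<m} \<and> 0 < t \<and> q 0 = rt \<and>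
    (\<forall>g < h. \<forall>c \<in> ch (q g). \<exists>g'. g < g' \<and> g' < t \<and> q g' = c) \<and>
    (\<forall>x < t. q x = rt \<or> (\<exists>g < h. q x \<in> ch (q g))))"
  define I where "I = (\<lambda>h s'. base s' \<and> reg s' ''h'' = h \<and> queue h (reg s' ''tail'') (cell s' ''q''))"
  define J where "J = (\<lambda>h t q j s'. base s' \<and> reg s' ''h'' = h \<and> reg s' ''i'' = q h \<and> reg s' ''j'' = j \<and>
    ?off (q h) \<le> j \<and> reg s' ''tail'' = t + (j - ?off (q h)) \<and>
    (\<forall>x < t. cell s' ''q'' x = q x) \<and> (\<forall>x < j - ?off (q h). cell s' ''q'' (t + x) = ?child (?off (q h) + x)))"
  let ?guard = "Cell ''child_off'' (Plus (Reg ''i'') (Num 1))"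
  have inner: "tri bfs_inner s' 12 (J h t q (Suc j))" if "J h t q j s'" for h t q j s'
    unfolding bfs_inner_def using that
    by (intro tri_mono[OF tri_Store_Seq[OF tri_Assign_Seq[OF tri_Assign[where k = 4]]]])
      (auto simp: J_def base_def less_Suc_eq Suc_diff_le)
  \<comment> \<open>If the queue ran dry after \<open>h < m\<close> rounds, its nodes would be
    closed under children, hence all \<open>m\<close> of them, but there are only
    \<open>h\<close>.\<close>
  have not_exhausted: "h < t" if q: "queue h t q" and h: "h < m" for h t q
  proof (rule ccontr)
    assume "\<not> h < t"
    then have "h = t" using q by (simp add: queue_def)
    have "{..<m} \<subseteq> q ` {..<t}"
    proof (rule reach)
      have "q 0 = rt" "0 < t" using q by (auto simp: queue_def)
      then show "rt \<in> q ` {..<t}" by force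
      fix i assume "i \<in> q ` {..<t}"
      then obtain g where "g < h" "i = q g" using \<open>h = t\<close> by auto
      then show "ch i \<subseteq> q ` {..<t}"
        using q unfolding queue_def by fastforce
    qed
    then have "card {..<m} \<le> card (q ` {..<t})"
      by (intro card_mono) auto
    also have "\<dots> \<le> t"
      using card_image_le[of "{..<t}" q] by simp
    finally show False using h \<open>h = t\<close> by simp
  qed
  have extend: "queue (Suc h) (t + card (ch (q h))) q'"
    if q: "queue h t q" and h: "h < m" and old: "\<forall>x < t. q' x = q x"
      and new: "\<forall>x < card (ch (q h)). q' (t + x) = ?child (?off (q h) + x)" for h t q q'
  proof -
    have ht: "h < t" using not_exhausted[OF q h] .
    let ?i = "q h" and ?k = "card (ch (q h))"
    have i: "?i < m" using q ht by (auto simp: queue_def)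
    have bij: "bij_betw (\<lambda>x. ?child (?off ?i + x)) {..<?k} (ch ?i)"
    proof -
      have "bij_betw (\<lambda>x. ?off ?i + x) {..<?k} {?off ?i..<?off (Suc ?i)}"
        using off[OF i] by (intro bij_betw_byWitness[where f' = "\<lambda>x. x - ?off ?i"]) auto
      from bij_betw_trans[OF this child[OF i]] show ?thesis by (simp add: comp_def)
    qed
    have new_ch: "q' x \<in> ch ?i" if "t \<le> x" "x < t + ?k" for x
    proof -
      obtain y where y: "x = t + y" "y < ?k" using \<open>t \<le> x\<close> \<open>x < t + ?k\<close> by (metis le_Suc_ex nat_add_left_cancel_less)
      then show ?thesis using new bij by (auto simp: bij_betw_def)
    qed
    have ch_new: "\<exists>x. t \<le> x \<and> x < t + ?k \<and> q' x = c" if c: "c \<in> ch ?i" for c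
    proof -
      obtain y where "y < ?k" "c = ?child (?off ?i + y)"
        using bij c by (auto simp: bij_betw_def)
      then show ?thesis using new by (intro exI[of _ "t + y"]) auto
    qed
    \<comment> \<open>A node in the queue other than the root has its parent among the
      \<open>h\<close> nodes already treated, so its parent is not \<open>?i\<close>.\<close>
    have old_notin: "q x \<notin> ch ?i" if x: "x < t" for x
    proof
      assume c: "q x \<in> ch ?i"
      then obtain g where g: "g < h" "q x \<in> ch (q g)"
        using q x rt_ch[OF i] unfolding queue_def by auto
      have "g < t" "q ` {..<t} \<subseteq> {..<m}" using q g ht unfolding queue_def by auto
      then have "q g < m" by blast
      then have "q g = ?i" using parent i c g by blast
      then show False using q g ht unfolding queue_def inj_on_def by auto
    qed
    have "inj_on q' {..<t + ?k}"
    proof (rule inj_onI)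
      fix x y assume xy: "x \<in> {..<t + ?k}" "y \<in> {..<t + ?k}" "q' x = q' y"
      consider "x < t" "y < t" | "x < t" "t \<le> y" | "t \<le> x" "y < t" | "t \<le> x" "t \<le> y" by linarith
      then show "x = y"
      proof cases
        case 1
        then show ?thesis using q old xy unfolding queue_def inj_on_def by auto
      next
        case 2
        then have "q' x \<notin> ch ?i" "q' y \<in> ch ?i" using old old_notin[of x] new_ch[of y] xy by auto
        then show ?thesis using xy(3) by simp
      next
        case 3
        then have "q' x \<in> ch ?i" "q' y \<notin> ch ?i" using old old_notin[of y] new_ch[of x] xy by auto
        then show ?thesis using xy(3) by simp
      next
        case 4
        then obtain a b where "x = t + a" "y = t + b" using le_Suc_ex by blast
        then show ?thesis using xy new bij by (auto simp: bij_betw_def inj_on_def)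
      qed
    qed
    moreover have "q' ` {..<t + ?k} \<subseteq> {..<m}"
    proof safe
      fix x assume "x < t + ?k"
      then show "q' x < m"
        using q old new_ch[of x] ch(1)[OF i] unfolding queue_def by (cases "x < t") auto
    qed
    moreover have "\<exists>g'. g < g' \<and> g' < t + ?k \<and> q' g' = c" if g: "g < Suc h" and c: "c \<in> ch (q' g)" for g c
    proof (cases "g = h")
      case True
      then have "c \<in> ch ?i" using c old ht by auto
      then obtain x where "t \<le> x" "x < t + ?k" "q' x = c" using ch_new by blast
      then show ?thesis using True ht by (intro exI[of _ x]) auto
    next
      case False
      then obtain g' where "g < g'" "g' < t" "q g' = c"
        using g c old ht q unfolding queue_def by (metis less_SucE less_trans)
      then show ?thesis using old by (intro exI[of _ g']) auto
    qed
    moreover have "q' x = rt \<or> (\<exists>g < Suc h. q' x \<in> ch (q' g))" if x: "x < t + ?k" for x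
    proof (cases "x < t")
      case True
      then have "q x = rt \<or> (\<exists>g < h. q x \<in> ch (q g))"
        using q unfolding queue_def by blast
      then show ?thesis
        using True old ht by (metis less_SucI less_trans)
    next
      case False
      then show ?thesis
        using new_ch[of x] x old ht by (intro disjI2 exI[of _ h]) auto
    qed
    moreover have "0 < t" "q' 0 = rt" using q old unfolding queue_def by auto
    ultimately show ?thesis
      using ht unfolding queue_def by auto
  qed
  have outer: "tri bfs_body s' 60 (I (Suc h))" if h: "h < m" and I: "I h s'" for h s'
  proof -
    let ?t = "reg s' ''tail''" and ?q = "cell s' ''q''"
    have q: "queue h ?t ?q" using I by (simp add: I_def)
    have i: "?q h < m" using not_exhausted[OF q h] q by (auto simp: queue_def)
    let ?c = "(\<Sum>j=?off (?q h)..<?off (Suc (?q h)). 12 + acost ?guard + 3) + acost ?guard + 3"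
    have loop: "tri (While (Less (Reg ''j'') ?guard) bfs_inner) s'' ?c (J h ?t ?q (?off (Suc (?q h))))"
      if "J h ?t ?q (?off (?q h)) s''" for s''
    proof (rule tri_while_from[where I = "J h ?t ?q"])
      show "tri bfs_inner u 12 (J h ?t ?q (Suc j))" if "J h ?t ?q j u" for j u
        using inner[OF that] .
    qed (use that off[OF i] in \<open>auto simp: J_def base_def\<close>)
    \<comment> \<open>At most two children at 19 operations each, and 7 for the last test.\<close>
    have c: "?c \<le> 45"
      using off[OF i] ch(2)[OF i] by simp
    have "tri bfs_body s' (3 + (3 + (?c + 4))) (I (Suc h))"
      unfolding bfs_body_def
    proof (intro tri_mono[OF tri_Assign_Seq[OF tri_Assign_Seq[OF tri_Seq[OF tri_mono[OF loop]]]]])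
      show "tri (incr ''h'') s'' 4 (I (Suc h))" if J: "J h ?t ?q (?off (Suc (?q h))) s''" for s''
      proof (rule tri_Assign)
        have "queue (Suc h) (reg s'' ''tail'') (cell s'' ''q'')"
          using extend[OF q h, of "cell s'' ''q''"] J off[OF i] by (auto simp: J_def)
        then show "I (Suc h) (s''\<lparr>reg := (reg s'')(''h'' := aval (Plus (Reg ''h'') (Num 1)) s'')\<rparr>)"
          using J by (auto simp: I_def J_def base_def)
      qed simp
    qed (use I in \<open>auto simp: I_def J_def base_def\<close>)
    then show ?thesis
      using c by (elim tri_mono) auto
  qed
  have loop: "tri (While (Less (Reg ''h'') (Reg ''m'')) bfs_body) s'
      ((\<Sum>h=0..<m. 60 + acost (Reg ''m'') + 3) + acost (Reg ''m'') + 3) (I m)" if "I 0 s'" for s'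
    by (rule tri_while_from[where I = I and \<kappa> = "\<lambda>_. 60"]) (use outer that in \<open>auto simp: I_def base_def\<close>)
  have init: "I 0 (s\<lparr>cell := (cell s)(''q'' := (cell s ''q'')(0 := rt))\<rparr>\<lparr>reg := (reg s)(''tail'' := 1)\<rparr>)"
    using m zero root by (auto simp: I_def base_def queue_def inj_on_def)
  have fin: "bfs_order (cell s' ''q'') m ch" if I: "I m s'" for s'
  proof -
    let ?q = "cell s' ''q''" and ?t = "reg s' ''tail''"
    have q: "queue m ?t ?q" using I by (simp add: I_def)
    have "card (?q ` {..<?t}) \<le> card {..<m}"
      using q by (intro card_mono) (auto simp: queue_def)
    then have "?t \<le> m"
      using q by (simp add: queue_def card_image)
    then have t: "?t = m" using q by (simp add: queue_def)
    have "bij_betw ?q {..<m} {..<m}"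
      using q t endo_inj_surj[of "{..<m}" ?q] by (auto simp: queue_def bij_betw_def)
    then show ?thesis
      using q t unfolding bfs_order_def queue_def by auto
  qed
  show ?thesis
    unfolding bfs_phase_def
    by (intro tri_mono[OF tri_Store_Seq[OF tri_Assign_Seq[OF tri_mono[OF loop]]]])
      (use init root fin in auto)
qed

section \<open>Parameters of the state space\<close>

definition set_reg :: "string \<Rightarrow> fx \<Rightarrow> com" where
  "set_reg x e = Seq (compile e [] 0) (Assign x (sreg 0))"

lemma sim_empty: "sim s [] [] d s"
  by (simp add: sim_def agree_refl)

lemma tri_set_reg:
  assumes "ok e s [] Q" "1 \<le> Q"
  shows "tri (set_reg x e) s (kc e * Q ^ dp e + 2)
    (\<lambda>s'. reg s' x = fval e s [] \<and> (\<forall>y. y \<noteq> x \<longrightarrow> y \<notin> range slot \<longrightarrow> reg s' y = reg s y) \<and> cell s' = cell s)"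
  unfolding set_reg_def
  by (rule computes_then[OF compile_correct[OF assms(2,1) sim_empty]])
    (auto simp: agree_def intro!: tri_Assign)

text \<open>The width bound is not part of the input, so \<open>B\<close> has to be computed from
  the bags.\<close>

definition bag_max_fx :: fx where
  "bag_max_fx = Iter (Glob ''m'') (Const 0)
    (Ite (Lt (Var 1) (App bs_fx [Var 0])) (App bs_fx [Var 0]) (Var 1))"

definition prep_phase :: "nat \<Rightarrow> com" where
  "prep_phase r = Seq (set_reg ''B'' (Add bag_max_fx (Const 2)))
    (Seq (set_reg ''L'' (App pow_fx [Glob ''B'', Const r]))
      (set_reg ''N'' (App pow_fx [Const 2, Add (Glob ''L'') (Glob ''L'')])))"

definition bag_size :: "ram_state \<Rightarrow> nat \<Rightarrow> nat" where
  "bag_size s j = (if j < reg s ''m'' then cell s ''bag_off'' (j + 1) - cell s ''bag_off'' j else 0)"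

lemma iterate_max:
  "(\<forall>i < n. f i \<le> iterate (\<lambda>i acc. if acc < f i then f i else acc) 0 n) \<and>
   ((\<forall>i < n. f i \<le> (W :: nat)) \<longrightarrow> iterate (\<lambda>i acc. if acc < f i then f i else acc) 0 n \<le> W)"
  by (induction n) (auto simp: less_Suc_eq le_trans)

lemma fval_bag_max:
  "fval bag_max_fx s [] = iterate (\<lambda>i acc. if acc < bag_size s i then bag_size s i else acc) 0 (reg s ''m'')"
  by (simp add: bag_max_fx_def bs_fx_def bag_size_def cong: if_cong)

lemma prep_cost:
  fixes kp :: nat
  assumes "30 \<le> kp"
  shows "((kb + 6) * m + 2) + (((kp + 7) * P + 2) + ((kp + 13) * P + 2)) \<le> (kb + 6) * m + 4 * kp * P + 30"
proof -
  have "(kp + 7) * P \<le> (2 * kp) * P" "(kp + 13) * P \<le> (2 * kp) * P"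
    using assms by (intro mult_right_mono; simp)+
  moreover have "4 * kp * P = (2 * kp) * P + (2 * kp) * P" by simp
  ultimately show ?thesis by linarith
qed

text \<open>The stages use different bounds. The maximum is a single loop of \<open>m\<close> rounds
  and costs O(m); the powers are computed under the bound \<open>2 ^ (2 * B ^ r)\<close>,
  independently of \<open>m\<close>.\<close>

lemma prep_phase_correct:
  fixes s :: ram_state and r :: nat
  assumes m: "1 \<le> reg s ''m''" and r: "1 \<le> r"
  shows "\<exists>B. (\<forall>i. bag_size s i + 2 \<le> B) \<and> (\<forall>W. (\<forall>i < reg s ''m''. bag_size s i \<le> W) \<longrightarrow> B \<le> W + 2) \<and>
    tri (prep_phase r) s ((kc bag_max_fx + 6) * reg s ''m'' + 4 * kc pow_fx * (2 ^ (2 * B ^ r)) ^ (dp pow_fx) + 30)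
      (\<lambda>s'. reg s' ''B'' = B \<and> reg s' ''L'' = B ^ r \<and> reg s' ''N'' = 2 ^ (2 * B ^ r))"
proof (intro exI conjI)
  let ?max = "iterate (\<lambda>i acc. if acc < bag_size s i then bag_size s i else acc) 0 (reg s ''m'')"
  let ?B = "?max + 2"
  let ?Q = "2 ^ (2 * ?B ^ r) :: nat"
  show "\<forall>i. bag_size s i + 2 \<le> ?B"
  proof
    fix i
    show "bag_size s i + 2 \<le> ?B"
      using iterate_max[of "reg s ''m''" "bag_size s"] by (cases "i < reg s ''m''") (auto simp: bag_size_def)
  qed
  show "\<forall>W. (\<forall>i < reg s ''m''. bag_size s i \<le> W) \<longrightarrow> ?B \<le> W + 2"
    using iterate_max[of "reg s ''m''" "bag_size s"] by auto
  have ok1: "ok (Add bag_max_fx (Const 2)) s [] (reg s ''m'')"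
    by (simp add: bag_max_fx_def bs_fx_def)
  have val1: "fval (Add bag_max_fx (Const 2)) s [] = ?B"
    by (simp add: fval_bag_max)
  have QL: "2 * ?B ^ r \<le> ?Q" by (rule less_imp_le[OF less_exp])
  have rQ: "r \<le> ?Q"
  proof -
    have "r \<le> 2 ^ r" using less_exp[of r] by simp
    also have "\<dots> \<le> ?B ^ r" by (rule power_mono) auto
    finally show ?thesis using QL by linarith
  qed
  have pQ: "?B ^ i \<le> ?Q" if "i < r" for i
  proof -
    have "?B ^ i \<le> ?B ^ r" using that by (intro power_increasing) auto
    then show ?thesis using QL by linarith
  qed
  let ?e1 = "Add bag_max_fx (Const 2)" and ?e2 = "App pow_fx [Glob ''B'', Const r]"
    and ?e3 = "App pow_fx [Const 2, Add (Glob ''L'') (Glob ''L'')]"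
  let ?k1 = "kc ?e1 * reg s ''m'' ^ dp ?e1 + 2" and ?k2 = "kc ?e2 * ?Q ^ dp ?e2 + 2"
    and ?k3 = "kc ?e3 * ?Q ^ dp ?e3 + 2"
  let ?P = "\<lambda>s'. reg s' ''B'' = ?B \<and> reg s' ''L'' = ?B ^ r \<and> reg s' ''N'' = ?Q"
  have "tri (prep_phase r) s (?k1 + (?k2 + ?k3)) ?P"
    unfolding prep_phase_def
  proof (rule tri_Seq[OF tri_mono[OF tri_set_reg[OF ok1 m] le_refl]], elim conjE)
    fix s1 :: ram_state assume "reg s1 ''B'' = fval ?e1 s []"
    then have B: "reg s1 ''B'' = ?B" using val1 by simp
    have ok2: "ok ?e2 s1 [] ?Q"
      using rQ pQ by (simp add: B)
    show "tri (Seq (set_reg ''L'' ?e2) (set_reg ''N'' ?e3)) s1 (?k2 + ?k3) ?P"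
    proof (rule tri_Seq[OF tri_mono[OF tri_set_reg[OF ok2] le_refl]], simp, elim conjE)
      fix s2 :: ram_state assume "reg s2 ''L'' = fval ?e2 s1 []"
        "\<forall>y. y \<noteq> ''L'' \<longrightarrow> y \<notin> range slot \<longrightarrow> reg s2 y = reg s1 y"
      then have L: "reg s2 ''L'' = ?B ^ r" "reg s2 ''B'' = ?B" using B by simp_all
      have ok3: "ok ?e3 s2 [] ?Q"
        using QL by (auto simp: L mult_2)
      have val3: "fval ?e3 s2 [] = ?Q"
        by (simp add: L mult_2)
      show "tri (set_reg ''N'' ?e3) s2 ?k3 ?P"
        by (rule tri_mono[OF tri_set_reg[OF ok3]]) (use L val3 in auto)
    qed
  qed
  then show "tri (prep_phase r) s ((kc bag_max_fx + 6) * reg s ''m'' + 4 * kc pow_fx * (2 ^ (2 * ?B ^ r)) ^ (dp pow_fx) + 30)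
      (\<lambda>s'. reg s' ''B'' = ?B \<and> reg s' ''L'' = ?B ^ r \<and> reg s' ''N'' = 2 ^ (2 * ?B ^ r))"
  proof (rule tri_mono)
    have d: "dp bag_max_fx = 1" and k: "30 \<le> kc pow_fx"
      by (simp_all add: bag_max_fx_def bs_fx_def pow_fx_def)
    have e: "kc ?e1 = kc bag_max_fx + 6" "dp ?e1 = 1" "kc ?e2 = kc pow_fx + 7" "dp ?e2 = dp pow_fx"
      "kc ?e3 = kc pow_fx + 13" "dp ?e3 = dp pow_fx"
      using d by simp_all
    show "?k1 + (?k2 + ?k3) \<le> (kc bag_max_fx + 6) * reg s ''m'' + 4 * kc pow_fx * ?Q ^ dp pow_fx + 30"
      unfolding e power_one_right by (rule prep_cost[OF k])
  qed
qed

section \<open>Filling the table\<close>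

definition dp_inner :: "nat \<Rightarrow> (nat \<times> nat) list \<Rightarrow> com" where
  "dp_inner r es = Seq (compile (App (step_fx r es) [Glob ''i'', Glob ''c'']) [] 0)
    (Seq (compile (Add (App mult_fx [Glob ''c'', Glob ''m'']) (Glob ''i'')) [] 1)
    (Seq (Store ''tab'' (sreg 1) (sreg 0)) (incr ''c'')))"

text \<open>The index \<open>m - k - 1\<close> runs through the node order backwards.\<close>

definition dp_body :: "nat \<Rightarrow> (nat \<times> nat) list \<Rightarrow> com" where
  "dp_body r es = Seq (Assign ''i'' (Cell ''q'' (Minus (Minus (Reg ''m'') (Reg ''k'')) (Num 1))))
    (Seq (Assign ''c'' (Num 0))
    (Seq (While (Less (Reg ''c'') (Reg ''N'')) (dp_inner r es)) (incr ''k'')))"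

definition dp_phase :: "nat \<Rightarrow> (nat \<times> nat) list \<Rightarrow> com" where
  "dp_phase r es = While (Less (Reg ''k'') (Reg ''m'')) (dp_body r es)"

text \<open>The 7 pays for storing the entry (3) and advancing the counter (4).\<close>

definition dp_const :: "nat \<Rightarrow> (nat \<times> nat) list \<Rightarrow> nat" where
  "dp_const r es = kc (App (step_fx r es) [Glob ''i'', Glob ''c'']) +
    kc (Add (App mult_fx [Glob ''c'', Glob ''m'']) (Glob ''i'')) + 7"

definition dp_degree :: "nat \<Rightarrow> (nat \<times> nat) list \<Rightarrow> nat" where
  "dp_degree r es = dp (App (step_fx r es) [Glob ''i'', Glob ''c'']) +
    dp (Add (App mult_fx [Glob ''c'', Glob ''m'']) (Glob ''i''))"

definition same_data :: "ram_state \<Rightarrow> ram_state \<Rightarrow> bool" where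
  "same_data s s' \<longleftrightarrow>
    (\<forall>a. a \<noteq> ''tab'' \<longrightarrow> cell s' a = cell s a) \<and>
    (\<forall>x. x \<notin> {''i'', ''c'', ''k''} \<longrightarrow> x \<notin> range slot \<longrightarrow> reg s' x = reg s x)"

text \<open>The table and the counters do not occur in the assumptions of \<open>dp_state\<close>,
  so all rules on expressions remain available while the table is being filled.\<close>

lemma (in dp_state) dp_state_same_data:
  assumes "same_data s s'"
  shows "dp_state r B hadj E bl bs s' es Q"
proof
  note * = assms[unfolded same_data_def]
  show "reg s' ''B'' = B" "reg s' ''L'' = L" "reg s' ''N'' = 2 ^ (2 * L)"
    using * reg_B reg_L reg_N by simp_all
  show "(u, v) \<in> E \<longleftrightarrow>
      u < reg s' ''n'' \<and> v < reg s' ''n'' \<and> cell s' ''mat'' (cell s' ''row'' u + v) \<noteq> 0" for u v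
    using * E_mat by simp
  show "bl j p = cell s' ''bag'' (cell s' ''bag_off'' j + p)" for j p
    using * bl_bag by simp
  show "bs j = (if j < reg s' ''m'' then cell s' ''bag_off'' (j + 1) - cell s' ''bag_off'' j else 0)" for j
    using * bs_bag by simp
qed (use B2 Q hadj_es bs_B in auto)

lemma bounded_ex2_cong:
  assumes "\<And>c. c < (N::nat) \<Longrightarrow> P c \<longleftrightarrow> P' c" "\<And>c. c < N \<Longrightarrow> Q c \<longleftrightarrow> Q' c"
    and "\<And>c. P' c \<Longrightarrow> c < N" "\<And>c. Q' c \<Longrightarrow> c < N"
  shows "(\<exists>c1 < N. \<exists>c2 < N. P c1 \<and> Q c2 \<and> R c1 c2) \<longleftrightarrow> (\<exists>c1 c2. P' c1 \<and> Q' c2 \<and> R c1 c2)"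
  using assms by (metis (no_types, lifting))

text \<open>After \<open>k\<close> rounds the entries of the last \<open>k\<close> nodes of the
  order are final. Each child of the next node is among those or is the dummy, so
  \<open>feas_step\<close> turns the computed value into feasibility.\<close>

lemma (in dp_state) dp_phase_correct:
  assumes m: "reg s ''m'' = m" and k0: "reg s ''k'' = 0"
    and order: "bfs_order (cell s ''q'') m ch"
    and kids: "\<And>i k. i < m \<Longrightarrow> k < 2 \<Longrightarrow> kid s k i = m \<or> kid s k i \<in> ch i"
    and split: "\<And>i. i < m \<Longrightarrow> split_node i (kid s 0 i) (kid s 1 i)"
    and Vm: "V m = {}" and QN: "Q = 2 ^ (2 * L)"
  shows "tri (dp_phase r es) s (m * (Q * (dp_const r es * Q ^ dp_degree r es + 4) + 30) + 10)
    (\<lambda>s'. (\<forall>i \<le> m. \<forall>c < 2 ^ (2 * L). tab_at s' i c \<longleftrightarrow> feas i c) \<and> same_data s s')"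
proof -
  let ?q = "cell s ''q''" and ?N = "2 ^ (2 * L) :: nat"
  let ?C = "dp_const r es * Q ^ dp_degree r es"
  have Q1: "1 \<le> Q" using two_le_Q by simp
  have q_less: "?q x < m" if "x < m" for x
    using order that by (auto simp: bfs_order_def bij_betw_def)
  have q_inj: "x = y" if "?q x = ?q y" "x < m" "y < m" for x y
    using order that by (auto simp: bfs_order_def bij_betw_def inj_on_def)
  have q_surj: "\<exists>x < m. ?q x = i" if "i < m" for i
  proof -
    have "i \<in> ?q ` {..<m}" using order that by (simp add: bfs_order_def bij_betw_def)
    then show ?thesis by auto
  qed
  define filled where "filled = (\<lambda>k (s' :: ram_state). \<forall>x < m. m \<le> x + k \<longrightarrow>
    (\<forall>c < ?N. cell s' ''tab'' (c * m + ?q x) \<noteq> 0 \<longleftrightarrow> feas (?q x) c))"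
  define I where "I = (\<lambda>k s'. same_data s s' \<and> reg s' ''k'' = k \<and> filled k s')"
  define J where "J = (\<lambda>k i c s'. same_data s s' \<and> reg s' ''k'' = k \<and> filled k s' \<and> reg s' ''i'' = i \<and>
    reg s' ''c'' = c \<and> (\<forall>c' < c. cell s' ''tab'' (c' * m + i) \<noteq> 0 \<longleftrightarrow> feas i c'))"
  \<comment> \<open>Different entries have different addresses, so a write spoils no other
    entry.\<close>
  have index: "c = c' \<and> i = i'" if "c * m + i = c' * m + i'" "i < m" "i' < m" for c c' i i'
  proof -
    have "(c * m + i) div m = c" "(c' * m + i') div m = c'"
      using that(2,3) by auto
    then have "c = c'" using that(1) by metis
    then show ?thesis using that(1) by simp
  qed
  have inner: "tri (dp_inner r es) s' ?C (J k i (Suc c))"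
    if k: "k < m" and i: "i = ?q (m - k - 1)" and c: "c < ?N" and J: "J k i c s'" for k i c s'
  proof -
    interpret S: dp_state r B hadj E bl bs V s' es Q
      using J dp_state_same_data by (simp add: J_def)
    have im: "i < m" using q_less[of "m - k - 1"] k i by simp
    have s': "reg s' ''m'' = m" "kid s' h i = kid s h i" for h
      using J m by (auto simp: J_def same_data_def kid_def)
    have filled_kid: "tab_at s' j c' \<longleftrightarrow> feas j c'" if j: "j = m \<or> j \<in> ch i" and c': "c' < ?N" for j c'
    proof (cases "j = m")
      case True
      then show ?thesis
        using feas_empty[OF Vm B2] s' by (simp add: tab_at_def S.reg_L)
    next
      case False
      then have "j \<in> ch (?q (m - k - 1))" "m - k - 1 < m"
        using j i k by auto
      then obtain x where x: "m - k - 1 < x" "x < m" "?q x = j"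
        using order unfolding bfs_order_def by blast
      then show ?thesis
        using J c' q_less[of x] s' unfolding J_def filled_def tab_at_def by auto
    qed
    have step: "holds (step_fx r es) s' [i, c] \<longleftrightarrow> feas i c"
    proof -
      have lt: "feas j c' \<Longrightarrow> c' < ?N" for j c'
        by (auto simp: feas_def realises_def)
      have kk: "kid s 0 i = m \<or> kid s 0 i \<in> ch i" "kid s 1 i = m \<or> kid s 1 i \<in> ch i"
        using kids[OF im] by auto
      show ?thesis
        unfolding S.holds_step s' feas_step[OF split[OF im]]
        using bounded_ex2_cong[OF filled_kid[OF kk(1)] filled_kid[OF kk(2)] lt lt, where R = "\<lambda>c1 c2. local_ok i c (kid s 0 i) c1 (kid s 1 i) c2"] c
        by simp
    qed
    let ?e1 = "App (step_fx r es) [Glob ''i'', Glob ''c'']"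
    let ?e2 = "Add (App mult_fx [Glob ''c'', Glob ''m'']) (Glob ''i'')"
    have e1: "ok ?e1 s' [] Q" "fval ?e1 s' [] \<noteq> 0 \<longleftrightarrow> feas i c"
      using J c QN step[unfolded holds_def] S.ok_step[of c i] by (auto simp: J_def)
    have "tri (dp_inner r es) s' (kc ?e1 * Q ^ dp ?e1 + (kc ?e2 * Q ^ dp ?e2 + (3 + 4))) (J k i (Suc c))"
      unfolding dp_inner_def
    proof (rule computes_then[OF compile_correct[OF Q1 e1(1) sim_empty]])
      fix s1 assume s1: "agree 0 s' s1" "reg s1 (slot 0) = fval ?e1 s' []"
      have r1: "reg s1 ''c'' = c" "reg s1 ''m'' = m" "reg s1 ''i'' = i"
        using s1 J s' by (auto simp: agree_def J_def)
      have e2: "ok ?e2 s1 [] Q" "fval ?e2 s1 [] = c * m + i"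
        using c QN r1 by auto
      \<comment> \<open>The address is computed from depth 1 on, so the entry in slot 0
        survives.\<close>
      show "tri (Seq (compile ?e2 [] 1) (Seq (Store ''tab'' (sreg 1) (sreg 0)) (incr ''c''))) s1
        (kc ?e2 * Q ^ dp ?e2 + (3 + 4)) (J k i (Suc c))"
      proof (rule computes_then[OF compile_correct[OF Q1 e2(1) sim_empty]])
        fix s2 assume s2: "agree 1 s1 s2" "reg s2 (slot 1) = fval ?e2 s1 []"
        have a: "agree 0 s' s2"
          using s1 s2 agree_trans'[of 0 s' s1 1 s2] by simp
        have v: "reg s2 (slot 0) = fval ?e1 s' []" "reg s2 (slot 1) = c * m + i"
          using s1 s2 e2 agree_slot[OF s2(1), of 0] by auto
        have J2: "J k i c s2"
          using J a by (auto simp: J_def agree_def same_data_def filled_def)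
        have "J k i (Suc c) (s2\<lparr>cell := (cell s2)(''tab'' := (cell s2 ''tab'')(c * m + i := fval ?e1 s' []))\<rparr>
            \<lparr>reg := (reg s2)(''c'' := Suc c)\<rparr>)"
        proof -
          have "?q x \<noteq> i" if "x < m" "m \<le> x + k" for x
            using q_inj[of x "m - k - 1"] k i that by auto
          then have "c' * m + ?q x \<noteq> c * m + i" if "x < m" "m \<le> x + k" for x c'
            using index[of c' "?q x" c i] q_less im that by blast
          moreover have "c' * m + i \<noteq> c * m + i" if "c' < c" for c'
            using that im by auto
          ultimately show ?thesis
            using J2 e1(2) by (auto simp: J_def same_data_def filled_def less_Suc_eq)
        qed
        then show "tri (Seq (Store ''tab'' (sreg 1) (sreg 0)) (incr ''c'')) s2 (3 + 4) (J k i (Suc c))"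
          using J2 v
          by (intro tri_mono[OF tri_Store_Seq[OF tri_Assign[where k = 4]]]) (auto simp: J_def)
      qed
    qed
    moreover have "kc ?e1 * Q ^ dp ?e1 + (kc ?e2 * Q ^ dp ?e2 + (3 + 4)) \<le> ?C"
      using add_cost2[OF Q1, of "kc ?e1" "dp ?e1" "kc ?e2" "dp ?e2" 7]
      unfolding dp_const_def dp_degree_def by simp
    ultimately show ?thesis by (rule tri_mono)
  qed
  have body: "tri (dp_body r es) s' (Q * (?C + 4) + 20) (I (Suc k))" if k: "k < m" and I: "I k s'" for k s'
  proof -
    let ?i = "?q (m - k - 1)"
    have loop: "tri (While (Less (Reg ''c'') (Reg ''N'')) (dp_inner r es)) s''
        ((\<Sum>c=0..<?N. ?C + acost (Reg ''N'') + 3) + acost (Reg ''N'') + 3) (J k ?i ?N)"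
      if "J k ?i 0 s''" for s''
    proof (rule tri_while_from[where I = "\<lambda>c s'. c \<le> ?N \<and> J k ?i c s'", THEN tri_mono])
      show "tri (dp_inner r es) t ?C (\<lambda>s'. Suc c \<le> ?N \<and> J k ?i (Suc c) s')"
        if "c < ?N" "c \<le> ?N \<and> J k ?i c t" for c t
        using inner[OF k refl that(1)] that by (auto elim!: tri_mono)
    qed (use that reg_N in \<open>auto simp: J_def same_data_def\<close>)
    have fin: "I (Suc k) (s''\<lparr>reg := (reg s'')(''k'' := Suc (reg s'' ''k''))\<rparr>)" if J: "J k ?i ?N s''" for s''
    proof -
      have "filled (Suc k) s''"
        unfolding filled_def
      proof (intro allI impI)
        fix x c assume x: "x < m" "m \<le> x + Suc k" and c: "c < ?N"
        have "x = m - k - 1 \<or> m \<le> x + k" using x by linarith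
        then show "cell s'' ''tab'' (c * m + ?q x) \<noteq> 0 \<longleftrightarrow> feas (?q x) c"
          using J x(1) c unfolding J_def filled_def by blast
      qed
      then show ?thesis
        using J by (simp add: J_def I_def filled_def same_data_def)
    qed
    have "tri (dp_body r es) s' (7 + (2 + (((\<Sum>c=0..<?N. ?C + acost (Reg ''N'') + 3) + acost (Reg ''N'') + 3) + 4))) (I (Suc k))"
      unfolding dp_body_def
    proof (intro tri_mono[OF tri_Assign_Seq[OF tri_Assign_Seq[OF tri_Seq[OF tri_mono[OF loop]]]]])
      show "tri (incr ''k'') s'' 4 (I (Suc k))" if "J k ?i ?N s''" for s''
        using fin[OF that] by (intro tri_Assign) auto
    qed (use I m in \<open>auto simp: I_def J_def same_data_def filled_def\<close>)
    then show ?thesis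
      by (elim tri_mono) (simp_all add: QN algebra_simps)
  qed
  have "tri (dp_phase r es) s ((\<Sum>k=0..<m. (Q * (?C + 4) + 20) + acost (Reg ''m'') + 3) + acost (Reg ''m'') + 3) (I m)"
    unfolding dp_phase_def
    by (rule tri_while_from[where I = I and \<kappa> = "\<lambda>_. Q * (?C + 4) + 20"])
      (use body k0 m in \<open>auto simp: I_def same_data_def filled_def\<close>)
  moreover have "(\<forall>i \<le> m. \<forall>c < ?N. tab_at s' i c \<longleftrightarrow> feas i c) \<and> same_data s s'" if I: "I m s'" for s'
  proof (intro conjI allI impI)
    show sd: "same_data s s'" using I by (simp add: I_def)
    interpret S: dp_state r B hadj E bl bs V s' es Q
      using sd by (rule dp_state_same_data)
    fix i c :: nat assume i: "i \<le> m" and c: "c < ?N"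
    have m': "reg s' ''m'' = m" using sd m by (simp add: same_data_def)
    show "tab_at s' i c \<longleftrightarrow> feas i c"
    proof (cases "i = m")
      case True
      then show ?thesis
        using feas_empty[OF Vm B2] m' by (simp add: tab_at_def S.reg_L)
    next
      case False
      then obtain x where "x < m" "?q x = i" using q_surj[of i] i by auto
      then show ?thesis
        using I c m' q_less[of x] by (auto simp: I_def filled_def tab_at_def)
    qed
  qed
  ultimately show ?thesis
    by (elim tri_mono) (auto simp: algebra_simps)
qed

section \<open>Tree decompositions\<close>

text \<open>Induction on the length of the root path. This supplies the reachability premise of the
  breadth-first search.\<close>

lemma (in rooted_tree) reach_all:
  assumes "rt \<in> S" and step: "\<And>i. i \<in> pverts T \<Longrightarrow> i \<in> S \<Longrightarrow> children T rt i \<subseteq> S"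
  shows "pverts T \<subseteq> S"
proof
  fix j assume "j \<in> pverts T"
  then show "j \<in> S"
  proof (induction "length (path_to j)" arbitrary: j rule: less_induct)
    case less
    have rp: "root_path j (path_to j)" using path_to less.prems .
    then obtain p where p: "path_to j = p @ [j]"
      using root_path_nonempty unfolding root_path_def by (metis append_butlast_last_id)
    show ?case
    proof (cases "p = []")
      case True
      then have "j = rt" using rp p by (simp add: root_path_def)
      then show ?thesis using assms(1) by simp
    next
      case False
      let ?i = "last p"
      have i: "root_path ?i p" using root_path_prefix[of j p "[j]"] rp p False by simp
      then have path: "path_to ?i = p" and node: "?i \<in> pverts T"
        using path_to_eq root_path_node by blast+
      have "?i \<in> S" using less.hyps[of ?i] path node p by simp
      moreover have "j \<in> children T rt ?i"
        using rp p path node children_iff by simp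
      ultimately show ?thesis using step node by blast
    qed
  qed
qed

locale rooted_decomposition = rooted_tree T rt for T :: "'i pair_pre_digraph" and rt +
  fixes G :: "'v pair_pre_digraph" and X :: "'i \<Rightarrow> 'v set"
  assumes decomposition: "tree_decomposition G T X"
begin

definition below :: "'i \<Rightarrow> 'v set" where
  "below i = (\<Union>j \<in> subtree i. X j)"

lemma subtree_nodes: "subtree i \<subseteq> pverts T"
  by (auto simp: subtree_def)

lemma bag_verts: "i \<in> pverts T \<Longrightarrow> X i \<subseteq> pverts G"
  using decomposition by (simp add: tree_decomposition_def)

lemma below_unfold: "i \<in> pverts T \<Longrightarrow> below i = X i \<union> (\<Union>c \<in> children T rt i. below c)"
  unfolding below_def by (subst subtree_children) auto

lemma below_root: "below rt = pverts G"
  unfolding below_def subtree_root using decomposition by (auto simp: tree_decomposition_def)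

text \<open>The nodes whose bags contain \<open>v\<close> are connected, and the only way out of the
  subtree is the arc from \<open>c\<close> to \<open>i\<close>.\<close>

lemma bag_crosses:
  assumes "a \<in> subtree c" "v \<in> X a" "b \<in> pverts T" "b \<notin> subtree c" "v \<in> X b" "c \<in> children T rt i"
  shows "v \<in> X c \<and> v \<in> X i"
proof -
  have "a \<in> pverts T" using assms(1) subtree_nodes by blast
  then have "v \<in> pverts G" using assms(2) bag_verts by blast
  then have "Digraph_Component.connected (with_proj T \<restriction> {i \<in> pverts T. v \<in> X i})"
    using decomposition by (simp add: tree_decomposition_def)
  then show ?thesis
    using connected_meets_boundary[of "{i \<in> pverts T. v \<in> X i}" a b c i] assms \<open>a \<in> pverts T\<close> by auto
qed

lemma bag_inter_below: "c \<in> children T rt i \<Longrightarrow> X i \<inter> below c \<subseteq> X c"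
  using bag_crosses[of _ c _ i i] children_nodes parent_notin_subtree unfolding below_def by blast

lemma below_inter_below:
  assumes "c \<in> children T rt i" "d \<in> children T rt i" "c \<noteq> d"
  shows "below c \<inter> below d \<subseteq> X i"
proof
  fix v assume "v \<in> below c \<inter> below d"
  then obtain a b where "a \<in> subtree c" "v \<in> X a" "b \<in> subtree d" "v \<in> X b"
    by (auto simp: below_def)
  then show "v \<in> X i"
    using bag_crosses[of a c v b i] assms subtree_disjoint[OF assms] subtree_nodes by blast
qed

text \<open>Some bag contains both ends. As \<open>u\<close> is not in \<open>X i\<close>, all bags
  containing \<open>u\<close> lie in the subtree of \<open>c\<close>, that bag included.\<close>

lemma edge_below:
  assumes "(u, v) \<in> parcs G" "u \<in> below c" "u \<notin> X i" "c \<in> children T rt i"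
  shows "v \<in> below c"
proof -
  obtain l where l: "l \<in> pverts T" "u \<in> X l" "v \<in> X l"
    using decomposition assms(1) by (fastforce simp: tree_decomposition_def)
  obtain a where "a \<in> subtree c" "u \<in> X a"
    using assms(2) by (auto simp: below_def)
  then have "l \<in> subtree c"
    using bag_crosses[of a c u l i] l assms by blast
  then show ?thesis using l by (auto simp: below_def)
qed

end

section \<open>Number of arcs, subgraph containment, blocks of the input\<close>

lemma finite_pverts: "pair_graph G \<Longrightarrow> finite (pverts G)"
  and parcs_pverts: "pair_graph G \<Longrightarrow> parcs G \<subseteq> pverts G \<times> pverts G"
  and parcs_sym: "pair_graph G \<Longrightarrow> (u, v) \<in> parcs G \<Longrightarrow> (v, u) \<in> parcs G"
  and parcs_irrefl: "pair_graph G \<Longrightarrow> (u, u) \<notin> parcs G"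
proof -
  assume "pair_graph G"
  then interpret pair_graph G .
  show "finite (pverts G)" by (rule pair_finite_verts)
  show "parcs G \<subseteq> pverts G \<times> pverts G"
    using arc_fst_in_verts arc_snd_in_verts by fastforce
  show "(u, v) \<in> parcs G \<Longrightarrow> (v, u) \<in> parcs G"
    using pair_sym_arcs by (auto simp: symmetric_def sym_def)
  show "(u, u) \<notin> parcs G" using pair_no_loops by fastforce
qed

text \<open>Every arc is a pair from some bag. This keeps the cost of reading the adjacency lists
  linear in the number of nodes, up to a factor that depends on the width.\<close>

lemma card_parcs_le:
  assumes td: "tree_decomposition G T X" and G: "pair_graph G" and B: "\<And>i. i \<in> pverts T \<Longrightarrow> card (X i) \<le> B"
  shows "card (parcs G) \<le> card (pverts T) * (B * B)"
proof -
  have T: "finite (pverts T)"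
    using td finite_pverts by (auto simp: tree_decomposition_def undirected_tree_def)
  have fin: "finite (X i)" if "i \<in> pverts T" for i
    using td that finite_pverts[OF G] by (auto simp: tree_decomposition_def intro: finite_subset)
  have "parcs G \<subseteq> (\<Union>i \<in> pverts T. X i \<times> X i)"
    using td by (fastforce simp: tree_decomposition_def)
  then have "card (parcs G) \<le> card (\<Union>i \<in> pverts T. X i \<times> X i)"
    using T fin by (intro card_mono) auto
  also have "\<dots> \<le> (\<Sum>i \<in> pverts T. card (X i \<times> X i))"
    by (rule card_UN_le[OF T])
  also have "\<dots> \<le> (\<Sum>i \<in> pverts T. B * B)"
    using B by (intro sum_mono) (simp add: card_cartesian_product mult_le_mono)
  finally show ?thesis by simp
qed

text \<open>A \<open>digraph_iso\<close> maps arcs separately from vertices. Compatibility with a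
  graph whose arcs are pairs forces each arc to follow its ends, so only a vertex map
  remains.\<close>

lemma contains_subgraph_iff:
  assumes G: "pair_graph G" and H: "pair_graph H" and A: "A \<subseteq> pverts G"
    and e: "bij_betw e {..<r} (pverts H)"
  shows "contains_subgraph (with_proj G \<restriction> A) (with_proj H) \<longleftrightarrow>
    (\<exists>f. inj_on f {..<r} \<and> f ` {..<r} \<subseteq> A \<and>
      (\<forall>h < r. \<forall>h' < r. (e h, e h') \<in> parcs H \<longrightarrow> (f h, f h') \<in> parcs G))"
proof
  assume "contains_subgraph (with_proj G \<restriction> A) (with_proj H)"
  then obtain S where S: "subgraph S (with_proj G \<restriction> A)" "digraph_iso (with_proj H) S"
    unfolding contains_subgraph_def by blast
  obtain iso where iso: "pre_digraph.digraph_isomorphism (with_proj H) iso" "S = app_iso iso (with_proj H)"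
    using S(2) unfolding digraph_iso_def by blast
  let ?g = "iso_verts iso"
  have inj: "inj_on ?g (pverts H)"
    using iso(1) by (simp add: pre_digraph.digraph_isomorphism_def)
  have verts: "?g ` pverts H \<subseteq> A"
    using S(1) iso(2) by (simp add: subgraph_def)
  have arcs: "(?g u, ?g v) \<in> parcs G" if "(u, v) \<in> parcs H" for u v
  proof -
    have "iso_arcs iso (u, v) \<in> parcs G"
      using S(1) iso(2) that by (auto simp: subgraph_def)
    moreover have "iso_tail iso = fst" "iso_head iso = snd"
      using S(1) iso(2) by (auto simp: subgraph_def compatible_def)
    then have "iso_arcs iso (u, v) = (?g u, ?g v)"
      using iso(1) that by (auto simp: pre_digraph.digraph_isomorphism_def prod_eq_iff)
    ultimately show ?thesis by simp
  qed
  have "inj_on (?g \<circ> e) {..<r}"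
    using e inj by (auto simp: bij_betw_def intro: comp_inj_on)
  moreover have "(?g \<circ> e) ` {..<r} \<subseteq> A"
    using e verts by (auto simp: bij_betw_def)
  ultimately show "\<exists>f. inj_on f {..<r} \<and> f ` {..<r} \<subseteq> A \<and>
      (\<forall>h < r. \<forall>h' < r. (e h, e h') \<in> parcs H \<longrightarrow> (f h, f h') \<in> parcs G)"
    using arcs by (intro exI[of _ "?g \<circ> e"]) simp
next
  assume "\<exists>f. inj_on f {..<r} \<and> f ` {..<r} \<subseteq> A \<and>
      (\<forall>h < r. \<forall>h' < r. (e h, e h') \<in> parcs H \<longrightarrow> (f h, f h') \<in> parcs G)"
  then obtain f where f: "inj_on f {..<r}" "f ` {..<r} \<subseteq> A"
      "\<And>h h'. h < r \<Longrightarrow> h' < r \<Longrightarrow> (e h, e h') \<in> parcs H \<Longrightarrow> (f h, f h') \<in> parcs G"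
    by blast
  define g where "g = f \<circ> the_inv_into {..<r} e"
  have inv: "bij_betw (the_inv_into {..<r} e) (pverts H) {..<r}"
    using e by (rule bij_betw_the_inv_into)
  have e_inv: "e (the_inv_into {..<r} e u) = u" if "u \<in> pverts H" for u
    using e that by (auto simp: bij_betw_def f_the_inv_into_f)
  have g_inj: "inj_on g (pverts H)"
    unfolding g_def using inv f(1) by (auto simp: bij_betw_def intro: comp_inj_on)
  have g_A: "g ` pverts H \<subseteq> A"
    unfolding g_def using inv f(2) by (auto simp: bij_betw_def)
  have g_arcs: "(g u, g v) \<in> parcs G" if "(u, v) \<in> parcs H" for u v
  proof -
    have uv: "u \<in> pverts H" "v \<in> pverts H" using parcs_pverts[OF H] that by auto
    then have "the_inv_into {..<r} e u < r" "the_inv_into {..<r} e v < r"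
      using inv by (auto simp: bij_betw_def)
    then show ?thesis
      unfolding g_def using f(3) e_inv uv that by simp
  qed
  define iso where "iso = \<lparr>iso_verts = g, iso_arcs = map_prod g g, iso_head = snd, iso_tail = fst\<rparr>"
  have wfG: "wf_digraph (with_proj G)" and wfH: "wf_digraph (with_proj H)"
    using G H by (simp_all add: wf_digraph_wp_iff pair_graph_def pair_digraph_def pair_fin_digraph_def)
  have iso: "pre_digraph.digraph_isomorphism (with_proj H) iso"
    unfolding pre_digraph.digraph_isomorphism_def
    using wfH g_inj inj_on_subset[OF map_prod_inj_on[OF g_inj g_inj] parcs_pverts[OF H]]
    by (auto simp: iso_def)
  have "subgraph (app_iso iso (with_proj H)) (with_proj G \<restriction> A)"
    unfolding subgraph_def
  proof (intro conjI)
    show "wf_digraph (with_proj G \<restriction> A)"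
      using wfG by (rule wf_digraph.wellformed_induce_subgraph)
    show "wf_digraph (app_iso iso (with_proj H))"
      using parcs_pverts[OF H] by unfold_locales (auto simp: iso_def)
    show "compatible (with_proj G \<restriction> A) (app_iso iso (with_proj H))"
      by (auto simp: compatible_def iso_def)
    show "verts (app_iso iso (with_proj H)) \<subseteq> verts (with_proj G \<restriction> A)"
      using g_A by (auto simp: iso_def)
    show "arcs (app_iso iso (with_proj H)) \<subseteq> arcs (with_proj G \<restriction> A)"
      using g_A g_arcs parcs_pverts[OF H] by (fastforce simp: iso_def)
  qed
  then show "contains_subgraph (with_proj G \<restriction> A) (with_proj H)"
    unfolding contains_subgraph_def digraph_iso_def using iso by blast
qed

lemma stores_sets_block:
  assumes "stores_sets s off dat k S" "i < k"
  shows "cell s off (Suc i) - cell s off i = card (S i)"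
    and "inj_on (\<lambda>p. cell s dat (cell s off i + p)) {..<card (S i)}"
    and "(\<lambda>p. cell s dat (cell s off i + p)) ` {..<card (S i)} = S i"
proof -
  have off: "cell s off (Suc i) = cell s off i + card (S i)"
    and bij: "bij_betw (cell s dat) {cell s off i..<cell s off (Suc i)} (S i)"
    using assms unfolding stores_sets_def Suc_eq_plus1 by blast+
  show "cell s off (Suc i) - cell s off i = card (S i)" using off by simp
  have "bij_betw (\<lambda>p. cell s off i + p) {..<card (S i)} {cell s off i..<cell s off (Suc i)}"
    using off by (intro bij_betw_byWitness[where f' = "\<lambda>x. x - cell s off i"]) auto
  from bij_betw_trans[OF this bij]
  show "inj_on (\<lambda>p. cell s dat (cell s off i + p)) {..<card (S i)}"
    "(\<lambda>p. cell s dat (cell s off i + p)) ` {..<card (S i)} = S i"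
    by (simp_all add: bij_betw_def comp_def)
qed

text \<open>Real children occupy distinct entries of a block without repetitions, so the two kids
  coincide only when both are the dummy \<open>m\<close>.\<close>

lemma kids_of_children:
  assumes "stores_sets s ''child_off'' ''child'' m ch" "i < m" "card (ch i) \<le> 2" "reg s ''m'' = m"
    "ch i \<subseteq> {..<m}"
  shows "kid s 0 i = m \<or> kid s 0 i \<in> ch i" "kid s 1 i = m \<or> kid s 1 i \<in> ch i"
    "ch i \<subseteq> {kid s 0 i, kid s 1 i}" "kid s 0 i = kid s 1 i \<Longrightarrow> kid s 0 i = m"
proof -
  note b = stores_sets_block[OF assms(1,2)]
  let ?f = "\<lambda>p. cell s ''child'' (cell s ''child_off'' i + p)"
  have kid: "kid s k i = (if k < card (ch i) then ?f k else m)" for k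
    using b(1) assms(4) by (simp add: kid_def)
  have in_ch: "?f k \<in> ch i" if "k < card (ch i)" for k
    using b(3) that by blast
  show "kid s 0 i = m \<or> kid s 0 i \<in> ch i" "kid s 1 i = m \<or> kid s 1 i \<in> ch i"
    using in_ch[of 0] in_ch[of 1] unfolding kid by auto
  consider "card (ch i) = 0" | "card (ch i) = 1" | "card (ch i) = 2"
    using assms(3) by linarith
  then have "ch i \<subseteq> {kid s 0 i, kid s 1 i} \<and> (kid s 0 i = kid s 1 i \<longrightarrow> kid s 0 i = m)"
  proof cases
    case 1
    then show ?thesis using b(3) by (simp add: kid)
  next
    case 2
    then have "ch i = {?f 0}" using b(3) by (simp add: lessThan_Suc)
    then have "?f 0 \<noteq> m" using assms(5) by auto
    then show ?thesis using \<open>ch i = {?f 0}\<close> 2 by (simp add: kid)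
  next
    case 3
    then have "{..<card (ch i)} = {0, 1}" by auto
    then have "ch i = {?f 0, ?f 1}" "?f 0 \<noteq> ?f 1" using b(2,3) by auto
    then show ?thesis using 3 by (simp add: kid)
  qed
  then show "ch i \<subseteq> {kid s 0 i, kid s 1 i}" "kid s 0 i = kid s 1 i \<Longrightarrow> kid s 0 i = m" by auto
qed

section \<open>Correctness and running time\<close>

definition partition_prog :: "nat \<Rightarrow> (nat \<times> nat) list \<Rightarrow> com" where
  "partition_prog r es = Seq (prep_phase r) (Seq mat_phase (Seq bfs_phase
    (Seq (dp_phase r es) (set_reg ''out'' (final_fx r)))))"

definition run_time :: "nat \<Rightarrow> (nat \<times> nat) list \<Rightarrow> nat \<Rightarrow> nat \<Rightarrow> nat \<Rightarrow> nat \<Rightarrow> nat" where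
  "run_time r es n m a Q =
     ((kc bag_max_fx + 6) * m + 4 * kc pow_fx * Q ^ dp pow_fx + 30) +
     ((40 * (n + a) + 10) + ((70 * m + 20) +
     ((m * (Q * (dp_const r es * Q ^ dp_degree r es + 4) + 30) + 10) +
      (kc (final_fx r) * Q ^ dp (final_fx r) + 2))))"

lemma not_wregs_compile: "x \<notin> range slot \<Longrightarrow> x \<notin> wregs (compile e vs d)"
  using wregs_compile by blast

lemma wregs_prep: "x \<notin> {''B'', ''L'', ''N''} \<Longrightarrow> x \<notin> range slot \<Longrightarrow> x \<notin> wregs (prep_phase r)"
  by (auto simp: prep_phase_def set_reg_def not_wregs_compile simp del: compile.simps)

lemma warrs_prep: "warrs (prep_phase r) = {}"
  by (simp add: prep_phase_def set_reg_def warrs_compile)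

lemma wregs_mat: "wregs mat_phase = {''u'', ''j'', ''base''}"
  and warrs_mat: "warrs mat_phase = {''row'', ''mat''}"
  by (auto simp: mat_phase_def mat_body_def mat_inner_def)

lemma wregs_bfs: "wregs bfs_phase = {''tail'', ''i'', ''j'', ''h''}"
  and warrs_bfs: "warrs bfs_phase = {''q''}"
  by (auto simp: bfs_phase_def bfs_body_def bfs_inner_def)

lemma stores_sets_cong:
  "cell s' off = cell s off \<Longrightarrow> cell s' dat = cell s dat \<Longrightarrow>
    stores_sets s off dat k S \<longleftrightarrow> stores_sets s' off dat k S"
  by (simp add: stores_sets_def)

lemma card_children_le:
  assumes "nice_tree_decomposition G T rt X" "i \<in> pverts T"
  shows "card (children T rt i) \<le> 2"
  using assms unfolding nice_tree_decomposition_def leaf_node_def introduce_node_def forget_node_def join_node_def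
  by (fastforce simp: card_insert_if)

text \<open>\<open>B\<close> is only bracketed: at least every bag size, for the count of arcs, and
  at most 2 more than any bound on the bags, for the exponent of the running time.\<close>

lemma program_correct:
  fixes T :: "nat pair_pre_digraph"
  assumes r: "1 \<le> r" and G: "pair_graph G" and H: "pair_graph H"
    and e: "bij_betw e {..<r} (pverts H)"
    and es: "set es = {(h, h'). h < r \<and> h' < r \<and> (e h, e h') \<in> parcs H}"
    and nice: "nice_tree_decomposition G T rt X"
    and init: "initial_state G T rt X s"
  shows "\<exists>B Q. (\<forall>i \<in> pverts T. card (X i) \<le> B) \<and> 2 \<le> B \<and>
    (\<forall>W. (\<forall>i \<in> pverts T. card (X i) \<le> W) \<longrightarrow> B \<le> W + 2) \<and> Q = 2 ^ (2 * B ^ r) \<and>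
    tri (partition_prog r es) s (run_time r es (card (pverts G)) (card (pverts T)) (card (parcs G)) Q)
      (\<lambda>s'. reg s' ''out'' = (if has_free_bipartition G H then 1 else 0))"
proof -
  let ?n = "reg s ''n''" and ?m = "reg s ''m''" and ?ch = "children T rt"
  have td: "tree_decomposition G T X" and rt: "rt \<in> pverts T"
    using nice by (simp_all add: nice_tree_decomposition_def)
  interpret D: rooted_decomposition T rt G X
    using td rt by unfold_locales (simp_all add: tree_decomposition_def)
  have vG: "pverts G = {..<?n}" and vT: "pverts T = {..<?m}" and root: "reg s ''root'' = rt"
    and adj: "stores_sets s ''adj_off'' ''adj'' ?n (\<lambda>u. {v. (u, v) \<in> parcs G})"
    and bags: "stores_sets s ''bag_off'' ''bag'' ?m X"
    and chs: "stores_sets s ''child_off'' ''child'' ?m ?ch"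
    and reg0: "\<And>x. x \<notin> {''n'', ''m'', ''root''} \<Longrightarrow> reg s x = 0"
    and cell0: "\<And>a. a \<notin> {''adj_off'', ''adj'', ''bag_off'', ''bag'', ''child_off'', ''child''} \<Longrightarrow>
        cell s a = (\<lambda>_. 0)"
    using init unfolding initial_state_def by simp_all
  have m1: "1 \<le> ?m" using rt vT by auto
  have ch_nodes: "?ch i \<subseteq> {..<?m}" for i
    using D.children_nodes vT by blast
  have size: "bag_size s i = card (X i)" if "i < ?m" for i
    using stores_sets_block(1)[OF bags that] that by (simp add: bag_size_def)
  have size_m: "bag_size s i = 0" if "\<not> i < ?m" for i
    using that by (simp add: bag_size_def)
  obtain B where B: "\<And>i. bag_size s i + 2 \<le> B"
      "\<And>W. (\<forall>i < ?m. bag_size s i \<le> W) \<Longrightarrow> B \<le> W + 2"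
    and prep: "tri (prep_phase r) s ((kc bag_max_fx + 6) * ?m + 4 * kc pow_fx * (2 ^ (2 * B ^ r)) ^ (dp pow_fx) + 30)
      (\<lambda>s'. reg s' ''B'' = B \<and> reg s' ''L'' = B ^ r \<and> reg s' ''N'' = 2 ^ (2 * B ^ r))"
    using prep_phase_correct[OF m1 r] by blast
  let ?Q = "2 ^ (2 * B ^ r) :: nat"
  define hadj where "hadj = (\<lambda>h h'. h < r \<and> h' < r \<and> (e h, e h') \<in> parcs H)"
  define bl where "bl = (\<lambda>j p. cell s ''bag'' (cell s ''bag_off'' j + p))"
  \<comment> \<open>Nothing lies below the dummy child \<open>m\<close>.\<close>
  define V where "V = (\<lambda>j. if j < ?m then D.below j else {})"
  interpret S: states r B hadj "parcs G" bl "bag_size s" V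
    using r parcs_sym[OF H] parcs_irrefl[OF H] parcs_sym[OF G]
    by unfold_locales (auto simp: hadj_def)
  have bag: "S.bag i = X i" if "i < ?m" for i
    using stores_sets_block(3)[OF bags that] size[OF that] unfolding S.bag_def by (simp add: bl_def)
  have bag_m: "S.bag i = {}" if "\<not> i < ?m" for i
    using size_m[OF that] by (simp add: S.bag_def)
  have unfold: "D.below i = X i \<union> (\<Union>c \<in> ?ch i. D.below c)" if "i < ?m" for i
    using D.below_unfold[of i] that vT by auto
  have node: "S.node i" for i
  proof (cases "i < ?m")
    case True
    then show ?thesis
      using B(1)[of i] stores_sets_block(2)[OF bags True] size[OF True] unfold[OF True] bag[OF True]
      unfolding S.node_def by (auto simp: bl_def V_def)
  next
    case False
    then show ?thesis
      using B(1)[of i] size_m bag_m by (simp add: S.node_def)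
  qed
  have hadj_all: "(\<forall>h < r. \<forall>h' < r. hadj h h' \<longrightarrow> P h h') \<longleftrightarrow>
      (\<forall>h < r. \<forall>h' < r. (e h, e h') \<in> parcs H \<longrightarrow> P h h')" for P
    by (auto simp: hadj_def)
  have full: "S.full_emb A \<longleftrightarrow> contains_subgraph (with_proj G \<restriction> A) (with_proj H)" if "A \<subseteq> pverts G" for A
    unfolding contains_subgraph_iff[OF G H that e] S.full_emb_def hadj_all ..
  have V_rt: "V rt = pverts G"
    using D.below_root rt vT by (simp add: V_def)
  have answer: "(\<exists>c. S.feas rt c \<and> S.accepting c) \<longleftrightarrow> has_free_bipartition G H"
    unfolding S.accepting_iff[OF node] has_free_bipartition_def V_rt
  proof (intro iff_exI conj_cong refl)
    fix A B assume AB: "A \<union> B = pverts G"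
    show "(\<not> S.full_emb A) = (\<not> contains_subgraph (with_proj G \<restriction> A) (with_proj H))"
      "(\<not> S.full_emb B) = (\<not> contains_subgraph (with_proj G \<restriction> B) (with_proj H))"
      using full[of A] full[of B] AB by auto
  qed
  have kids: "kid s 0 i = ?m \<or> kid s 0 i \<in> ?ch i" "kid s 1 i = ?m \<or> kid s 1 i \<in> ?ch i"
    "?ch i \<subseteq> {kid s 0 i, kid s 1 i}" "kid s 0 i = kid s 1 i \<Longrightarrow> kid s 0 i = ?m" if "i < ?m" for i
    using kids_of_children[OF chs that card_children_le[OF nice] refl ch_nodes] that vT by auto
  have split: "S.split_node i (kid s 0 i) (kid s 1 i)" if i: "i < ?m" for i
  proof -
    \<comment> \<open>A kid with a non-empty part is not the dummy, hence a genuine child of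
      \<open>i\<close>.\<close>
    have child: "kid s k i \<in> ?ch i \<and> kid s k i < ?m \<and> V (kid s k i) = D.below (kid s k i)"
      if "V (kid s k i) \<noteq> {}" "k < 2" for k
    proof -
      have "kid s k i \<noteq> ?m" using that by (auto simp: V_def)
      then have "kid s k i \<in> ?ch i" using kids(1,2)[OF i] that(2) by (auto simp: S.less_2_iff)
      then show ?thesis using ch_nodes by (auto simp: V_def)
    qed
    have bag_sub: "S.bag i \<inter> V (kid s k i) \<subseteq> S.bag (kid s k i)" if "k < 2" for k
      using child[of k] D.bag_inter_below[of "kid s k i" i] bag[OF i] bag[of "kid s k i"] that by blast
    have edge: "v \<in> V (kid s k i)" if "(u, v) \<in> parcs G" "u \<notin> S.bag i" "u \<in> V (kid s k i)" "k < 2" for u v k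
      using child[of k] D.edge_below[of u v "kid s k i" i] bag[OF i] that by blast
    have "V i = S.bag i \<union> V (kid s 0 i) \<union> V (kid s 1 i)"
    proof
      show "V i \<subseteq> S.bag i \<union> V (kid s 0 i) \<union> V (kid s 1 i)"
      proof
        fix v assume "v \<in> V i"
        then have "v \<in> X i \<or> (\<exists>c \<in> ?ch i. v \<in> D.below c)"
          using i unfold[OF i] by (auto simp: V_def)
        moreover have "D.below c \<subseteq> V (kid s 0 i) \<union> V (kid s 1 i)" if "c \<in> ?ch i" for c
          using kids(3)[OF i] that ch_nodes by (auto simp: V_def)
        ultimately show "v \<in> S.bag i \<union> V (kid s 0 i) \<union> V (kid s 1 i)"
          using bag[OF i] by blast
      qed
      show "S.bag i \<union> V (kid s 0 i) \<union> V (kid s 1 i) \<subseteq> V i"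
      proof -
        have "V (kid s k i) \<subseteq> D.below i" if "k < 2" for k
          using child[of k] unfold[OF i] that by blast
        from this[of 0] this[of 1] have "V (kid s 0 i) \<union> V (kid s 1 i) \<subseteq> D.below i" by simp
        moreover have "V i = D.below i" using i by (simp add: V_def)
        ultimately show ?thesis using unfold[OF i] bag[OF i] by blast
      qed
    qed
    moreover have "V (kid s 0 i) \<inter> V (kid s 1 i) \<subseteq> S.bag i"
    proof (cases "V (kid s 0 i) = {} \<or> V (kid s 1 i) = {}")
      case False
      then have c: "kid s 0 i \<in> ?ch i" "kid s 1 i \<in> ?ch i" "kid s 0 i < ?m"
        "V (kid s 0 i) = D.below (kid s 0 i)" "V (kid s 1 i) = D.below (kid s 1 i)"
        using child[of 0] child[of 1] by auto
      then have "kid s 0 i \<noteq> kid s 1 i" using kids(4)[OF i] by auto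
      then show ?thesis using D.below_inter_below[OF c(1,2)] c bag[OF i] by simp
    qed auto
    ultimately show ?thesis
      using node bag_sub[of 0] bag_sub[of 1] edge[of _ _ 0] edge[of _ _ 1]
      unfolding S.split_node_def by auto
  qed
  \<comment> \<open>\<open>R\<close> and \<open>A\<close> list what may have changed so far.
    Everything else still holds its input value, in particular the zeros from which later phases
    start.\<close>
  define frame where "frame = (\<lambda>R A (s' :: ram_state). (\<forall>x. x \<notin> R \<longrightarrow> x \<notin> range slot \<longrightarrow> reg s' x = reg s x) \<and>
    (\<forall>a. a \<notin> A \<longrightarrow> cell s' a = cell s a))"
  let ?frame1 = "frame {''B'', ''L'', ''N''} {}" and ?frame2 = "frame {''B'', ''L'', ''N'', ''u'', ''j'', ''base''} {''row'', ''mat''}"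
    and ?frame3 = "frame {''B'', ''L'', ''N'', ''u'', ''j'', ''base'', ''tail'', ''i'', ''h''} {''row'', ''mat'', ''q''}"
  define params where "params = (\<lambda>s' :: ram_state. reg s' ''B'' = B \<and> reg s' ''L'' = B ^ r \<and> reg s' ''N'' = ?Q)"
  define matrix where "matrix = (\<lambda>s' :: ram_state. \<forall>u < ?n. \<forall>v < ?n.
    cell s' ''mat'' (cell s' ''row'' u + v) \<noteq> 0 \<longleftrightarrow> (u, v) \<in> parcs G)"
  have P1: "tri (prep_phase r) s ((kc bag_max_fx + 6) * ?m + 4 * kc pow_fx * ?Q ^ dp pow_fx + 30)
      (\<lambda>s'. ?frame1 s' \<and> params s')"
    by (rule tri_frame[OF prep]) (use wregs_prep warrs_prep in \<open>auto simp: frame_def params_def\<close>)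
  have P2: "tri mat_phase s1 (40 * (?n + card (parcs G)) + 10)
      (\<lambda>s'. ?frame2 s' \<and> params s' \<and> matrix s')"
    if s1: "?frame1 s1 \<and> params s1" for s1
  proof (rule tri_frame[OF mat_phase_correct[of s1 ?n "parcs G"]])
    show "reg s1 ''n'' = ?n" "reg s1 ''u'' = 0" "reg s1 ''base'' = 0" "cell s1 ''mat'' = (\<lambda>_. 0)"
      using s1 reg0 cell0 by (auto simp: frame_def)
    show "stores_sets s1 ''adj_off'' ''adj'' ?n (\<lambda>u. {v. (u, v) \<in> parcs G})"
      using adj s1 stores_sets_cong[of s1 "''adj_off''" s "''adj''"] by (simp add: frame_def)
    show "parcs G \<subseteq> {..<?n} \<times> {..<?n}"
      using parcs_pverts[OF G] vG by simp
  qed (use s1 in \<open>auto simp: wregs_mat warrs_mat frame_def params_def matrix_def\<close>)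
  have P3: "tri bfs_phase s2 (70 * ?m + 20)
      (\<lambda>s'. ?frame3 s' \<and> params s' \<and> matrix s' \<and> bfs_order (cell s' ''q'') ?m ?ch)"
    if s2: "?frame2 s2 \<and> params s2 \<and> matrix s2" for s2
  proof (rule tri_frame[OF bfs_phase_correct[of s2 ?m rt ?ch]])
    show "reg s2 ''m'' = ?m" "reg s2 ''h'' = 0" "reg s2 ''root'' = rt"
      using s2 reg0 root by (auto simp: frame_def)
    show "stores_sets s2 ''child_off'' ''child'' ?m ?ch"
      using chs s2 stores_sets_cong[of s2 "''child_off''" s "''child''"] by (simp add: frame_def)
    show "rt < ?m" using rt vT by simp
    show "?ch i \<subseteq> {..<?m}" for i by (rule ch_nodes)
    show "card (?ch i) \<le> 2" if "i < ?m" for i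
      using card_children_le[OF nice, of i] that vT by simp
    show "i = i'" if "c \<in> ?ch i" "c \<in> ?ch i'" for i i' c
      using D.unique_parent that .
    show "rt \<notin> ?ch i" for i by (rule D.root_not_child)
    show "{..<?m} \<subseteq> S" if "rt \<in> S" "\<And>i. i < ?m \<Longrightarrow> i \<in> S \<Longrightarrow> ?ch i \<subseteq> S" for S
      using D.reach_all[of S] that vT by auto
  qed (use s2 in \<open>auto simp: wregs_bfs warrs_bfs frame_def params_def matrix_def\<close>)
  have P45: "tri (Seq (dp_phase r es) (set_reg ''out'' (final_fx r))) s3
      ((?m * (?Q * (dp_const r es * ?Q ^ dp_degree r es + 4) + 30) + 10) +
        (kc (final_fx r) * ?Q ^ dp (final_fx r) + 2))
      (\<lambda>s'. reg s' ''out'' = (if has_free_bipartition G H then 1 else 0))"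
    if s3: "?frame3 s3 \<and> params s3 \<and> matrix s3 \<and> bfs_order (cell s3 ''q'') ?m ?ch" for s3
  proof -
    have s3': "reg s3 ''n'' = ?n" "reg s3 ''m'' = ?m" "reg s3 ''k'' = 0" "reg s3 ''root'' = rt"
      "kid s3 k i = kid s k i" for k i
      using s3 reg0 root by (auto simp: frame_def kid_def)
    have B2: "2 \<le> B" using B(1)[of 0] by simp
    interpret S3: dp_state r B hadj "parcs G" bl "bag_size s" V s3 es ?Q
    proof
      show "(u, v) \<in> parcs G \<longleftrightarrow>
          u < reg s3 ''n'' \<and> v < reg s3 ''n'' \<and> cell s3 ''mat'' (cell s3 ''row'' u + v) \<noteq> 0" for u v
        using s3 s3' parcs_pverts[OF G] vG by (auto simp: matrix_def)
      show "bl j p = cell s3 ''bag'' (cell s3 ''bag_off'' j + p)" for j p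
        using s3 by (simp add: bl_def frame_def)
      show "bag_size s j = (if j < reg s3 ''m'' then cell s3 ''bag_off'' (j + 1) - cell s3 ''bag_off'' j else 0)" for j
        using s3 s3' by (simp add: bag_size_def frame_def)
    qed (use s3 B2 B(1) es in \<open>auto simp: params_def S.L_def hadj_def\<close>)
    have dp: "tri (dp_phase r es) s3 (?m * (?Q * (dp_const r es * ?Q ^ dp_degree r es + 4) + 30) + 10)
        (\<lambda>s'. (\<forall>i \<le> ?m. \<forall>c < 2 ^ (2 * S.L). tab_at s' i c \<longleftrightarrow> S.feas i c) \<and> same_data s3 s')"
    proof (rule S3.dp_phase_correct)
      show "bfs_order (cell s3 ''q'') ?m ?ch" using s3 by simp
      show "kid s3 k i = ?m \<or> kid s3 k i \<in> ?ch i" if "i < ?m" "k < 2" for i k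
        using kids(1,2)[OF that(1)] that(2) s3' by (auto simp: S.less_2_iff)
      show "S.split_node i (kid s3 0 i) (kid s3 1 i)" if "i < ?m" for i
        using split[OF that] s3' by simp
      show "V ?m = {}" by (simp add: V_def)
    qed (simp_all add: s3' S.L_def)
    show ?thesis
    proof (rule tri_Seq[OF tri_mono[OF dp le_refl]], elim conjE)
      fix s4 assume tab: "\<forall>i \<le> ?m. \<forall>c < 2 ^ (2 * S.L). tab_at s4 i c \<longleftrightarrow> S.feas i c"
        and same: "same_data s3 s4"
      interpret S4: dp_state r B hadj "parcs G" bl "bag_size s" V s4 es ?Q
        using same by (rule S3.dp_state_same_data)
      have "reg s4 ''root'' = rt"
        using same s3' by (simp add: same_data_def)
      moreover have "rt \<le> ?m" using rt vT by simp
      moreover have "c < 2 ^ (2 * S.L)" if "S.feas i c" for i c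
        using that by (auto simp: S.feas_def S.realises_def)
      ultimately have "fval (final_fx r) s4 [] = of_bool (has_free_bipartition G H)"
        unfolding S4.fval_final answer[symmetric] using tab by (metis (no_types, lifting))
      then show "tri (set_reg ''out'' (final_fx r)) s4 (kc (final_fx r) * ?Q ^ dp (final_fx r) + 2)
          (\<lambda>s'. reg s' ''out'' = (if has_free_bipartition G H then 1 else 0))"
        by (intro tri_mono[OF tri_set_reg[OF S4.ok_final]]) auto
    qed
  qed
  have "tri (partition_prog r es) s (run_time r es ?n ?m (card (parcs G)) ?Q)
      (\<lambda>s'. reg s' ''out'' = (if has_free_bipartition G H then 1 else 0))"
    unfolding partition_prog_def run_time_def
    by (rule tri_Seq[OF tri_mono[OF P1 le_refl]], rule tri_Seq[OF tri_mono[OF P2 le_refl]], assumption,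
      rule tri_Seq[OF tri_mono[OF P3 le_refl]], assumption, rule P45, assumption)
  moreover have "card (pverts T) = ?m" "card (pverts G) = ?n" using vT vG by simp_all
  moreover have "\<forall>i \<in> pverts T. card (X i) \<le> B"
  proof
    fix i assume "i \<in> pverts T"
    then show "card (X i) \<le> B" using B(1)[of i] size[of i] vT by simp
  qed
  moreover have "2 \<le> B" using B(1)[of 0] by simp
  moreover have "B \<le> W + 2" if "\<forall>i \<in> pverts T. card (X i) \<le> W" for W
    using B(2)[of W] that size vT by simp
  ultimately show ?thesis
    by (intro exI[of _ B] exI[of _ ?Q]) simp
qed

section \<open>Adding up the running time\<close>

definition total_degree :: "nat \<Rightarrow> (nat \<times> nat) list \<Rightarrow> nat" where
  "total_degree r es = dp pow_fx + dp_degree r es + dp (final_fx r) + 3"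

text \<open>The 262 collects the fixed coefficients in \<open>total_cost\<close>: 6 + 72 + 40 + 40 +
  100 + 4.\<close>

definition total_const :: "nat \<Rightarrow> (nat \<times> nat) list \<Rightarrow> nat" where
  "total_const r es = kc bag_max_fx + 4 * kc pow_fx + dp_const r es + kc (final_fx r) + 262"

lemma total_cost:
  fixes m n R Q :: nat
  assumes Q: "1 \<le> Q" and m: "1 \<le> m" and R: "R \<le> m * (Q * Q)"
  shows "run_time r es n m R Q \<le> total_const r es * ((n + m) * Q ^ total_degree r es)"
proof -
  let ?W = "(n + m) * Q ^ total_degree r es"
  have le: "c * (x * Q ^ d) \<le> c * ?W" if "x \<le> n + m" "d \<le> total_degree r es" for c x d
    using that Q by (intro mult_le_mono2 mult_le_mono power_increasing) auto
  have c1: "(kc bag_max_fx + 6) * m \<le> (kc bag_max_fx + 6) * ?W"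
    using le[of m 0 "kc bag_max_fx + 6"] by simp
  have c2: "4 * kc pow_fx * Q ^ dp pow_fx \<le> (4 * kc pow_fx) * ?W"
    using le[of 1 "dp pow_fx" "4 * kc pow_fx"] m by (simp add: total_degree_def)
  have c3: "72 \<le> 72 * ?W"
    using le[of 1 0 72] m by simp
  have c4: "40 * n \<le> 40 * ?W"
    using le[of n 0 40] by simp
  have c5: "40 * R \<le> 40 * ?W"
  proof -
    have "40 * R \<le> 40 * (m * Q ^ 2)" using R by (simp add: power2_eq_square)
    also have "\<dots> \<le> 40 * ?W" by (rule le) (simp_all add: total_degree_def)
    finally show ?thesis .
  qed
  have c6: "100 * m \<le> 100 * ?W"
    using le[of m 0 100] by simp
  have c7: "dp_const r es * (m * Q ^ (dp_degree r es + 1)) \<le> dp_const r es * ?W"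
    by (rule le) (simp_all add: total_degree_def)
  have c8: "4 * (m * Q ^ 1) \<le> 4 * ?W"
    by (rule le) (simp_all add: total_degree_def)
  have c9: "kc (final_fx r) * Q ^ dp (final_fx r) \<le> kc (final_fx r) * ?W"
    using le[of 1 "dp (final_fx r)" "kc (final_fx r)"] m by (simp add: total_degree_def)
  have "run_time r es n m R Q
    = (kc bag_max_fx + 6) * m + 4 * kc pow_fx * Q ^ dp pow_fx + 72 + 40 * n + 40 * R + 100 * m +
      dp_const r es * (m * Q ^ (dp_degree r es + 1)) + 4 * (m * Q ^ 1) +
      kc (final_fx r) * Q ^ dp (final_fx r)"
    by (simp add: run_time_def algebra_simps)
  also have "\<dots> \<le> (kc bag_max_fx + 6) * ?W + (4 * kc pow_fx) * ?W + 72 * ?W +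
      40 * ?W + 40 * ?W + 100 * ?W + dp_const r es * ?W + 4 * ?W + kc (final_fx r) * ?W"
    by (intro add_mono c1 c2 c3 c4 c5 c6 c7 c8 c9)
  also have "\<dots> = total_const r es * ?W"
    unfolding distrib_right[symmetric] total_const_def by simp
  finally show ?thesis .
qed

text \<open>For \<open>t \<ge> 1\<close> one has \<open>t + 3 \<le> 4 * t\<close>, and
  \<open>t ^ r \<ge> 1\<close> absorbs the constant.\<close>

lemma exponent_bigo:
  fixes c d :: real
  shows "(\<lambda>t. c + d * (real t + 3) ^ r) \<in> O(\<lambda>t. real t ^ r)"
proof (rule bigoI[where c = "\<bar>c\<bar> + \<bar>d\<bar> * 4 ^ r"])
  show "\<forall>\<^sub>F t in at_top. norm (c + d * (real t + 3) ^ r) \<le> (\<bar>c\<bar> + \<bar>d\<bar> * 4 ^ r) * norm (real t ^ r)"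
    using eventually_ge_at_top[of 1]
  proof eventually_elim
    case (elim t)
    have "(real t + 3) ^ r \<le> (4 * real t) ^ r"
      using elim by (intro power_mono) auto
    then have "\<bar>d\<bar> * (real t + 3) ^ r \<le> \<bar>d\<bar> * (4 ^ r * real t ^ r)"
      by (intro mult_left_mono) (auto simp: power_mult_distrib)
    moreover have "\<bar>c\<bar> \<le> \<bar>c\<bar> * real t ^ r"
      using elim by (simp add: mult_le_cancel_left1)
    moreover have "norm (c + d * (real t + 3) ^ r) \<le> \<bar>c\<bar> + \<bar>d\<bar> * (real t + 3) ^ r"
      using abs_triangle_ineq[of c "d * (real t + 3) ^ r"] by (simp add: abs_mult)
    ultimately show ?case
      by (simp add: algebra_simps)
  qed
qed

theorem theorem4:
  fixes H :: "'h pair_pre_digraph" and r :: nat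
  assumes "pair_graph H" and "card (pverts H) = r"
  shows "\<exists>prog. \<forall>K :: real. \<exists>f :: nat \<Rightarrow> real. f \<in> O(\<lambda>t. real t ^ r) \<and>
    (\<forall>(G :: nat pair_pre_digraph) (T :: nat pair_pre_digraph) rt X (t :: nat) (n :: nat) s.
       pair_graph G \<and> card (pverts G) = n \<and> tree_width G \<le> int t \<and>
       nice_tree_decomposition G T rt X \<and> width T X \<le> int t \<and>
       real (card (pverts T)) \<le> K * real n \<and>
       initial_state G T rt X s \<longrightarrow>
       (\<exists>k s'. runs prog s k s' \<and>
          reg s' ''out'' = (if has_free_bipartition G H then 1 else 0) \<and>
          real k \<le> 2 powr f t * real n))"
proof -
  obtain e where e: "bij_betw e {..<r} (pverts H)"
    using ex_bij_betw_nat_finite[OF finite_pverts[OF assms(1)]] assms(2) by (auto simp: atLeast0LessThan)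
  \<comment> \<open>For \<open>n = 0\<close> the time bound would be 0. This case does not arise:
    the tree has a root, so the bound \<open>K * n\<close> on the number of nodes is
    positive.\<close>
  have nodes: "1 \<le> card (pverts T)" "1 \<le> n" "finite (pverts T)"
    if "nice_tree_decomposition G T rt X" "real (card (pverts T)) \<le> K * real n"
    for G T rt n and X :: "nat \<Rightarrow> nat set" and K :: real
  proof -
    have "rt \<in> pverts T" and fin: "finite (pverts T)"
      using that(1) finite_pverts
      by (auto simp: nice_tree_decomposition_def tree_decomposition_def undirected_tree_def)
    then show c: "1 \<le> card (pverts T)" by (metis One_nat_def Suc_leI card_gt_0_iff empty_iff)
    show "finite (pverts T)" by (rule fin)
    show "1 \<le> n" using that(2) c by (cases n) auto
  qed
  show ?thesis
  proof (cases "r = 0")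
    case True
    \<comment> \<open>The graph H without vertices is contained in every graph, so the answer is
      always no, and \<open>out\<close> is 0 from the start.\<close>
    have no: "\<not> has_free_bipartition G H" if "pair_graph G" for G :: "nat pair_pre_digraph"
      unfolding has_free_bipartition_def
      using contains_subgraph_iff[OF that assms(1) _ e] True by auto
    show ?thesis
    proof (intro exI allI conjI impI; (elim conjE)?)
      show "(\<lambda>_. 0) \<in> O(\<lambda>t. real t ^ r)" by simp
      fix K :: real and G T :: "nat pair_pre_digraph" and rt X and t n :: nat and s
      assume a: "pair_graph G" "nice_tree_decomposition G T rt X" "real (card (pverts T)) \<le> K * real n"
        and init: "initial_state G T rt X s"
      show "runs Skip s 1 s" by (rule runs.Skip)
      show "reg s ''out'' = (if has_free_bipartition G H then 1 else 0)"
        using no[OF a(1)] init by (simp add: initial_state_def)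
      show "real 1 \<le> 2 powr 0 * real n"
        using nodes(2)[OF a(2,3)] by simp
    qed
  next
    case False
    then have r: "1 \<le> r" by simp
    have "finite {(h, h'). h < r \<and> h' < r \<and> (e h, e h') \<in> parcs H}"
      by (rule finite_subset[of _ "{..<r} \<times> {..<r}"]) auto
    then obtain es where es: "set es = {(h, h'). h < r \<and> h' < r \<and> (e h, e h') \<in> parcs H}"
      using finite_list by blast
    let ?C = "total_const r es" and ?D = "total_degree r es"
    \<comment> \<open>The constant \<open>K\<close> enters only through an additive logarithm. The
      second summand bounds the exponent of \<open>Q ^ ?D\<close>, as
      \<open>Q = 2 ^ (2 * B ^ r)\<close> and \<open>B \<le> t + 3\<close>.\<close>
    define f where "f = (\<lambda>K t. log 2 (real ?C * (1 + \<bar>K\<bar>)) + (2 * real ?D) * (real t + 3) ^ r)"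
    have bigo: "f K \<in> O(\<lambda>t. real t ^ r)" for K
      unfolding f_def by (rule exponent_bigo)
    have key: "\<exists>k s'. runs (partition_prog r es) s k s' \<and>
        reg s' ''out'' = (if has_free_bipartition G H then 1 else 0) \<and> real k \<le> 2 powr f K t * real n"
      if G: "pair_graph G" and n: "card (pverts G) = n" and nice: "nice_tree_decomposition G T rt X"
        and w: "width T X \<le> int t" and K: "real (card (pverts T)) \<le> K * real n"
        and init: "initial_state G T rt X s"
      for G T :: "nat pair_pre_digraph" and rt X and t n :: nat and s and K :: real
    proof -
      let ?m = "card (pverts T)"
      have td: "tree_decomposition G T X" using nice by (simp add: nice_tree_decomposition_def)
      obtain B Q where B: "\<forall>i \<in> pverts T. card (X i) \<le> B" "2 \<le> B"
          "\<forall>W. (\<forall>i \<in> pverts T. card (X i) \<le> W) \<longrightarrow> B \<le> W + 2" and Q: "Q = 2 ^ (2 * B ^ r)"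
        and run: "tri (partition_prog r es) s (run_time r es (card (pverts G)) ?m (card (parcs G)) Q)
          (\<lambda>s'. reg s' ''out'' = (if has_free_bipartition G H then 1 else 0))"
        using program_correct[OF r G assms(1) e es nice init] by (elim exE conjE) (rule that)
      have "B \<le> Q"
      proof -
        have "B ^ 1 \<le> B ^ r" using r B(2) by (intro power_increasing) auto
        moreover have "2 * B ^ r \<le> Q" unfolding Q by (rule less_imp_le[OF less_exp])
        ultimately show ?thesis by simp
      qed
      have arcs: "card (parcs G) \<le> ?m * (Q * Q)"
        using card_parcs_le[OF td G, of Q] B(1) \<open>B \<le> Q\<close> by (meson le_trans)
      have Q1: "1 \<le> Q" by (simp add: Q)
      have "tri (partition_prog r es) s (?C * ((n + ?m) * Q ^ ?D))
          (\<lambda>s'. reg s' ''out'' = (if has_free_bipartition G H then 1 else 0))"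
        using total_cost[OF Q1 nodes(1)[OF nice K] arcs, where n = "card (pverts G)" and r = r and es = es]
        unfolding n by (rule tri_mono[OF run[unfolded n]])
      then obtain k s' where k: "runs (partition_prog r es) s k s'" "k \<le> ?C * ((n + ?m) * Q ^ ?D)"
        "reg s' ''out'' = (if has_free_bipartition G H then 1 else 0)"
        unfolding tri_def by (elim exE conjE) (rule that)
      have "card (X i) \<le> t + 1" if "i \<in> pverts T" for i
      proof -
        have "card (X i) \<le> Max ((\<lambda>i. card (X i)) ` pverts T)"
          using that nodes(3)[OF nice K] by (intro Max_ge) auto
        then show ?thesis using w by (simp add: width_def)
      qed
      \<comment> \<open>Bags have at most \<open>t + 1\<close> vertices, and the digits 0 and 1 add
        two.\<close>
      then have "B \<le> t + 3" using B(3)[rule_format, of "t + 1"] by simp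
      then have "B ^ r \<le> (t + 3) ^ r" by (rule power_mono) simp
      then have "Q ^ ?D \<le> 2 ^ (2 * ?D * (t + 3) ^ r)"
        unfolding Q power_mult[symmetric] by (intro power_increasing) auto
      then have QD: "real (Q ^ ?D) \<le> 2 powr ((2 * real ?D) * (real t + 3) ^ r)"
        by (simp add: powr_realpow[symmetric] flip: of_nat_le_iff[where 'a = real])
      have nm: "real (n + ?m) \<le> (1 + \<bar>K\<bar>) * real n"
        using K abs_ge_self[of K] mult_right_mono[of K "\<bar>K\<bar>" "real n"] by (simp add: algebra_simps)
      have "real k \<le> real ?C * (real (n + ?m) * real (Q ^ ?D))"
        using k(2) by (metis of_nat_le_iff of_nat_mult)
      also have "\<dots> \<le> real ?C * (((1 + \<bar>K\<bar>) * real n) * 2 powr ((2 * real ?D) * (real t + 3) ^ r))"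
        using nm QD by (intro mult_left_mono mult_mono) auto
      also have "\<dots> = 2 powr f K t * real n"
      proof -
        have "0 < real ?C * (1 + \<bar>K\<bar>)" by (simp add: total_const_def)
        then show ?thesis by (simp add: f_def powr_add)
      qed
      finally show ?thesis using k by blast
    qed
    show ?thesis
      by (rule exI[of _ "partition_prog r es"], rule allI, rule exI[of _ "f K" for K],
        intro conjI bigo allI impI, elim conjE, rule key)
  qed
qed

end
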